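(* The following pairs $(K,L)$ of number fields are Sylow-conjugate but not isomorphic: (a) $K=\mathbb{Q}(\alpha)$ and $L=\mathbb{Q}(\beta)$, where $\alpha,\beta\in\overline{\mathbb{Q}}$ are roots of $p_7(x)$ and $q_7(x)$, respectively, with $$p_7(x)=x^7-7x+3,\qquad q_7(x)=x^7+14x^4-42x^2-21x+9.$$ (b) $K=\mathbb{Q}(\alpha)$ and $L=\mathbb{Q}(\beta)$, where $\alpha,\beta\in\overline{\mathbb{Q}}$ are roots of $p_8(x)$ and $q_8(x)$, respectively, with $$p_8(x)=x^8-4x^7-4x^6+26x^5+2x^4-52x^3+31x+1,$$ $$q_8(x)=x^8+12x^7+30x^6-108x^5-402x^4+342x^3+1256x^2-687x-337.$$
   Context: Fix an algebraic closure $\overline{\mathbb{Q}}$ of $\mathbb{Q}$. A number field is a finite extension of $\mathbb{Q}$ contained in $\overline{\mathbb{Q}}$, and $\mathrm{Gal}(K)=\mathrm{Gal}(\overline{\mathbb{Q}}/K)$ denotes the absolute Galois group of a number field $K$. Two number fields $K$ and $L$ are called Sylow-conjugate if for every prime $p$, the $p$-Sylow subgroups of the profinite groups $\mathrm{Gal}(K)$ and $\mathrm{Gal}(L)$ are conjugate in $\mathrm{Gal}(\mathbb{Q})$. *)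

theory Defs
  imports
    "HOL-Analysis.Abstract_Topology"
    "HOL-Computational_Algebra.Computational_Algebra"
    "HOL-Algebra.Algebra"
    "HOL-Algebra.Algebraic_Closure_Type"
begin

(* Throughout, the type 'q plays the role of the fixed algebraic closure of the rationals, and its
   subfields are subsets of 'q.  That 'q really is an algebraic closure (algebraically closed, of
   characteristic 0, every element algebraic over the rationals) is imposed where it is used. *)

definition finite_field_extension :: "'q::field_char_0 set \<Rightarrow> 'q set \<Rightarrow> bool" where
  "finite_field_extension K E \<longleftrightarrow>
     subfield K ring_of_type_algebra \<and> subfield E ring_of_type_algebra \<and> K \<subseteq> E \<and>
     ring.finite_dimension ring_of_type_algebra K E"

definition number_field :: "'q::field_char_0 set \<Rightarrow> bool" where
  "number_field K \<longleftrightarrow> finite_field_extension \<rat> K"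

definition rat_adjoin :: "'q::field_char_0 \<Rightarrow> 'q set" where
  "rat_adjoin a = generate_field ring_of_type_algebra (insert a \<rat>)"

definition subfields_isomorphic :: "'q::field_char_0 set \<Rightarrow> 'q set \<Rightarrow> bool" where
  "subfields_isomorphic K L \<longleftrightarrow>
     (ring_of_type_algebra \<lparr>carrier := K\<rparr> :: 'q ring) \<simeq> ring_of_type_algebra \<lparr>carrier := L\<rparr>"

definition Gal :: "'q::field_char_0 set \<Rightarrow> ('q \<Rightarrow> 'q) monoid" where
  "Gal K = \<lparr>carrier = {\<sigma> \<in> ring_iso ring_of_type_algebra ring_of_type_algebra. \<forall>x\<in>K. \<sigma> x = x},
            monoid.mult = (\<circ>), one = id\<rparr>"

(* The Krull topology: the subgroups fixing a finite extension E of K are a basis of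
   neighbourhoods of the identity. *)
definition krull_topology :: "'q::field_char_0 set \<Rightarrow> ('q \<Rightarrow> 'q) topology" where
  "krull_topology K =
     topology_generated_by
       {\<sigma> <#\<^bsub>Gal K\<^esub> carrier (Gal E) | \<sigma> E. \<sigma> \<in> carrier (Gal K) \<and> finite_field_extension K E}"

definition open_normal_subgroup :: "('g, 'b) monoid_scheme \<Rightarrow> 'g topology \<Rightarrow> 'g set \<Rightarrow> bool" where
  "open_normal_subgroup G T U \<longleftrightarrow> U \<lhd> G \<and> openin T U"

(* The following two notions are meant for a profinite group G with topology T. *)
definition pro_p_group :: "nat \<Rightarrow> ('g, 'b) monoid_scheme \<Rightarrow> 'g topology \<Rightarrow> bool" where
  "pro_p_group p G T \<longleftrightarrow> (\<forall>U. open_normal_subgroup G T U \<longrightarrow> (\<exists>n. Coset.order (G Mod U) = p ^ n))"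

(* A p-Sylow subgroup of a profinite group is a closed pro-p subgroup P whose index (G : P) is prime
   to p.  This index is the supernatural number lcm of the finite indices (G : P U), where U ranges
   over the open normal subgroups of G; it is prime to p iff p divides none of these indices. *)
definition sylow_subgroup ::
  "nat \<Rightarrow> ('g, 'b) monoid_scheme \<Rightarrow> 'g topology \<Rightarrow> 'g set \<Rightarrow> bool" where
  "sylow_subgroup p G T P \<longleftrightarrow>
     subgroup P G \<and> closedin T P \<and>
     pro_p_group p (G \<lparr>carrier := P\<rparr>) (subtopology T P) \<and>
     (\<forall>U. open_normal_subgroup G T U \<longrightarrow> \<not> p dvd card (rcosets\<^bsub>G\<^esub> (P <#>\<^bsub>G\<^esub> U)))"

definition conjugate_subgroups :: "('g, 'b) monoid_scheme \<Rightarrow> 'g set \<Rightarrow> 'g set \<Rightarrow> bool" where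
  "conjugate_subgroups G P Q \<longleftrightarrow>
     (\<exists>g\<in>carrier G. Q = (\<lambda>x. g \<otimes>\<^bsub>G\<^esub> x \<otimes>\<^bsub>G\<^esub> inv\<^bsub>G\<^esub> g) ` P)"

definition sylow_conjugate :: "'q::field_char_0 set \<Rightarrow> 'q set \<Rightarrow> bool" where
  "sylow_conjugate K L \<longleftrightarrow>
     (\<forall>p::nat. Factorial_Ring.prime p \<longrightarrow>
        (\<forall>P Q. sylow_subgroup p (Gal K) (krull_topology K) P \<longrightarrow>
               sylow_subgroup p (Gal L) (krull_topology L) Q \<longrightarrow>
               conjugate_subgroups (Gal \<rat>) P Q))"

end

theory Submission
  imports Defs "HOL-Analysis.Function_Topology" "HOL-Number_Theory.Cong"
begin

text \<open>
Every automorphism of the algebraic closure fixes the rationals, the automorphisms permute the roots of an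
irreducible integer polynomial transitively (\<open>aut_orbit_root\<close>), and the Galois group of the field generated by
\<open>\<alpha>\<close> is the stabilizer of \<open>\<alpha>\<close>. Both parts of the theorem therefore are about the action on the roots.

Let \<open>\<alpha>\<close> and \<open>\<beta>\<close> be roots of irreducible polynomials \<open>p\<close> and \<open>q\<close> of the same degree. Suppose that over the field
generated by \<open>\<alpha>\<close> the polynomial \<open>q\<close> has a factor whose degree is not divisible by the prime \<open>l\<close>. The stabilizer of
\<open>\<alpha>\<close> permutes the roots of this factor, and some root \<open>\<beta>'\<close> has an orbit of size prime to \<open>l\<close>. Hence the common
stabilizer of \<open>\<alpha>\<close> and \<open>\<beta>'\<close> has index prime to \<open>l\<close> in the stabilizer of \<open>\<alpha>\<close>, and then also in that of \<open>\<beta>'\<close>, because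
both stabilizers have the same index in the whole group. So the three groups share an \<open>l\<close>-Sylow subgroup. In a finite
group this is \<open>stabilizer_sylow_conjugate\<close>; it applies to the permutations of each finite stable set of algebraic
numbers, and compactness passes to the profinite group (\<open>sylow_conjugateI\<close>). In the two cases at hand, \<open>q\<close> has
factors of degrees \<open>3\<close> and \<open>4\<close>, respectively \<open>2\<close>, \<open>3\<close> and \<open>3\<close> (\<open>factorization_q7\<close>, \<open>factorization_q8\<close>), and two
coprime degrees take care of all primes (\<open>sylow_conjugate_roots\<close>).

If the two fields were isomorphic, then \<open>q\<close>, and thus one of these factors, would have a root in the field generated by
\<open>\<alpha>\<close>. Reduction at a suitable prime ideal of degree one shows that it has none (\<open>no_root_by_place\<close>). Here it is essential
to reduce the factors: the two fields are arithmetically equivalent, so that \<open>q\<close> has a root modulo almost every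
prime modulo which \<open>p\<close> has one.
\<close>

section \<open>Sylow subgroups of finite groups\<close>

lemma (in group_action) prime_dvd_card_if_dvd_orbits:
  assumes "finite E" and "\<And>x. x \<in> E \<Longrightarrow> p dvd card (orbit G \<phi> x)"
  shows "p dvd card E"
proof -
  have "(\<Sum>orb\<in>orbits G E \<phi>. card orb) = card E"
    using disjoint_sum[OF assms(1), of "\<lambda>_. 1::nat"] by simp
  moreover have "p dvd (\<Sum>orb\<in>orbits G E \<phi>. card orb)"
    using assms(2) by (intro dvd_sum) (auto simp: orbits_def)
  ultimately show ?thesis by simp
qed

lemma (in group_action) p_group_fixed_point:
  assumes "Coset.order G = p ^ n" "Factorial_Ring.prime (p::nat)" "finite E" "\<not> p dvd card E"
  shows "\<exists>x\<in>E. \<forall>g\<in>carrier G. \<phi> g x = x"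
proof -
  obtain x where x: "x \<in> E" "\<not> p dvd card (orbit G \<phi> x)"
    using prime_dvd_card_if_dvd_orbits[OF assms(3)] assms(4) by blast
  have "card (orbit G \<phi> x) dvd p ^ n"
    using orbit_stabilizer_theorem[OF x(1)] assms(1) by (metis dvd_triv_left)
  then obtain i where "card (orbit G \<phi> x) = p ^ i"
    using divides_primepow_nat[OF assms(2)] by blast
  with x(2) have "card (orbit G \<phi> x) = 1"
    by (cases i) auto
  then obtain z where z: "orbit G \<phi> x = {z}" by (auto simp: card_1_singleton_iff)
  moreover have "x \<in> orbit G \<phi> x" using orbit_refl x(1) by auto
  ultimately have "orbit G \<phi> x = {x}" by auto
  then show ?thesis using x(1) by (auto simp: orbit_def)
qed

text \<open>The elements of an action homomorphism into \<^const>\<open>BijGroup\<close> have to be extensional, hence the restriction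
to \<open>E\<close>.\<close>

lemma group_actionI:
  fixes G (structure)
  assumes "group G"
    and closed: "\<And>g x. g \<in> carrier G \<Longrightarrow> x \<in> E \<Longrightarrow> act g x \<in> E"
    and one: "\<And>x. x \<in> E \<Longrightarrow> act \<one>\<^bsub>G\<^esub> x = x"
    and mult: "\<And>g h x. g \<in> carrier G \<Longrightarrow> h \<in> carrier G \<Longrightarrow> x \<in> E \<Longrightarrow> act (g \<otimes>\<^bsub>G\<^esub> h) x = act g (act h x)"
  shows "group_action G E (\<lambda>g. restrict (act g) E)"
proof -
  interpret group G by fact
  have bij: "restrict (act g) E \<in> Bij E" if g: "g \<in> carrier G" for g
  proof -
    have "bij_betw (act g) E E"
    proof (rule bij_betwI[where g = "act (inv g)"])
      show "act g \<in> E \<rightarrow> E" "act (inv g) \<in> E \<rightarrow> E" using closed g by auto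
      show "act (inv g) (act g x) = x" if "x \<in> E" for x
        using mult[of "inv g" g x] one[of x] g that by simp
      show "act g (act (inv g) x) = x" if "x \<in> E" for x
        using mult[of g "inv g" x] one[of x] g that by simp
    qed
    then have "bij_betw (restrict (act g) E) E E"
      by (rule bij_betw_cong[THEN iffD1, rotated]) simp
    then show ?thesis by (simp add: Bij_def)
  qed
  have "(\<lambda>g. restrict (act g) E) \<in> hom G (BijGroup E)"
  proof (rule homI)
    show "restrict (act g) E \<in> carrier (BijGroup E)" if "g \<in> carrier G" for g
      using bij that by (simp add: BijGroup_def)
    show "restrict (act (g \<otimes> h)) E = restrict (act g) E \<otimes>\<^bsub>BijGroup E\<^esub> restrict (act h) E"
      if gh: "g \<in> carrier G" "h \<in> carrier G" for g h
    proof -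
      have "restrict (act (g \<otimes> h)) E = compose E (restrict (act g) E) (restrict (act h) E)"
        unfolding compose_def using mult[OF gh] closed[OF gh(2)] by (intro restrict_ext) simp
      then show ?thesis using bij[OF gh(1)] bij[OF gh(2)] by (simp add: BijGroup_def)
    qed
  qed
  then show ?thesis
    by (simp add: group_action_def group_hom_def group_hom_axioms_def group_BijGroup group_axioms)
qed

text \<open>Sylow's second theorem: the \<open>p\<close>-group \<open>R\<close> permutes the cosets of \<open>P\<close>, whose number is prime to \<open>p\<close>, so it fixes
some coset \<open>P a\<close>, and that says that \<open>a R a^(-1)\<close> lies in \<open>P\<close>.\<close>

lemma (in group) p_subgroup_conjugate_into_sylow:
  assumes fin: "finite (carrier G)" and p: "Factorial_Ring.prime (p::nat)"
    and P: "subgroup P G" "\<not> p dvd card (rcosets P)"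
    and R: "subgroup R G" "card R = p ^ n"
  shows "\<exists>g\<in>carrier G. (\<lambda>x. g \<otimes> x \<otimes> inv g) ` R \<subseteq> P"
proof -
  let ?act = "\<lambda>r C. C #> inv r"
  have Pc: "P \<subseteq> carrier G" and Rc: "R \<subseteq> carrier G"
    using subgroup.subset P R by blast+
  have sub: "C \<subseteq> carrier G" if "C \<in> rcosets P" for C
    using that rcosets_part_G[OF P(1)] by blast
  have "group_action (G\<lparr>carrier := R\<rparr>) (rcosets P) (\<lambda>g. restrict (?act g) (rcosets P))"
  proof (rule group_actionI)
    show "group (G\<lparr>carrier := R\<rparr>)" by (rule subgroup.subgroup_is_group[OF R(1) group_axioms])
    fix r C assume r: "r \<in> carrier (G\<lparr>carrier := R\<rparr>)" and C: "C \<in> rcosets P"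
    then obtain a where a: "a \<in> carrier G" "C = P #> a" by (auto simp: RCOSETS_def)
    have rc: "inv r \<in> carrier G" using r Rc by auto
    have "C #> inv r = P #> (a \<otimes> inv r)"
      unfolding a(2) by (rule coset_mult_assoc[OF Pc a(1) rc])
    moreover have "a \<otimes> inv r \<in> carrier G" using a(1) rc by simp
    ultimately show "C #> inv r \<in> rcosets P"
      unfolding RCOSETS_def by blast
  next
    fix C assume C: "C \<in> rcosets P"
    show "C #> inv \<one>\<^bsub>G\<lparr>carrier := R\<rparr>\<^esub> = C"
      using sub[OF C] by (simp add: coset_mult_one)
  next
    fix g h C assume *: "g \<in> carrier (G\<lparr>carrier := R\<rparr>)" "h \<in> carrier (G\<lparr>carrier := R\<rparr>)" "C \<in> rcosets P"
    then have gh: "g \<in> carrier G" "h \<in> carrier G" using Rc by auto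
    then have "C #> inv h #> inv g = C #> (inv h \<otimes> inv g)"
      using coset_mult_assoc[OF sub[OF *(3)], of "inv h" "inv g"] by simp
    with gh show "C #> inv (g \<otimes>\<^bsub>G\<lparr>carrier := R\<rparr>\<^esub> h) = C #> inv h #> inv g"
      by (simp add: inv_mult_group)
  qed
  moreover have "finite (rcosets P)"
    using fin Pc by (auto simp: RCOSETS_def)
  moreover have "Coset.order (G\<lparr>carrier := R\<rparr>) = p ^ n"
    using R(2) by (simp add: Coset.order_def)
  ultimately have "\<exists>C\<in>rcosets P. \<forall>r\<in>carrier (G\<lparr>carrier := R\<rparr>). restrict (?act r) (rcosets P) C = C"
    by (intro group_action.p_group_fixed_point[OF _ _ p _ P(2)])
  then obtain C where C: "C \<in> rcosets P"
      and fixed: "\<forall>r\<in>R. restrict (?act r) (rcosets P) C = C"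
    by auto
  obtain a where a: "a \<in> carrier G" "C = P #> a" using C by (auto simp: RCOSETS_def)
  have "a \<otimes> r \<otimes> inv a \<in> P" if r: "r \<in> R" for r
  proof -
    have ri: "inv r \<in> R" using r subgroup.m_inv_closed[OF R(1)] by auto
    have rc: "r \<in> carrier G" using r Rc by blast
    have "C #> inv (inv r) = C" using fixed[rule_format, OF ri] C by simp
    then have "P #> (a \<otimes> r) = P #> a"
      using coset_mult_assoc[OF Pc a(1) rc] a(2) rc by simp
    then have "a \<otimes> r \<in> P #> a"
      using rcos_self[OF m_closed[OF a(1) rc] P(1)] by simp
    then obtain h where h: "h \<in> P" "a \<otimes> r = h \<otimes> a" by (auto simp: r_coset_def)
    have hc: "h \<in> carrier G" using h(1) Pc by blast
    have "a \<otimes> r \<otimes> inv a = h" using h(2) hc a(1) by (simp add: m_assoc)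
    then show ?thesis using h(1) by simp
  qed
  then show ?thesis using a(1) by blast
qed

lemma (in group) card_conjugate:
  assumes "g \<in> carrier G" "R \<subseteq> carrier G"
  shows "card ((\<lambda>x. g \<otimes> x \<otimes> inv g) ` R) = card R"
proof (rule card_image, rule inj_onI)
  fix x y assume "x \<in> R" "y \<in> R" and eq: "g \<otimes> x \<otimes> inv g = g \<otimes> y \<otimes> inv g"
  then have "x \<in> carrier G" "y \<in> carrier G" using assms(2) by auto
  then show "x = y" using eq assms(1) by simp
qed

lemma (in group) sylow_subgroups_conjugate:
  assumes fin: "finite (carrier G)" and p: "Factorial_Ring.prime (p::nat)"
    and A: "subgroup A G" "card A = p ^ a * m" "\<not> p dvd m"
    and P: "subgroup P G" "P \<subseteq> A" "card P = p ^ a"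
    and R: "subgroup R G" "R \<subseteq> A" "card R = p ^ a"
  shows "\<exists>g\<in>A. (\<lambda>x. g \<otimes> x \<otimes> inv g) ` R = P"
proof -
  let ?A = "G\<lparr>carrier := A\<rparr>"
  have Ac: "A \<subseteq> carrier G" using A(1) subgroup.subset by blast
  interpret A: group ?A by (rule subgroup.subgroup_is_group[OF A(1) group_axioms])
  have finA: "finite A" using fin Ac finite_subset by blast
  have PA: "subgroup P ?A" and RA: "subgroup R ?A"
    using subgroup_incl P R A by auto
  have "card (rcosets\<^bsub>?A\<^esub> P) * p ^ a = p ^ a * m"
    using A.lagrange[OF PA] P(3) A(2) by (simp add: Coset.order_def)
  then have "card (rcosets\<^bsub>?A\<^esub> P) = m"
    using prime_gt_0_nat[OF p] by simp
  then obtain g where g: "g \<in> A" and sub: "(\<lambda>x. g \<otimes> x \<otimes> inv\<^bsub>?A\<^esub> g) ` R \<subseteq> P"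
    using A.p_subgroup_conjugate_into_sylow[of p P R a] finA p PA RA R(3) A(3) by auto
  have inv: "inv\<^bsub>?A\<^esub> g = inv g" using m_inv_consistent[OF A(1) g] by simp
  have "(\<lambda>x. g \<otimes> x \<otimes> inv g) ` R = P"
  proof (rule card_seteq)
    show "finite P" using finA P(2) finite_subset by blast
    show "(\<lambda>x. g \<otimes> x \<otimes> inv g) ` R \<subseteq> P" using sub inv by simp
    show "card P \<le> card ((\<lambda>x. g \<otimes> x \<otimes> inv g) ` R)"
      using card_conjugate[of g R] subsetD[OF Ac g] subset_trans[OF R(2) Ac] R(3) P(3) by simp
  qed
  then show ?thesis using g by blast
qed

lemma (in group) conjugate_subgroup:
  assumes "subgroup H G" "g \<in> carrier G"
  shows "subgroup ((\<lambda>x. g \<otimes> x \<otimes> inv g) ` H) G"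
proof -
  interpret H: subgroup H G by fact
  show ?thesis
  proof (rule subgroupI)
    show "(\<lambda>x. g \<otimes> x \<otimes> inv g) ` H \<subseteq> carrier G" using assms(2) by auto
    show "(\<lambda>x. g \<otimes> x \<otimes> inv g) ` H \<noteq> {}" using H.one_closed by blast
    show "inv a \<in> (\<lambda>x. g \<otimes> x \<otimes> inv g) ` H" if a: "a \<in> (\<lambda>x. g \<otimes> x \<otimes> inv g) ` H" for a
    proof -
      obtain h where h: "h \<in> H" "a = g \<otimes> h \<otimes> inv g" using a by blast
      then have hc: "h \<in> carrier G" by (intro H.mem_carrier)
      have "inv a = g \<otimes> inv h \<otimes> inv g"
        unfolding h(2) using assms(2) hc by (simp add: inv_mult_group m_assoc)
      then show ?thesis using h by blast
    qed
    show "a \<otimes> b \<in> (\<lambda>x. g \<otimes> x \<otimes> inv g) ` H"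
      if ab: "a \<in> (\<lambda>x. g \<otimes> x \<otimes> inv g) ` H" "b \<in> (\<lambda>x. g \<otimes> x \<otimes> inv g) ` H" for a b
    proof -
      obtain h k where h: "h \<in> H" "a = g \<otimes> h \<otimes> inv g" "k \<in> H" "b = g \<otimes> k \<otimes> inv g"
        using ab by blast
      then have hk: "h \<in> carrier G" "k \<in> carrier G" by (blast intro: H.mem_carrier)+
      have "a \<otimes> b = g \<otimes> (h \<otimes> k) \<otimes> inv g"
        unfolding h(2,4) using assms(2) hk by (simp add: m_assoc) (simp add: m_assoc[symmetric])
      then show ?thesis using H.m_closed[OF h(1,3)] by blast
    qed
  qed
qed

lemma (in group) conjugate_conjugate:
  assumes "g \<in> carrier G" "h \<in> carrier G" "H \<subseteq> carrier G"
  shows "(\<lambda>x. g \<otimes> x \<otimes> inv g) ` (\<lambda>x. h \<otimes> x \<otimes> inv h) ` H = (\<lambda>x. (g \<otimes> h) \<otimes> x \<otimes> inv (g \<otimes> h)) ` H"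
  unfolding image_image
proof (rule image_cong[OF refl])
  fix x assume "x \<in> H"
  then have "x \<in> carrier G" using assms(3) by blast
  then show "g \<otimes> (h \<otimes> x \<otimes> inv h) \<otimes> inv g = g \<otimes> h \<otimes> x \<otimes> inv (g \<otimes> h)"
    using assms(1,2) by (simp add: m_assoc inv_mult_group)
qed

text \<open>This is the finite heart of the matter. The common stabilizer \<open>C\<close> of \<open>x\<close> and \<open>y'\<close> has index prime to \<open>p\<close> in the
stabilizer of \<open>x\<close>, this index being the size of an orbit. Because \<open>x\<close> and \<open>y'\<close> have orbits of the same size, their
stabilizers have the same order, and so \<open>C\<close> also has index prime to \<open>p\<close> in the stabilizer of \<open>y'\<close>. A Sylow subgroup
of \<open>C\<close> is therefore a Sylow subgroup of both, and links \<open>P\<close> with a conjugate of \<open>Q\<close>.\<close>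

lemma (in group_action) stabilizer_sylow_conjugate:
  assumes fin: "finite (carrier G)" and p: "Factorial_Ring.prime (p::nat)"
    and xy: "x \<in> E" "y \<in> E" "card (orbit G \<phi> x) = card (orbit G \<phi> y)"
    and y': "y' \<in> orbit G \<phi> y" "\<not> p dvd card ((\<lambda>g. \<phi> g y') ` stabilizer G \<phi> x)"
    and P: "subgroup P G" "P \<subseteq> stabilizer G \<phi> x" "card P = p ^ a"
           "card (stabilizer G \<phi> x) = p ^ a * m" "\<not> p dvd m"
    and Q: "subgroup Q G" "Q \<subseteq> stabilizer G \<phi> y" "card Q = p ^ b"
           "card (stabilizer G \<phi> y) = p ^ b * k" "\<not> p dvd k"
  shows "\<exists>g\<in>carrier G. Q = (\<lambda>x. g \<otimes> x \<otimes> inv g) ` P"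
proof -
  interpret group G by (rule group_hom.axioms(1)[OF group_hom])
  define A where "A = stabilizer G \<phi> x"
  define B where "B = stabilizer G \<phi> y"
  define B' where "B' = stabilizer G \<phi> y'"
  obtain h where h: "h \<in> carrier G" "y' = \<phi> h y" using y'(1) by (auto simp: orbit_def)
  have y'E: "y' \<in> E" using element_image[OF h(1) xy(2)] h(2) by simp
  have sub: "subgroup A G" "subgroup B G" "subgroup B' G"
    using stabilizer_subgroup xy y'E by (auto simp: A_def B_def B'_def)
  have Ac: "A \<subseteq> carrier G" "B \<subseteq> carrier G" "B' \<subseteq> carrier G" using sub subgroup.subset by blast+
  have finA: "finite A" using Ac fin finite_subset by blast
  have inj: "card (orbit G \<phi> x) > 0" 
    using fin orbit_refl[OF xy(1)] by (auto simp: card_gt_0_iff orbit_def)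
  have AB: "card A = card B"
    using orbit_stabilizer_theorem[OF xy(1)] orbit_stabilizer_theorem[OF xy(2)] xy(3) inj
    unfolding A_def B_def by (metis mult_cancel1 not_gr_zero)
  have conjB: "h \<otimes> g \<otimes> inv h \<in> B'" if "g \<in> B" for g
  proof -
    have gy: "g \<in> carrier G" "\<phi> g y = y" using that by (auto simp: B_def stabilizer_def)
    have "\<phi> (h \<otimes> g \<otimes> inv h) y' = \<phi> (h \<otimes> g \<otimes> inv h) (\<phi> h y)" by (simp add: h)
    also have "\<dots> = \<phi> ((h \<otimes> g \<otimes> inv h) \<otimes> h) y" 
      using composition_rule[OF xy(2), of "h \<otimes> g \<otimes> inv h" h] gy h(1) by simp
    also have "(h \<otimes> g \<otimes> inv h) \<otimes> h = h \<otimes> g" using h(1) gy(1) by (simp add: m_assoc)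
    also have "\<phi> (h \<otimes> g) y = y'" using composition_rule[OF xy(2), of h g] gy h by simp
    finally show ?thesis using gy h by (simp add: B'_def stabilizer_def)
  qed
  have orby: "orbit G \<phi> y' = orbit G \<phi> y"
  proof -
    have "y' \<in> orbit G \<phi> y'" using orbit_refl[OF y'E] by simp
    then have "orbit G \<phi> y \<inter> orbit G \<phi> y' \<noteq> {}" using y'(1) by blast
    moreover have "orbit G \<phi> y \<in> orbits G E \<phi>" "orbit G \<phi> y' \<in> orbits G E \<phi>"
      using xy y'E by (auto simp: orbits_def)
    ultimately show ?thesis using disjoint_union by blast
  qed
  have BB': "card B' = card A"
    using orbit_stabilizer_theorem[OF xy(1)] orbit_stabilizer_theorem[OF y'E] xy(3) inj orby
    unfolding A_def B'_def by (metis mult_cancel1 not_gr_zero)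
  have "p ^ a * m = p ^ b * k" using P(4) Q(4) AB by (simp add: A_def B_def)
  moreover have mult: "multiplicity p (p ^ i * j) = i" if "\<not> p dvd j" for i j
  proof -
    have "j \<noteq> 0" using that by (intro notI) simp
    then show ?thesis using p that
      by (simp add: prime_elem_multiplicity_mult_distrib not_dvd_imp_multiplicity_0)
  qed
  ultimately have ab: "a = b"
    using mult[OF P(5), of a] mult[OF Q(5), of b] by simp
  define C where "C = A \<inter> B'"
  have subC: "subgroup C G" using sub subgroups_Inter_pair by (auto simp: C_def)
  let ?A = "G\<lparr>carrier := A\<rparr>"
  have actA: "group_action ?A E \<phi>"
    using induced_action[OF sub(1)] by simp
  have "orbit ?A \<phi> y' = (\<lambda>g. \<phi> g y') ` A" by (auto simp: orbit_def)
  moreover have "stabilizer ?A \<phi> y' = C" using Ac by (auto simp: stabilizer_def C_def B'_def)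
  ultimately have "card ((\<lambda>g. \<phi> g y') ` A) * card C = card A"
    using group_action.orbit_stabilizer_theorem[OF actA y'E] by (simp add: Coset.order_def)
  then have oc: "card ((\<lambda>g. \<phi> g y') ` A) * card C = p ^ a * m" using P(4) by (simp add: A_def)
  have "coprime (p ^ a) (card ((\<lambda>g. \<phi> g y') ` A))"
    using y'(2) p by (simp add: A_def prime_imp_coprime)
  then have "p ^ a dvd card C" using oc by (metis coprime_dvd_mult_right_iff dvd_triv_left)
  then obtain c where c: "card C = p ^ a * c" by blast
  interpret C: group "G\<lparr>carrier := C\<rparr>" by (rule subgroup.subgroup_is_group[OF subC group_axioms])
  obtain R where R0: "subgroup R (G\<lparr>carrier := C\<rparr>)" and Rc: "card R = p ^ a"
    using sylow_thm[OF p C.group_axioms, of a c] c finA by (auto simp: Coset.order_def C_def)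
  have R: "subgroup R G" using incl_subgroup[OF subC R0] .
  have RC: "R \<subseteq> C" using subgroup.subset[OF R0] by simp
  obtain g1 where g1: "g1 \<in> A" "(\<lambda>x. g1 \<otimes> x \<otimes> inv g1) ` P = R"
    using sylow_subgroups_conjugate[OF fin p sub(1), of a m R P] P R Rc RC
    by (auto simp: A_def C_def)
  define Q' where "Q' = (\<lambda>x. h \<otimes> x \<otimes> inv h) ` Q"
  have Qc: "Q \<subseteq> carrier G" and Pc: "P \<subseteq> carrier G" using P Q subgroup.subset by blast+
  have Q': "subgroup Q' G" "card Q' = p ^ a" "Q' \<subseteq> B'"
    using conjugate_subgroup[OF Q(1) h(1)] card_conjugate[OF h(1) Qc] conjB Q ab
    by (auto simp: Q'_def B_def)
  have "card B' = p ^ a * m" using BB' P(4) by (simp add: A_def)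
  then obtain g2 where g2: "g2 \<in> B'" "(\<lambda>x. g2 \<otimes> x \<otimes> inv g2) ` R = Q'"
    using sylow_subgroups_conjugate[OF fin p sub(3), of a m Q' R] Q' R Rc RC P(5)
    by (auto simp: C_def)
  have g: "g1 \<in> carrier G" "g2 \<in> carrier G" using g1 g2 Ac by auto
  have "(\<lambda>x. (g2 \<otimes> g1) \<otimes> x \<otimes> inv (g2 \<otimes> g1)) ` P = Q'"
    using g1(2) g2(2) conjugate_conjugate[OF g(2,1) Pc] by simp
  moreover have "(\<lambda>x. inv h \<otimes> x \<otimes> inv (inv h)) ` Q' = Q"
  proof -
    have "(\<lambda>x. inv h \<otimes> x \<otimes> inv (inv h)) ` Q' = (\<lambda>x. \<one> \<otimes> x \<otimes> inv \<one>) ` Q"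
      using conjugate_conjugate[OF inv_closed[OF h(1)] h(1) Qc] h(1) by (simp add: Q'_def)
    also have "\<dots> = (\<lambda>x. x) ` Q"
    proof (rule image_cong[OF refl])
      fix x assume "x \<in> Q"
      then have "x \<in> carrier G" using Qc by blast
      then show "\<one> \<otimes> x \<otimes> inv \<one> = x" by simp
    qed
    finally show ?thesis by simp
  qed
  ultimately have "(\<lambda>x. (inv h \<otimes> (g2 \<otimes> g1)) \<otimes> x \<otimes> inv (inv h \<otimes> (g2 \<otimes> g1))) ` P = Q"
    using conjugate_conjugate[OF inv_closed[OF h(1)], of "g2 \<otimes> g1" P] g Pc by simp
  then show ?thesis using g h(1) by (intro bexI[of _ "inv h \<otimes> (g2 \<otimes> g1)"]) auto
qed

section \<open>Values of integer polynomials\<close>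

abbreviation int_poly_val :: "int poly \<Rightarrow> 'a::comm_ring_1 \<Rightarrow> 'a" where
  "int_poly_val p x \<equiv> poly (map_poly of_int p) x"

lemma map_poly_of_int_add: "map_poly of_int (p + q) = (map_poly of_int p + map_poly of_int q :: 'a::comm_ring_1 poly)"
  by (rule poly_eqI) (simp add: coeff_map_poly)

lemma map_poly_of_int_mult: "map_poly of_int (p * q) = (map_poly of_int p * map_poly of_int q :: 'a::comm_ring_1 poly)"
  by (rule poly_eqI) (simp add: coeff_map_poly coeff_mult)

lemma map_poly_of_int_smult: "map_poly of_int (smult c p) = (smult (of_int c) (map_poly of_int p) :: 'a::comm_ring_1 poly)"
  by (rule poly_eqI) (simp add: coeff_map_poly)

lemma map_poly_of_int_uminus: "map_poly of_int (- p) = (- map_poly of_int p :: 'a::comm_ring_1 poly)"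
  by (rule poly_eqI) (simp add: coeff_map_poly)

lemma map_poly_of_int_diff: "map_poly of_int (p - q) = (map_poly of_int p - map_poly of_int q :: 'a::comm_ring_1 poly)"
  by (rule poly_eqI) (simp add: coeff_map_poly)

lemmas map_poly_of_int_hom = map_poly_of_int_add map_poly_of_int_mult map_poly_of_int_smult
  map_poly_of_int_uminus map_poly_of_int_diff

lemma map_poly_of_int_eq_0 [simp]: "map_poly of_int p = (0 :: 'a::ring_char_0 poly) \<longleftrightarrow> p = 0"
  by (auto simp: poly_eq_iff coeff_map_poly)

section \<open>Extending field homomorphisms\<close>

text \<open>The graph of a ring homomorphism from a subring into the whole ring. Graphs, rather than partial functions, can be
enlarged by taking unions of chains.\<close>

definition partial_hom :: "('q::comm_ring_1 \<times> 'q) set \<Rightarrow> bool" where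
  "partial_hom R \<longleftrightarrow> (1, 1) \<in> R \<and> (\<forall>a b. (a, b) \<in> R \<longrightarrow> (-a, -b) \<in> R) \<and>
     (\<forall>a b c d. (a, b) \<in> R \<longrightarrow> (c, d) \<in> R \<longrightarrow> (a + c, b + d) \<in> R \<and> (a * c, b * d) \<in> R) \<and>
     (\<forall>b. (0, b) \<in> R \<longrightarrow> b = 0)"

lemma partial_homD:
  assumes "partial_hom R"
  shows "(1, 1) \<in> R" "(0, 0) \<in> R" "(0, b) \<in> R \<Longrightarrow> b = 0"
    "(a, b) \<in> R \<Longrightarrow> (c, d) \<in> R \<Longrightarrow> (a + c, b + d) \<in> R"
    "(a, b) \<in> R \<Longrightarrow> (c, d) \<in> R \<Longrightarrow> (a - c, b - d) \<in> R"
    "(a, b) \<in> R \<Longrightarrow> (c, d) \<in> R \<Longrightarrow> (a * c, b * d) \<in> R"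
    "(a, b) \<in> R \<Longrightarrow> (-a, -b) \<in> R"
proof -
  have u: "(1, 1) \<in> R" and neg: "\<And>a b. (a, b) \<in> R \<Longrightarrow> (-a, -b) \<in> R"
    and add: "\<And>a b c d. (a, b) \<in> R \<Longrightarrow> (c, d) \<in> R \<Longrightarrow> (a + c, b + d) \<in> R"
    and mult: "\<And>a b c d. (a, b) \<in> R \<Longrightarrow> (c, d) \<in> R \<Longrightarrow> (a * c, b * d) \<in> R"
    and zero: "\<And>b. (0, b) \<in> R \<Longrightarrow> b = 0"
    using assms unfolding partial_hom_def by blast+
  show "(1, 1) \<in> R" by (rule u)
  show "(0, 0) \<in> R" using add[OF u neg[OF u]] by simp
  show "(0, b) \<in> R \<Longrightarrow> b = 0" by (rule zero)
  show "(a, b) \<in> R \<Longrightarrow> (c, d) \<in> R \<Longrightarrow> (a + c, b + d) \<in> R" by (rule add)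
  show "(a, b) \<in> R \<Longrightarrow> (c, d) \<in> R \<Longrightarrow> (a - c, b - d) \<in> R" using add[OF _ neg[of c d], of a b] by simp
  show "(a, b) \<in> R \<Longrightarrow> (c, d) \<in> R \<Longrightarrow> (a * c, b * d) \<in> R" by (rule mult)
  show "(a, b) \<in> R \<Longrightarrow> (-a, -b) \<in> R" by (rule neg)
qed

lemma partial_hom_sum:
  assumes "partial_hom R" "\<And>i. i \<in> A \<Longrightarrow> (f i, g i) \<in> R"
  shows "(sum f A, sum g A) \<in> R"
  using assms(2) by (induction A rule: infinite_finite_induct) (auto intro: partial_homD[OF assms(1)])

lemma partial_hom_of_int:
  assumes "partial_hom R"
  shows "(of_int k, of_int k) \<in> R"
proof (induction k rule: int_induct[where k = 0])
  case (step1 i) then show ?case using partial_homD(4)[OF assms _ partial_homD(1)[OF assms]] by simp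
next
  case (step2 i) then show ?case using partial_homD(5)[OF assms _ partial_homD(1)[OF assms]] by simp
qed (use partial_homD(2)[OF assms] in simp)

lemma partial_hom_power: "partial_hom R \<Longrightarrow> (a, b) \<in> R \<Longrightarrow> (a ^ n, b ^ n) \<in> R"
  by (induction n) (auto intro: partial_homD)

lemma partial_hom_poly:
  assumes "partial_hom R" "\<And>i. (coeff p i, coeff p' i) \<in> R" "(a, b) \<in> R"
  shows "(poly p a, poly p' b) \<in> R"
proof -
  define n where "n = max (degree p) (degree p')"
  have "poly p a = (\<Sum>i\<le>n. coeff p i * a ^ i)"
    unfolding poly_altdef n_def by (rule sum.mono_neutral_left) (auto simp: coeff_eq_0)
  moreover have "poly p' b = (\<Sum>i\<le>n. coeff p' i * b ^ i)"
    unfolding poly_altdef n_def by (rule sum.mono_neutral_left) (auto simp: coeff_eq_0)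
  ultimately show ?thesis
    using assms by (auto intro!: partial_hom_sum partial_homD(6) partial_hom_power)
qed

text \<open>The domain need not be a field, but an algebraic \<open>c\<close> annihilated by a polynomial with constant coefficient
\<open>a \<noteq> 0\<close> cannot be sent to \<open>0\<close>, as this would send \<open>0\<close> to \<open>a\<close>.\<close>

lemma partial_hom_inj:
  fixes c :: "'q::field_char_0"
  assumes R: "partial_hom R" and alg: "algebraic c" and c: "(c, 0) \<in> R"
  shows "c = 0"
proof (rule ccontr)
  assume "c \<noteq> 0"
  then obtain p where p: "coeff p 0 \<noteq> 0" "int_poly_val p c = 0"
    by (rule algebraicE'_nonzero[OF alg])
  have "(int_poly_val p c, int_poly_val p 0) \<in> R"
    by (rule partial_hom_poly[OF R _ c]) (simp add: coeff_map_poly partial_hom_of_int[OF R])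
  then have "int_poly_val p (0::'q) = 0" using p(2) partial_homD(3)[OF R] by simp
  then show False using p(1) by (simp add: poly_0_coeff_0 coeff_map_poly)
qed

text \<open>Among the polynomials over the domain that vanish at \<open>a\<close>, let \<open>m\<close> have least degree, and let \<open>b\<close> be a root of its
image \<open>m'\<close>. The images of all other polynomials that vanish at \<open>a\<close> then vanish at \<open>b\<close>: multiplication by leading
coefficients replaces division by \<open>m\<close>, which is harmless as the homomorphism does not annihilate them. So sending
\<open>a\<close> to \<open>b\<close> is well defined.\<close>

lemma partial_hom_extend:
  fixes a :: "'q::{alg_closed_field,field_char_0}"
  assumes alg: "\<And>x::'q. algebraic x" and R: "partial_hom R"
  shows "\<exists>R' b. partial_hom R' \<and> R \<subseteq> R' \<and> (a, b) \<in> R'"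
proof -
  \<comment> \<open>polynomials over the domain, paired with their images\<close>
  define RP where "RP = {(p, p'). \<forall>i. (coeff p i, coeff p' i) \<in> R}"
  have RP_add: "(p + q, p' + q') \<in> RP" and RP_diff: "(p - q, p' - q') \<in> RP"
    and RP_mult: "(p * q, p' * q') \<in> RP"
    if "(p, p') \<in> RP" "(q, q') \<in> RP" for p p' q q'
    using that by (auto simp: RP_def coeff_mult intro!: partial_homD[OF R] partial_hom_sum[OF R])
  have RP_const: "([:c:], [:c':]) \<in> RP" if "(c, c') \<in> R" for c c'
    using that partial_homD(2)[OF R] by (auto simp: RP_def coeff_pCons split: nat.splits)
  have RP_monom: "(monom c n, monom c' n) \<in> RP" if "(c, c') \<in> R" for c c' n
    using that partial_homD(2)[OF R] by (auto simp: RP_def)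
  have inj: "c = 0" if "(c, 0) \<in> R" for c
    using partial_hom_inj[OF R alg that] .
  have deg_eq: "degree p' = degree p" if p: "(p, p') \<in> RP" for p p'
  proof (rule antisym)
    have coeff: "(coeff p i, coeff p' i) \<in> R" for i using p by (auto simp: RP_def)
    show "degree p' \<le> degree p"
    proof (rule degree_le, intro allI impI)
      fix i assume "i > degree p"
      then show "coeff p' i = 0" using coeff[of i] partial_homD(3)[OF R] by (simp add: coeff_eq_0)
    qed
    show "degree p \<le> degree p'"
    proof (rule degree_le, intro allI impI)
      fix i assume "i > degree p'"
      then show "coeff p i = 0" using coeff[of i] inj by (simp add: coeff_eq_0)
    qed
  qed
  define I where "I = {(p, p'). (p, p') \<in> RP \<and> p \<noteq> 0 \<and> poly p a = 0}"
  obtain r where r: "r \<noteq> 0" "int_poly_val r a = 0" by (rule algebraicE'[OF alg[of a]])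
  have "(map_poly of_int r, map_poly of_int r) \<in> I"
    using r by (auto simp: I_def RP_def coeff_map_poly partial_hom_of_int[OF R])
  then obtain mm where mm: "mm \<in> I" "\<forall>pp. pp \<in> I \<longrightarrow> degree (fst mm) \<le> degree (fst pp)"
    using ex_has_least_nat[of "\<lambda>pp. pp \<in> I" _ "\<lambda>pp. degree (fst pp)"] by blast
  then obtain m m' where m: "(m, m') \<in> RP" "m \<noteq> 0" "poly m a = 0"
    and min: "\<And>p p'. (p, p') \<in> RP \<Longrightarrow> p \<noteq> 0 \<Longrightarrow> poly p a = 0 \<Longrightarrow> degree m \<le> degree p"
    by (cases mm) (fastforce simp: I_def)
  have "degree m > 0"
  proof (rule ccontr)
    assume "\<not> degree m > 0"
    then obtain c where "m = [:c:]" using degree_eq_zeroE by blast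
    then show False using m(2,3) by simp
  qed
  then obtain b where b: "poly m' b = 0" using alg_closed_imp_poly_has_root[of m'] deg_eq[OF m(1)] by auto
  have lc': "lead_coeff m' \<noteq> 0"
  proof
    assume "lead_coeff m' = 0"
    moreover have "(lead_coeff m, coeff m' (degree m)) \<in> R" using m(1) by (auto simp: RP_def)
    ultimately have "(lead_coeff m, 0) \<in> R" using deg_eq[OF m(1)] by simp
    from inj[OF this] show False using m(2) by simp
  qed
  \<comment> \<open>elimination of the leading term lowers the degree; a pair \<open>(0, p')\<close> has \<open>p' = 0\<close>\<close>
  have key: "poly p' b = 0" if "(p, p') \<in> RP" "poly p a = 0" for p p'
    using that
  proof (induction "degree p" arbitrary: p p' rule: less_induct)
    case less
    show ?case
    proof (cases "p = 0")
      case True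
      then have "\<forall>i. coeff p' i = 0" using less.prems(1) partial_homD(3)[OF R] by (auto simp: RP_def)
      then have "p' = 0" by (simp add: poly_eq_iff)
      then show ?thesis by simp
    next
      case False
      then have dm: "degree m \<le> degree p" using min less.prems by blast
      define n where "n = degree p - degree m"
      define p2 where "p2 = smult (lead_coeff m) p - monom (lead_coeff p) n * m"
      define p2' where "p2' = smult (lead_coeff m') p' - monom (lead_coeff p') n * m'"
      have lcs: "(lead_coeff m, lead_coeff m') \<in> R" "(lead_coeff p, lead_coeff p') \<in> R"
        using m(1) less.prems(1) deg_eq[OF m(1)] deg_eq[OF less.prems(1)] by (auto simp: RP_def)
      have "(p2, p2') \<in> RP"
        unfolding p2_def p2'_def
        using RP_mult[OF RP_const[OF lcs(1)] less.prems(1)] RP_mult[OF RP_monom[OF lcs(2)] m(1)]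
        by (intro RP_diff) simp_all
      moreover have p2a: "poly p2 a = 0" using less.prems(2) m(3) by (simp add: p2_def)
      moreover have "degree p2 < degree p \<or> p2 = 0"
      proof -
        have "coeff p2 i = 0" if "i \<ge> degree p" for i
        proof (cases "i = degree p")
          case True
          have "coeff (monom (lead_coeff p) n * m) (degree p) = lead_coeff p * lead_coeff m"
            using dm by (simp add: coeff_monom_mult n_def)
          then show ?thesis using True by (simp add: p2_def)
        next
          case False
          then have "i > degree p" using that by simp
          moreover have "degree (monom (lead_coeff p) n * m) \<le> degree p"
            using dm by (intro order.trans[OF degree_mult_le]) (auto simp: n_def degree_monom_eq False intro: le_diff_conv2[THEN iffD1] degree_monom_le order.trans[OF add_right_mono[OF degree_monom_le]])
          ultimately show ?thesis by (simp add: p2_def coeff_eq_0)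
        qed
        then show ?thesis
          by (metis leading_coeff_0_iff not_le)
      qed
      ultimately have "poly p2' b = 0"
      proof (elim disjE)
        assume *: "(p2, p2') \<in> RP" "p2 = 0"
        then have "\<forall>i. coeff p2' i = 0" using partial_homD(3)[OF R] by (auto simp: RP_def)
        then have "p2' = 0" by (simp add: poly_eq_iff)
        then show ?thesis by simp
      qed (use less.hyps in blast)
      then show ?thesis using b lc' by (simp add: p2'_def)
    qed
  qed
  define R' where "R' = {(poly p a, poly p' b) | p p'. (p, p') \<in> RP}"
  have "partial_hom R'"
    unfolding partial_hom_def
  proof (intro conjI allI impI)
    show "(1, 1) \<in> R'"
      unfolding R'_def using RP_const[OF partial_homD(1)[OF R]] by force
    fix x y assume "(x, y) \<in> R'"
    then obtain p p' where p: "(p, p') \<in> RP" "x = poly p a" "y = poly p' b" by (auto simp: R'_def)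
    have "(0 - p, 0 - p') \<in> RP" using RP_diff[OF RP_const[OF partial_homD(2)[OF R]] p(1)] by simp
    then show "(- x, - y) \<in> R'" unfolding R'_def using p by force
    fix u v assume "(u, v) \<in> R'"
    then obtain q q' where q: "(q, q') \<in> RP" "u = poly q a" "v = poly q' b" by (auto simp: R'_def)
    show "(x + u, y + v) \<in> R'" unfolding R'_def using RP_add[OF p(1) q(1)] p q by force
    show "(x * u, y * v) \<in> R'" unfolding R'_def using RP_mult[OF p(1) q(1)] p q by force
  next
    fix y assume "(0, y) \<in> R'"
    then show "y = 0" using key by (auto simp: R'_def)
  qed
  moreover have "R \<subseteq> R'"
    unfolding R'_def using RP_const by force
  moreover have "(a, b) \<in> R'"
  proof -
    have "(monom 1 1, monom 1 1) \<in> RP" by (rule RP_monom[OF partial_homD(1)[OF R]])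
    then show ?thesis unfolding R'_def by (force simp: poly_monom)
  qed
  ultimately show ?thesis by blast
qed

section \<open>Automorphisms of an algebraic closure of the rationals\<close>

definition field_aut :: "('q::field \<Rightarrow> 'q) set" where
  "field_aut = {\<sigma>. bij \<sigma> \<and> (\<forall>x y. \<sigma> (x + y) = \<sigma> x + \<sigma> y) \<and> (\<forall>x y. \<sigma> (x * y) = \<sigma> x * \<sigma> y)}"

lemma field_autD:
  assumes "\<sigma> \<in> field_aut"
  shows "bij \<sigma>" "\<sigma> (x + y) = \<sigma> x + \<sigma> y" "\<sigma> (x * y) = \<sigma> x * \<sigma> y"
    "\<sigma> 0 = 0" "\<sigma> 1 = 1" "\<sigma> (- x) = - \<sigma> x" "\<sigma> (x - y) = \<sigma> x - \<sigma> y" "\<sigma> (inverse x) = inverse (\<sigma> x)"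
proof -
  have b: "bij \<sigma>" and a: "\<And>x y. \<sigma> (x + y) = \<sigma> x + \<sigma> y" and m: "\<And>x y. \<sigma> (x * y) = \<sigma> x * \<sigma> y"
    using assms by (auto simp: field_aut_def)
  show "bij \<sigma>" "\<sigma> (x + y) = \<sigma> x + \<sigma> y" "\<sigma> (x * y) = \<sigma> x * \<sigma> y" by (fact b a m)+
  show z: "\<sigma> 0 = 0" using a[of 0 0] by (metis add_cancel_right_right add_0)
  have inj: "\<sigma> u = \<sigma> v \<longleftrightarrow> u = v" for u v using b by (auto simp: bij_def inj_eq)
  show o: "\<sigma> 1 = 1" using m[of 1 1] inj[of 1 0] z by simp
  show neg: "\<sigma> (- x) = - \<sigma> x" for x using a[of x "-x"] z by (simp add: eq_neg_iff_add_eq_0 add.commute)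
  show "\<sigma> (x - y) = \<sigma> x - \<sigma> y" using a[of x "-y"] neg[of y] by simp
  show "\<sigma> (inverse x) = inverse (\<sigma> x)"
    using m[of x "inverse x"] z o by (cases "x = 0") (simp_all add: inverse_unique)
qed

lemma field_aut_of_int: "\<sigma> \<in> field_aut \<Longrightarrow> \<sigma> (of_int k) = of_int k"
  by (induction k rule: int_induct[where k = 0]) (auto simp: field_autD)

lemma field_aut_Rats:
  fixes \<sigma> :: "'q::field_char_0 \<Rightarrow> 'q"
  assumes "\<sigma> \<in> field_aut" "x \<in> \<rat>" shows "\<sigma> x = x"
proof -
  obtain i j where "j \<noteq> 0" "x = of_int i * inverse (of_int j :: 'q)"
    using assms(2) by (elim Rats_cases') (metis divide_inverse less_irrefl)
  then show ?thesis using assms(1) by (simp add: field_autD field_aut_of_int)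
qed

lemma field_aut_poly:
  assumes "\<sigma> \<in> field_aut" shows "\<sigma> (poly p x) = poly (map_poly \<sigma> p) (\<sigma> x)"
  by (induction p) (auto simp: map_poly_pCons field_autD[OF assms])

lemma field_aut_int_poly_val:
  assumes "\<sigma> \<in> field_aut" shows "\<sigma> (int_poly_val p x) = int_poly_val p (\<sigma> x)"
proof -
  have "map_poly \<sigma> (map_poly of_int p) = map_poly of_int p"
    by (rule poly_eqI) (simp add: coeff_map_poly field_autD[OF assms] field_aut_of_int[OF assms])
  then show ?thesis by (simp add: field_aut_poly[OF assms])
qed

text \<open>Surjectivity comes for free: an injective endomorphism permutes the finitely many roots of any integer polynomial,
and every element is such a root.\<close>

lemma field_autI:
  fixes \<sigma> :: "'q::field_char_0 \<Rightarrow> 'q"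
  assumes alg: "\<And>x::'q. algebraic x"
    and add: "\<And>x y. \<sigma> (x + y) = \<sigma> x + \<sigma> y" and mult: "\<And>x y. \<sigma> (x * y) = \<sigma> x * \<sigma> y"
    and one: "\<sigma> 1 = 1"
  shows "\<sigma> \<in> field_aut"
proof -
  have zero: "\<sigma> 0 = 0" using add[of 0 0] by (metis add_cancel_right_right add_0)
  have neg: "\<sigma> (- x) = - \<sigma> x" for x
    using add[of x "-x"] zero by (simp add: eq_neg_iff_add_eq_0 add.commute)
  have inj: "inj \<sigma>"
  proof (rule injI)
    fix x y assume "\<sigma> x = \<sigma> y"
    then have "\<sigma> (x - y) = 0" using add[of x "- y"] neg by simp
    then have "\<sigma> ((x - y) * inverse (x - y)) = 0" using mult by simp
    then show "x = y" using one by (cases "x = y") auto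
  qed
  have of_int: "\<sigma> (of_int k) = of_int k" for k
  proof (induction k rule: int_induct[where k = 0])
    case (step2 i)
    then show ?case using add[of "of_int i" "- 1"] neg[of 1] one by simp
  qed (simp_all add: zero add one)
  have poly: "\<sigma> (int_poly_val p x) = int_poly_val p (\<sigma> x)" for p x
    by (induction p) (auto simp: map_poly_pCons add mult of_int zero)
  have "surj \<sigma>"
  proof (unfold surj_def, intro allI)
    fix y :: 'q
    obtain p where p: "p \<noteq> 0" "int_poly_val p y = 0" by (rule algebraicE'[OF alg[of y]])
    let ?Z = "{x :: 'q. int_poly_val p x = 0}"
    have "finite ?Z" using p(1) by (intro poly_roots_finite) simp
    moreover have "\<sigma> ` ?Z \<subseteq> ?Z" using poly[of p] zero by (auto simp flip: poly)
    ultimately have "\<sigma> ` ?Z = ?Z" using inj by (meson endo_inj_surj inj_on_subset subset_UNIV)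
    then have "y \<in> \<sigma> ` ?Z" using p(2) by simp
    then show "\<exists>x. y = \<sigma> x" by blast
  qed
  then show ?thesis using inj add mult by (auto simp: field_aut_def bij_def)
qed

theorem exists_field_aut:
  fixes x y :: "'q::{alg_closed_field,field_char_0}"
  assumes alg: "\<And>x::'q. algebraic x"
    and conj: "\<And>r. int_poly_val r x = 0 \<Longrightarrow> int_poly_val r y = 0"
  shows "\<exists>\<sigma>\<in>field_aut. \<sigma> x = y"
proof -
  define R0 where "R0 = {(int_poly_val r x, int_poly_val r y) | r. True}"
  have R0: "partial_hom R0"
    unfolding partial_hom_def
  proof (intro conjI allI impI)
    have "(int_poly_val 1 x, int_poly_val 1 y) \<in> R0" unfolding R0_def by blast
    then show "(1, 1) \<in> R0" by simp
    fix a b assume "(a, b) \<in> R0"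
    then obtain r where r: "a = int_poly_val r x" "b = int_poly_val r y" by (auto simp: R0_def)
    have "(int_poly_val (- r) x, int_poly_val (- r) y) \<in> R0" unfolding R0_def by blast
    then show "(- a, - b) \<in> R0" using r by (simp add: map_poly_of_int_hom)
    fix c d assume "(c, d) \<in> R0"
    then obtain s where s: "c = int_poly_val s x" "d = int_poly_val s y" by (auto simp: R0_def)
    have "(int_poly_val (r + s) x, int_poly_val (r + s) y) \<in> R0"
      "(int_poly_val (r * s) x, int_poly_val (r * s) y) \<in> R0" unfolding R0_def by blast+
    then show "(a + c, b + d) \<in> R0" "(a * c, b * d) \<in> R0" using r s by (simp_all add: map_poly_of_int_hom)
  next
    fix b assume "(0, b) \<in> R0" then show "b = 0" using conj by (auto simp: R0_def)
  qed
  define PH where "PH = {R. partial_hom R \<and> R0 \<subseteq> R}"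
  have "\<exists>M\<in>PH. \<forall>D\<in>PH. M \<subseteq> D \<longrightarrow> D = M"
  proof (rule subset_Zorn_nonempty)
    show "PH \<noteq> {}" using R0 by (auto simp: PH_def)
    fix C assume C: "C \<noteq> {}" "subset.chain PH C"
    have ph: "partial_hom D" "R0 \<subseteq> D" if "D \<in> C" for D
      using C(2) that by (auto simp: subset.chain_def PH_def)
    have two: "\<exists>D\<in>C. p \<in> D \<and> q \<in> D" if "p \<in> \<Union>C" "q \<in> \<Union>C" for p q
    proof -
      obtain D Y where XY: "D \<in> C" "p \<in> D" "Y \<in> C" "q \<in> Y" using \<open>p \<in> \<Union>C\<close> \<open>q \<in> \<Union>C\<close> by blast
      then have "D \<subseteq> Y \<or> Y \<subseteq> D" using C(2) by (auto simp: subset.chain_def)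
      then show ?thesis using XY by blast
    qed
    have "partial_hom (\<Union>C)"
      unfolding partial_hom_def
    proof (intro conjI allI impI)
      show "(1, 1) \<in> \<Union>C" using C(1) ph(1) partial_homD(1) by blast
      show "(- a, - b) \<in> \<Union>C" if "(a, b) \<in> \<Union>C" for a b
        using that ph(1) partial_homD(7) by blast
      show "(a + c, b + d) \<in> \<Union>C" "(a * c, b * d) \<in> \<Union>C" if "(a, b) \<in> \<Union>C" "(c, d) \<in> \<Union>C" for a b c d
        using two[OF that] ph(1) partial_homD(4,6) by blast+
      show "b = 0" if "(0, b) \<in> \<Union>C" for b
        using that ph(1) partial_homD(3) by blast
    qed
    then show "\<Union>C \<in> PH" using C(1) ph(2) by (auto simp: PH_def)
  qed
  then obtain M where M: "partial_hom M" "R0 \<subseteq> M" and max: "\<And>D. partial_hom D \<Longrightarrow> M \<subseteq> D \<Longrightarrow> D = M"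
    unfolding PH_def by (smt (verit) dual_order.trans mem_Collect_eq)
  have total: "\<exists>b. (a, b) \<in> M" for a
    using partial_hom_extend[OF alg M(1), of a] max by blast
  have unique: "b = b'" if "(a, b) \<in> M" "(a, b') \<in> M" for a b b'
  proof -
    have "(0, b - b') \<in> M" using partial_homD(5)[OF M(1) that] by simp
    then have "b - b' = 0" by (rule partial_homD(3)[OF M(1)])
    then show ?thesis by simp
  qed
  define \<sigma> where "\<sigma> a = (THE b. (a, b) \<in> M)" for a
  have \<sigma>: "(a, b) \<in> M \<longleftrightarrow> \<sigma> a = b" for a b
    unfolding \<sigma>_def using total[of a] unique[of a] by (metis the_equality)
  have "\<sigma> \<in> field_aut"
  proof (rule field_autI[OF alg])
    have in_M: "(a, \<sigma> a) \<in> M" for a by (simp add: \<sigma>)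
    show "\<sigma> (a + b) = \<sigma> a + \<sigma> b" "\<sigma> (a * b) = \<sigma> a * \<sigma> b" for a b
      using partial_homD(4,6)[OF M(1) in_M[of a] in_M[of b]] by (simp_all only: \<sigma>)
    show "\<sigma> 1 = 1" using partial_homD(1)[OF M(1)] by (simp only: \<sigma>)
  qed
  moreover have "(int_poly_val [:0, 1:] x, int_poly_val [:0, 1:] y) \<in> R0"
    unfolding R0_def by blast
  then have "\<sigma> x = y" using M(2) by (auto simp: map_poly_pCons simp flip: \<sigma>)
  ultimately show ?thesis by blast
qed

section \<open>Compactness\<close>

text \<open>Tychonoff's theorem for a product of finite discrete spaces: whatever can be arranged on every finite set,
compatibly with restriction, can be arranged on all of them by a single function. It glues the conjugations that
are found in the finite quotients of the Galois group.\<close>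

lemma finite_dependence_compactness:
  fixes W :: "'a set \<Rightarrow> ('a \<Rightarrow> 'b) set" and A :: "'a \<Rightarrow> 'b set"
  assumes fin: "\<And>x. finite (A x)"
    and range: "\<And>S h x. finite S \<Longrightarrow> h \<in> W S \<Longrightarrow> h x \<in> A x"
    and anti: "\<And>S T. finite T \<Longrightarrow> S \<subseteq> T \<Longrightarrow> W T \<subseteq> W S"
    and ne: "\<And>S. finite S \<Longrightarrow> W S \<noteq> {}"
  shows "\<exists>g. \<forall>S. finite S \<longrightarrow> (\<exists>h\<in>W S. \<forall>x\<in>S. h x = g x)"
proof -
  define prod_top where "prod_top = product_topology (\<lambda>x. discrete_topology (A x)) UNIV"
  have top: "topspace prod_top = PiE UNIV A" by (simp add: prod_top_def)
  have compact: "compact_space prod_top"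
    unfolding prod_top_def compact_space_product_topology by (simp add: compact_space_discrete_topology fin)
  define C where "C = (\<lambda>S. {g. g \<in> PiE UNIV A \<and> (\<exists>h\<in>W S. \<forall>x\<in>S. h x = g x)})"
  have closed: "closedin prod_top (C S)" if S: "finite S" for S
  proof -
    have "openin prod_top (topspace prod_top - C S)"
    proof (subst openin_subopen, intro ballI)
      fix g assume g: "g \<in> topspace prod_top - C S"
      let ?B = "PiE UNIV (\<lambda>x. if x \<in> S then {g x} else A x)"
      have gA: "g x \<in> A x" for x using g by (auto simp: top)
      have "openin prod_top ?B"
        unfolding prod_top_def openin_PiE_gen
        using gA by (auto intro!: finite_subset[OF _ S])
      moreover have "g \<in> ?B" using gA by auto
      moreover have "?B \<subseteq> topspace prod_top - C S"
      proof
        fix g' assume g': "g' \<in> ?B"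
        then have eq: "g' x = g x" if "x \<in> S" for x using that by (auto dest: PiE_mem[of _ _ _ x])
        have "g' x \<in> A x" for x using PiE_mem[OF g', of x] gA[of x] by (auto split: if_splits)
        moreover have "g' \<notin> C S" using g eq by (auto simp: C_def top)
        ultimately show "g' \<in> topspace prod_top - C S" by (auto simp: top)
      qed
      ultimately show "\<exists>T. openin prod_top T \<and> g \<in> T \<and> T \<subseteq> topspace prod_top - C S" by blast
    qed
    then show ?thesis by (auto simp: closedin_def C_def top)
  qed
  have "\<Inter>(C ` {S. finite S}) \<noteq> {}"
  proof (rule compact_space_fip[THEN iffD1, OF compact, rule_format], intro conjI ballI allI impI)
    fix D assume "D \<in> C ` {S. finite S}" then show "closedin prod_top D" using closed by auto
  next
    fix \<F> assume F: "finite \<F> \<and> \<F> \<subseteq> C ` {S. finite S}"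
    then obtain \<S> where \<S>: "finite \<S>" "\<S> \<subseteq> {S. finite S}" "\<F> = C ` \<S>"
      by (meson finite_subset_image)
    have finU: "finite (\<Union>\<S>)" using \<S> by auto
    obtain h where h: "h \<in> W (\<Union>\<S>)" using ne[OF finU] by blast
    have "h \<in> C S" if "S \<in> \<S>" for S
      using anti[OF finU, of S] h range[OF finU h] that by (auto simp: C_def)
    then show "\<Inter>\<F> \<noteq> {}" unfolding \<S>(3) by blast
  qed
  then obtain g where "\<And>S. finite S \<Longrightarrow> g \<in> C S" by auto
  then show ?thesis unfolding C_def by blast
qed

section \<open>Subfields and Galois groups\<close>

abbreviation type_ring :: "'q::field_char_0 ring" where "type_ring \<equiv> ring_of_type_algebra"

lemma type_ring_simps [simp]:
  "carrier (type_ring :: 'q::field_char_0 ring) = UNIV"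
  "x \<otimes>\<^bsub>type_ring\<^esub> y = x * (y::'q)" "x \<oplus>\<^bsub>type_ring\<^esub> y = x + y"
  "\<one>\<^bsub>type_ring\<^esub> = (1::'q)" "\<zero>\<^bsub>type_ring\<^esub> = (0::'q)"
  by (simp_all add: ring_of_type_algebra_def)

lemma type_ring_inverses [simp]:
  fixes x :: "'q::field_char_0"
  shows "\<ominus>\<^bsub>type_ring\<^esub> x = - x" "x \<noteq> 0 \<Longrightarrow> inv\<^bsub>type_ring\<^esub> x = inverse x"
proof -
  interpret R: field "type_ring :: 'q ring" by (rule field_from_type_algebra)
  show "\<ominus>\<^bsub>type_ring\<^esub> x = - x" by (rule R.minus_equality) simp_all
  show "inv\<^bsub>type_ring\<^esub> x = inverse x" if "x \<noteq> 0" by (rule R.inv_unique'[symmetric]) (use that in simp_all)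
qed

lemma subfield_type_ringI:
  fixes K :: "'q::field_char_0 set"
  assumes "1 \<in> K" "\<And>x. x \<in> K \<Longrightarrow> - x \<in> K" "\<And>x y. x \<in> K \<Longrightarrow> y \<in> K \<Longrightarrow> x * y \<in> K"
    "\<And>x y. x \<in> K \<Longrightarrow> y \<in> K \<Longrightarrow> x + y \<in> K" "\<And>x. x \<in> K \<Longrightarrow> x \<noteq> 0 \<Longrightarrow> inverse x \<in> K"
  shows "subfield K type_ring"
proof -
  interpret R: field "type_ring :: 'q ring" by (rule field_from_type_algebra)
  have "subring K type_ring" by (rule R.subringI) (use assms in simp_all)
  then show ?thesis by (rule R.subfieldI') (use assms(5) in auto)
qed

lemma subfield_type_ringD:
  fixes K :: "'q::field_char_0 set"
  assumes "subfield K type_ring"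
  shows "0 \<in> K" "1 \<in> K" "x \<in> K \<Longrightarrow> - x \<in> K" "x \<in> K \<Longrightarrow> y \<in> K \<Longrightarrow> x * y \<in> K"
    "x \<in> K \<Longrightarrow> y \<in> K \<Longrightarrow> x + y \<in> K" "x \<in> K \<Longrightarrow> inverse x \<in> K" "\<rat> \<subseteq> K"
proof -
  interpret R: field "type_ring :: 'q ring" by (rule field_from_type_algebra)
  note * = subringE[OF subfieldE(1)[OF assms]]
  show 01: "0 \<in> K" "1 \<in> K" using *(2,3) by simp_all
  show neg: "x \<in> K \<Longrightarrow> - x \<in> K" for x using *(5)[of x] by simp
  show mult: "x \<in> K \<Longrightarrow> y \<in> K \<Longrightarrow> x * y \<in> K" for x y using *(6)[of x y] by simp
  show add: "x \<in> K \<Longrightarrow> y \<in> K \<Longrightarrow> x + y \<in> K" for x y using *(7)[of x y] by simp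
  show inv: "x \<in> K \<Longrightarrow> inverse x \<in> K" for x
    using R.subfield_m_inv(1)[OF assms, of x] 01 by (cases "x = 0") auto
  have int: "of_int k \<in> K" for k
  proof (induction k rule: int_induct[where k = 0])
    case (step2 i) then show ?case using add[OF _ neg[OF 01(2)]] by simp
  qed (use 01 add in simp_all)
  show "\<rat> \<subseteq> K"
  proof
    fix x :: 'q assume "x \<in> \<rat>"
    then obtain i j where "x = of_int i * inverse (of_int j)"
      by (elim Rats_cases') (metis divide_inverse)
    then show "x \<in> K" using int mult inv by simp
  qed
qed

lemma subfield_Rats: "subfield \<rat> (type_ring :: 'q::field_char_0 ring)"
  by (rule subfield_type_ringI) simp_all

lemma subfield_fixed:
  assumes "\<sigma> \<in> field_aut"
  shows "subfield {x :: 'q::field_char_0. \<sigma> x = x} type_ring"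
  by (rule subfield_type_ringI) (simp_all add: field_autD[OF assms])

lemma subfield_rat_adjoin: "subfield (rat_adjoin a) type_ring"
  and rat_adjoin_mem: "a \<in> rat_adjoin a"
  and rat_adjoin_least: "subfield E type_ring \<Longrightarrow> a \<in> E \<Longrightarrow> rat_adjoin a \<subseteq> E"
proof -
  interpret R: field "type_ring :: 'a ring" by (rule field_from_type_algebra)
  show "subfield (rat_adjoin a) type_ring"
    unfolding rat_adjoin_def by (rule R.generate_field_is_subfield) simp
  show "a \<in> rat_adjoin a"
    unfolding rat_adjoin_def by (rule generate_field.incl) simp
  show "rat_adjoin a \<subseteq> E" if "subfield E type_ring" "a \<in> E" 
    unfolding rat_adjoin_def
    by (rule R.generate_field_min_subfield1) (use that subfield_type_ringD(7)[OF that(1)] in auto)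
qed

text \<open>Translates between the two notions of polynomials: over a carrier set they are lists, with the leading coefficient
first.\<close>

lemma algebraic_over_subfield:
  fixes x :: "'q::field_char_0"
  assumes "algebraic x" "subfield K type_ring"
  shows "(ring.algebraic type_ring over K) x"
proof -
  interpret R: field "type_ring :: 'q ring" by (rule field_from_type_algebra)
  obtain p where p: "p \<noteq> 0" "int_poly_val p x = 0" by (rule algebraicE'[OF assms(1)])
  have eval: "R.eval (rev (coeffs q)) x = poly q x" for q
  proof (induction q)
    case (pCons a q)
    have "R.eval (rev (coeffs q) @ [a]) x = R.eval (rev (coeffs q)) x * x + a"
      using R.eval_append_aux[of "rev (coeffs q)" a x] by simp
    moreover have "coeffs (pCons a q) = a # coeffs q"
      using pCons.hyps by (auto simp: coeffs_pCons_eq_cCons cCons_def)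
    ultimately show ?case using pCons.IH by (simp add: algebra_simps)
  qed simp
  define q where "q = (map_poly of_int p :: 'q poly)"
  have q: "q \<noteq> 0" "poly q x = 0" using p by (simp_all add: q_def)
  have "set (coeffs q) \<subseteq> K"
    using subfield_type_ringD(7)[OF assms(2)] by (auto simp: q_def coeffs_def coeff_map_poly intro!: subsetD[OF _ Rats_of_int])
  moreover have "rev (coeffs q) \<noteq> []" "hd (rev (coeffs q)) \<noteq> 0"
    using q(1) by (simp_all add: hd_rev last_coeffs_eq_coeff_degree)
  ultimately have "rev (coeffs q) \<in> carrier (K [X]\<^bsub>type_ring\<^esub>)"
    by (simp add: univ_poly_def polynomial_def)
  moreover have "R.eval (rev (coeffs q)) x = 0" using eval q(2) by simp
  ultimately show ?thesis
    using R.algebraicI[of "rev (coeffs q)" K x] \<open>rev (coeffs q) \<noteq> []\<close> by simp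
qed

lemma finite_extension_adjoin:
  fixes K :: "'q::field_char_0 set"
  assumes alg: "\<And>x::'q. algebraic x" and K: "subfield K type_ring" and S: "finite S"
  shows "\<exists>E. finite_field_extension K E \<and> S \<subseteq> E \<and>
    (\<forall>F. subfield F type_ring \<longrightarrow> K \<subseteq> F \<longrightarrow> S \<subseteq> F \<longrightarrow> E \<subseteq> F)"
proof -
  interpret R: field "type_ring :: 'q ring" by (rule field_from_type_algebra)
  obtain xs where xs: "set xs = S" using finite_list[OF S] by blast
  have a: "(R.algebraic over K) x" for x by (rule algebraic_over_subfield[OF alg K])
  let ?E = "R.finite_extension K xs"
  have "subfield ?E type_ring" by (rule R.finite_extension_is_subfield[OF K]) (use a in simp_all)
  moreover have "R.finite_dimension K ?E" by (rule R.finite_extension_finite_dimension(1)[OF K]) (use a in simp_all)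
  moreover have "K \<subseteq> ?E" by (rule R.finite_extension_incl) simp_all
  moreover have "S \<subseteq> ?E" unfolding xs[symmetric] by (rule R.finite_extension_mem[OF subfieldE(1)[OF K]]) simp
  moreover have "?E \<subseteq> F" if "subfield F type_ring" "K \<subseteq> F" "S \<subseteq> F" for F
    by (rule R.finite_extension_subring_incl[OF subfieldE(1)[OF that(1)]]) (use that xs in simp_all)
  ultimately show ?thesis using K unfolding finite_field_extension_def by blast
qed

lemma number_field_rat_adjoin:
  fixes a :: "'q::field_char_0"
  assumes alg: "\<And>x::'q. algebraic x"
  shows "number_field (rat_adjoin a)"
proof -
  obtain E where E: "finite_field_extension \<rat> E" "{a} \<subseteq> E"
    "\<forall>F. subfield F type_ring \<longrightarrow> \<rat> \<subseteq> F \<longrightarrow> {a} \<subseteq> F \<longrightarrow> E \<subseteq> F"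
    using finite_extension_adjoin[OF alg subfield_Rats, of "{a}"] by auto
  have "subfield E type_ring" using E(1) by (simp add: finite_field_extension_def)
  then have "rat_adjoin a \<subseteq> E" using rat_adjoin_least[of E a] E(2) by simp
  moreover have "E \<subseteq> rat_adjoin a"
    using E(3) subfield_rat_adjoin[of a] rat_adjoin_mem[of a] subfield_type_ringD(7)[OF subfield_rat_adjoin[of a]] by simp
  ultimately have "E = rat_adjoin a" by blast
  then show ?thesis using E(1) by (simp add: number_field_def)
qed

lemma carrier_Gal: "carrier (Gal K) = {\<sigma> \<in> field_aut. \<forall>x\<in>K. \<sigma> x = (x::'q::field_char_0)}"
proof -
  have "\<sigma> \<in> ring_iso type_ring type_ring \<longleftrightarrow> \<sigma> \<in> field_aut" for \<sigma> :: "'q \<Rightarrow> 'q"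
  proof
    assume "\<sigma> \<in> ring_iso type_ring type_ring"
    then show "\<sigma> \<in> field_aut"
      by (auto simp: ring_iso_def ring_hom_def field_aut_def)
  next
    assume "\<sigma> \<in> field_aut"
    then show "\<sigma> \<in> ring_iso type_ring type_ring"
      using field_autD[of \<sigma>] by (auto simp: ring_iso_def ring_hom_def)
  qed
  then show ?thesis by (auto simp: Gal_def)
qed

lemma Gal_mult [simp]: "\<sigma> \<otimes>\<^bsub>Gal K\<^esub> \<tau> = \<sigma> \<circ> \<tau>" and Gal_one [simp]: "\<one>\<^bsub>Gal K\<^esub> = id"
  by (simp_all add: Gal_def)

lemma carrier_Gal_Rats: "carrier (Gal \<rat>) = (field_aut :: ('q::field_char_0 \<Rightarrow> 'q) set)"
  by (auto simp: carrier_Gal field_aut_Rats)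

lemma Gal_carrier_update: "Gal K = Gal \<rat> \<lparr>carrier := carrier (Gal K)\<rparr>"
  by (simp add: Gal_def)

lemma field_aut_comp: "\<sigma> \<in> field_aut \<Longrightarrow> \<tau> \<in> field_aut \<Longrightarrow> \<sigma> \<circ> \<tau> \<in> field_aut"
  by (auto simp: field_aut_def intro: bij_comp)

lemma field_aut_inv: 
  assumes "\<sigma> \<in> field_aut" shows "inv_into UNIV \<sigma> \<in> field_aut"
proof -
  have b: "bij \<sigma>" by (rule field_autD[OF assms])
  have s: "\<sigma> (inv_into UNIV \<sigma> x) = x" for x using b by (simp add: bij_def surj_f_inv_f)
  have i: "inv_into UNIV \<sigma> (\<sigma> x) = x" for x using b by (simp add: bij_def)
  have "inv_into UNIV \<sigma> (x + y) = inv_into UNIV \<sigma> x + inv_into UNIV \<sigma> y" for x y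
    using i[of "inv_into UNIV \<sigma> x + inv_into UNIV \<sigma> y"] by (simp add: field_autD(2)[OF assms] s)
  moreover have "inv_into UNIV \<sigma> (x * y) = inv_into UNIV \<sigma> x * inv_into UNIV \<sigma> y" for x y
    using i[of "inv_into UNIV \<sigma> x * inv_into UNIV \<sigma> y"] by (simp add: field_autD(3)[OF assms] s)
  ultimately show ?thesis using bij_imp_bij_inv[OF b] by (simp add: field_aut_def)
qed

lemma field_aut_inv_apply:
  assumes "\<sigma> \<in> field_aut"
  shows "\<sigma> (inv_into UNIV \<sigma> x) = x" "inv_into UNIV \<sigma> (\<sigma> x) = x"
  using field_autD(1)[OF assms] by (simp_all add: bij_def surj_f_inv_f)

lemma group_Gal: "group (Gal (K :: 'q::field_char_0 set))"
proof (rule groupI)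
  show "\<one>\<^bsub>Gal K\<^esub> \<in> carrier (Gal K)" by (auto simp: carrier_Gal field_aut_def)
  fix \<sigma> assume s: "\<sigma> \<in> carrier (Gal K)"
  show "\<exists>\<tau>\<in>carrier (Gal K). \<tau> \<otimes>\<^bsub>Gal K\<^esub> \<sigma> = \<one>\<^bsub>Gal K\<^esub>"
  proof (rule bexI[of _ "inv_into UNIV \<sigma>"])
    have f: "\<sigma> \<in> field_aut" and fx: "\<And>x. x \<in> K \<Longrightarrow> \<sigma> x = x" using s by (auto simp: carrier_Gal)
    show "inv_into UNIV \<sigma> \<otimes>\<^bsub>Gal K\<^esub> \<sigma> = \<one>\<^bsub>Gal K\<^esub>"
      using field_aut_inv_apply[OF f] by (auto simp: fun_eq_iff)
    have "inv_into UNIV \<sigma> x = x" if "x \<in> K" for x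
      using field_aut_inv_apply(2)[OF f, of x] fx[OF that] by simp
    then show "inv_into UNIV \<sigma> \<in> carrier (Gal K)"
      using field_aut_inv[OF f] by (simp add: carrier_Gal)
  qed
qed (auto simp: carrier_Gal field_aut_comp)

lemma Gal_inv:
  assumes "\<sigma> \<in> carrier (Gal K)" shows "inv\<^bsub>Gal K\<^esub> \<sigma> = inv_into UNIV \<sigma>"
proof -
  interpret group "Gal K" by (rule group_Gal)
  have f: "\<sigma> \<in> field_aut" using assms by (auto simp: carrier_Gal)
  obtain \<tau> where \<tau>: "\<tau> \<in> carrier (Gal K)" "\<tau> \<circ> \<sigma> = id" using l_inv_ex[OF assms] by auto
  then have "\<tau> = inv_into UNIV \<sigma>"
    using field_aut_inv_apply(1)[OF f] by (auto simp: fun_eq_iff) metis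
  then show ?thesis using inv_equality[of \<tau> \<sigma>] \<tau> assms by simp
qed

lemma subgroup_Gal: "subgroup (carrier (Gal K)) (Gal (\<rat> :: 'q::field_char_0 set))"
proof -
  interpret Q: group "Gal (\<rat> :: 'q set)" by (rule group_Gal)
  interpret K: group "Gal K" by (rule group_Gal)
  show ?thesis
  proof (rule Q.subgroupI)
    show "carrier (Gal K) \<subseteq> carrier (Gal \<rat>)" by (auto simp: carrier_Gal_Rats) (simp add: carrier_Gal)
    show "carrier (Gal K) \<noteq> {}" using K.one_closed by blast
    fix \<sigma> \<tau> assume "\<sigma> \<in> carrier (Gal K)" "\<tau> \<in> carrier (Gal K)"
    then show "\<sigma> \<otimes>\<^bsub>Gal \<rat>\<^esub> \<tau> \<in> carrier (Gal K)" using K.m_closed[of \<sigma> \<tau>] by simp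
  next
    fix \<sigma> assume *: "\<sigma> \<in> carrier (Gal K)"
    then have "\<sigma> \<in> carrier (Gal \<rat>)" by (auto simp: carrier_Gal_Rats) (simp add: carrier_Gal)
    then show "inv\<^bsub>Gal \<rat>\<^esub> \<sigma> \<in> carrier (Gal K)"
      using K.inv_closed[OF *] by (simp add: Gal_inv *)
  qed
qed

lemma carrier_Gal_rat_adjoin: "carrier (Gal (rat_adjoin a)) = {\<sigma> \<in> field_aut. \<sigma> a = a}"
  using rat_adjoin_mem[of a] rat_adjoin_least[OF subfield_fixed]
  by (fastforce simp: carrier_Gal)

section \<open>The Krull topology\<close>

lemma openin_krull_fixing:
  fixes K :: "'q::field_char_0 set"
  assumes alg: "\<And>x::'q. algebraic x" and K: "subfield K type_ring" and S: "finite S"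
  shows "openin (krull_topology K) {\<sigma> \<in> carrier (Gal K). \<forall>s\<in>S. \<sigma> s = s}"
proof -
  obtain E where E: "finite_field_extension K E" "S \<subseteq> E"
    "\<forall>F. subfield F type_ring \<longrightarrow> K \<subseteq> F \<longrightarrow> S \<subseteq> F \<longrightarrow> E \<subseteq> F"
    using finite_extension_adjoin[OF alg K S] by auto
  have KE: "K \<subseteq> E" using E(1) by (simp add: finite_field_extension_def)
  have "{\<sigma> \<in> carrier (Gal K). \<forall>s\<in>S. \<sigma> s = s} = id <#\<^bsub>Gal K\<^esub> carrier (Gal E)"
  proof -
    have "id <#\<^bsub>Gal K\<^esub> carrier (Gal E) = carrier (Gal E)" by (auto simp: l_coset_def)
    moreover have "carrier (Gal E) = {\<sigma> \<in> carrier (Gal K). \<forall>s\<in>S. \<sigma> s = s}"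
    proof
      show "carrier (Gal E) \<subseteq> {\<sigma> \<in> carrier (Gal K). \<forall>s\<in>S. \<sigma> s = s}"
        using KE E(2) by (auto simp: carrier_Gal)
      show "{\<sigma> \<in> carrier (Gal K). \<forall>s\<in>S. \<sigma> s = s} \<subseteq> carrier (Gal E)"
      proof
        fix \<sigma> assume s: "\<sigma> \<in> {\<sigma> \<in> carrier (Gal K). \<forall>s\<in>S. \<sigma> s = s}"
        then have f: "\<sigma> \<in> field_aut" by (simp add: carrier_Gal)
        have "E \<subseteq> {x. \<sigma> x = x}"
          using E(3) subfield_fixed[OF f] s by (auto simp: carrier_Gal)
        then show "\<sigma> \<in> carrier (Gal E)" using f by (auto simp: carrier_Gal)
      qed
    qed
    ultimately show ?thesis by simp
  qed
  moreover have "id \<in> carrier (Gal K)" using monoid.one_closed[OF group.is_monoid[OF group_Gal[of K]]] by simp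
  ultimately show ?thesis
    unfolding krull_topology_def using E(1) by (intro topology_generated_by_Basis) auto
qed

text \<open>A finite extension \<open>E\<close> of \<open>K\<close> is spanned by finitely many elements, and an automorphism over \<open>K\<close> that fixes these
fixes \<open>E\<close>; so a basic open set around \<open>\<tau>\<close> is determined by the values on a finite set.\<close>

lemma krull_neighbourhood:
  fixes K :: "'q::field_char_0 set"
  assumes "openin (krull_topology K) V" "\<tau> \<in> V" "\<tau> \<in> carrier (Gal K)" and K: "subfield K type_ring"
  shows "\<exists>S. finite S \<and> (\<forall>\<tau>'\<in>carrier (Gal K). (\<forall>s\<in>S. \<tau>' s = \<tau> s) \<longrightarrow> \<tau>' \<in> V)"
proof -
  interpret R: field "type_ring :: 'q ring" by (rule field_from_type_algebra)
  interpret G: group "Gal K" by (rule group_Gal)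
  let ?B = "{\<sigma> <#\<^bsub>Gal K\<^esub> carrier (Gal E) | \<sigma> E. \<sigma> \<in> carrier (Gal K) \<and> finite_field_extension K E}"
  have "generate_topology_on ?B V"
    using openin_topology_generated_by[OF assms(1)[unfolded krull_topology_def]] .
  then show ?thesis using assms(2)
  proof induction
    case (Int a b)
    then obtain S T where "finite S" "finite T"
      "\<forall>\<tau>'\<in>carrier (Gal K). (\<forall>s\<in>S. \<tau>' s = \<tau> s) \<longrightarrow> \<tau>' \<in> a"
      "\<forall>\<tau>'\<in>carrier (Gal K). (\<forall>s\<in>T. \<tau>' s = \<tau> s) \<longrightarrow> \<tau>' \<in> b" by blast
    then show ?case by (intro exI[of _ "S \<union> T"]) auto
  next
    case (UN A)
    then obtain a where a: "a \<in> A" "\<tau> \<in> a" by blast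
    show ?case using UN.IH[OF a] a(1) by blast
  next
    case (Basis s)
    then obtain \<sigma> E where s: "s = \<sigma> <#\<^bsub>Gal K\<^esub> carrier (Gal E)" "\<sigma> \<in> carrier (Gal K)"
      and E: "finite_field_extension K E" by blast
    then obtain Us where Us: "set Us \<subseteq> E" "R.Span K Us = E"
      using R.exists_base[OF K] R.Span_base_incl[OF K] R.finite_dimensionE'
      unfolding finite_field_extension_def by (metis subset_UNIV type_ring_simps(1))
    obtain e where e: "e \<in> carrier (Gal E)" "\<tau> = \<sigma> \<circ> e" using s(1) Basis.prems by (auto simp: l_coset_def)
    show ?case
    proof (intro exI[of _ "set Us"] conjI ballI impI)
      fix \<tau>' assume \<tau>': "\<tau>' \<in> carrier (Gal K)" "\<forall>u\<in>set Us. \<tau>' u = \<tau> u"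
      define \<rho> where "\<rho> = inv_into UNIV \<sigma> \<circ> \<tau>'"
      have f: "\<sigma> \<in> field_aut" "\<tau>' \<in> field_aut" "e \<in> field_aut" using s(2) \<tau>'(1) e(1) by (auto simp: carrier_Gal)
      have \<rho>: "\<rho> \<in> carrier (Gal K)"
        using G.m_closed[OF G.inv_closed[OF s(2)] \<tau>'(1)] by (simp add: \<rho>_def Gal_inv[OF s(2)])
      have \<rho>f: "\<rho> \<in> field_aut" using \<rho> by (simp add: carrier_Gal)
      have \<rho>u: "\<rho> u = u" if "u \<in> set Us" for u
        using \<tau>'(2) that Us(1) e by (auto simp: \<rho>_def field_aut_inv_apply[OF f(1)] carrier_Gal)
      let ?F = "{x. \<rho> x = x}"
      have F: "subfield ?F type_ring" by (rule subfield_fixed[OF \<rho>f])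
      have KF: "K \<subseteq> ?F" using \<rho> by (auto simp: carrier_Gal)
      have "subalgebra K ?F type_ring"
      proof (rule subalgebra.intro)
        show "subgroup ?F (add_monoid type_ring)" using subfieldE(1)[OF F] by (rule subring.axioms(1))
        show "subalgebra_axioms K ?F type_ring"
          using KF by (auto simp: subalgebra_axioms_def field_autD[OF \<rho>f] subset_iff)
      qed
      then have "R.Span K Us \<subseteq> ?F"
        by (rule R.subalgebra_Span_incl[OF K]) (use \<rho>u in auto)
      then have "\<rho> \<in> carrier (Gal E)" using Us(2) \<rho>f by (auto simp: carrier_Gal)
      moreover have "\<tau>' = \<sigma> \<circ> \<rho>" by (simp add: \<rho>_def fun_eq_iff field_aut_inv_apply[OF f(1)])
      ultimately show "\<tau>' \<in> s" unfolding s(1) by (auto simp: l_coset_def)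
    qed simp
  qed simp
qed

lemma krull_closed_mem:
  fixes K :: "'q::field_char_0 set"
  assumes K: "subfield K type_ring" "finite_field_extension K K" and P: "closedin (krull_topology K) P" "P \<subseteq> carrier (Gal K)"
    and \<tau>: "\<tau> \<in> field_aut" and approx: "\<And>S. finite S \<Longrightarrow> \<exists>q\<in>P. \<forall>s\<in>S. q s = \<tau> s"
  shows "\<tau> \<in> P"
proof (rule ccontr)
  assume "\<tau> \<notin> P"
  have \<tau>K: "\<tau> \<in> carrier (Gal K)"
  proof -
    have "\<tau> x = x" if x: "x \<in> K" for x
    proof -
      obtain q where q: "q \<in> P" "q x = \<tau> x" using approx[of "{x}"] by auto
      then show ?thesis using P(2) x by (auto simp: carrier_Gal)
    qed
    then show ?thesis using \<tau> by (simp add: carrier_Gal)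
  qed
  interpret G: group "Gal K" by (rule group_Gal)
  have "\<tau> \<in> \<tau> <#\<^bsub>Gal K\<^esub> carrier (Gal K)" using G.one_closed by (auto simp: l_coset_def intro!: bexI[of _ id])
  then have "\<tau> \<in> topspace (krull_topology K)"
    unfolding krull_topology_def topology_generated_by_topspace using \<tau>K K(2) by blast
  then obtain S where "finite S"
    and S: "\<forall>\<tau>'\<in>carrier (Gal K). (\<forall>s\<in>S. \<tau>' s = \<tau> s) \<longrightarrow> \<tau>' \<in> topspace (krull_topology K) - P"
    using krull_neighbourhood[of K "topspace (krull_topology K) - P" \<tau>] P(1) \<open>\<tau> \<notin> P\<close> \<tau>K K
    by (auto simp: closedin_def)
  then show False using approx[of S] P(2) by blast
qed

section \<open>Sylow subgroups in finite quotients\<close>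

lemma (in group_hom) restrict_range:
  "group_hom G (H\<lparr>carrier := h ` carrier G\<rparr>) h"
proof -
  have "group (H\<lparr>carrier := h ` carrier G\<rparr>)"
    by (rule subgroup.subgroup_is_group[OF img_is_subgroup H.group_axioms])
  moreover have "h \<in> hom G (H\<lparr>carrier := h ` carrier G\<rparr>)" by (auto simp: hom_def)
  ultimately show ?thesis by (simp add: group_hom_def group_hom_axioms_def)
qed

lemma (in group_hom) order_FactGroup_kernel:
  "Coset.order (G Mod kernel G H h) = card (h ` carrier G)"
proof -
  interpret I: group_hom G "H\<lparr>carrier := h ` carrier G\<rparr>" h by (rule restrict_range)
  have "kernel G (H\<lparr>carrier := h ` carrier G\<rparr>) h = kernel G H h" by (simp add: kernel_def)
  then have "bij_betw (\<lambda>Y. the_elem (h ` Y)) (carrier (G Mod kernel G H h)) (h ` carrier G)"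
    using I.FactGroup_iso_set by (simp add: iso_def)
  then show ?thesis by (simp add: Coset.order_def bij_betw_same_card)
qed

text \<open>The index of \<open>P N\<close>, for \<open>N\<close> the kernel, is the index of the image of \<open>P\<close> in the image of the group: two elements lie
in the same coset of \<open>P N\<close> iff their images lie in the same coset of the image of \<open>P\<close>.\<close>

lemma (in group_hom) card_rcosets_mult_kernel:
  assumes P: "subgroup P G"
  shows "card (rcosets\<^bsub>G\<^esub> (P <#>\<^bsub>G\<^esub> kernel G H h)) * card (h ` P) = card (h ` carrier G)"
proof -
  let ?H = "H\<lparr>carrier := h ` carrier G\<rparr>"
  let ?PN = "P <#>\<^bsub>G\<^esub> kernel G H h"
  interpret P: subgroup P G by (rule P)
  interpret I: group_hom G ?H h by (rule restrict_range)
  have hP: "subgroup (h ` P) ?H" by (rule I.subgroup_img_is_subgroup[OF P])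
  have PN: "x \<in> ?PN \<longleftrightarrow> x \<in> carrier G \<and> h x \<in> h ` P" for x
  proof
    assume "x \<in> ?PN"
    then obtain u k where uk: "u \<in> P" "k \<in> carrier G" "h k = \<one>\<^bsub>H\<^esub>" "x = u \<otimes>\<^bsub>G\<^esub> k"
      by (auto simp: set_mult_def kernel_def)
    have "u \<in> carrier G" using uk(1) by (rule P.mem_carrier)
    then show "x \<in> carrier G \<and> h x \<in> h ` P" using uk by simp
  next
    assume *: "x \<in> carrier G \<and> h x \<in> h ` P"
    then obtain u where u: "u \<in> P" "h x = h u" by blast
    have uc: "u \<in> carrier G" using u(1) by (rule P.mem_carrier)
    have "x = u \<otimes>\<^bsub>G\<^esub> (inv\<^bsub>G\<^esub> u \<otimes>\<^bsub>G\<^esub> x)"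
      using * uc by (simp add: G.m_assoc[symmetric])
    moreover have "inv\<^bsub>G\<^esub> u \<otimes>\<^bsub>G\<^esub> x \<in> kernel G H h" using * uc u(2) by (simp add: kernel_def)
    ultimately show "x \<in> ?PN" using u(1) unfolding set_mult_def by blast
  qed
  have coset: "z \<in> ?PN #>\<^bsub>G\<^esub> x \<longleftrightarrow> z \<in> carrier G \<and> h z \<in> h ` P #>\<^bsub>?H\<^esub> h x" if x: "x \<in> carrier G" for x z
  proof
    assume "z \<in> ?PN #>\<^bsub>G\<^esub> x"
    then obtain y where y: "y \<in> carrier G" "h y \<in> h ` P" "z = y \<otimes>\<^bsub>G\<^esub> x"
      using PN unfolding r_coset_def by blast
    then show "z \<in> carrier G \<and> h z \<in> h ` P #>\<^bsub>?H\<^esub> h x" using x unfolding r_coset_def by auto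
  next
    assume *: "z \<in> carrier G \<and> h z \<in> h ` P #>\<^bsub>?H\<^esub> h x"
    then obtain u where u: "u \<in> P" "h z = h u \<otimes>\<^bsub>H\<^esub> h x" unfolding r_coset_def by auto
    have uc: "u \<in> carrier G" using u(1) by (rule P.mem_carrier)
    let ?y = "z \<otimes>\<^bsub>G\<^esub> inv\<^bsub>G\<^esub> x"
    have "h ?y = h u" using * u(2) uc x by (simp add: H.m_assoc)
    then have "?y \<in> ?PN" using PN[of ?y] u(1) * x by simp
    moreover have "z = ?y \<otimes>\<^bsub>G\<^esub> x" using * x by (simp add: G.m_assoc)
    ultimately show "z \<in> ?PN #>\<^bsub>G\<^esub> x" unfolding r_coset_def by blast
  qed
  have sub: "h ` P #>\<^bsub>?H\<^esub> h x \<subseteq> h ` carrier G" if x: "x \<in> carrier G" for x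
  proof
    fix w assume "w \<in> h ` P #>\<^bsub>?H\<^esub> h x"
    then obtain u where u: "u \<in> P" "w = h u \<otimes>\<^bsub>H\<^esub> h x" unfolding r_coset_def by auto
    have "u \<in> carrier G" using u(1) by (rule P.mem_carrier)
    then have "w = h (u \<otimes>\<^bsub>G\<^esub> x)" "u \<otimes>\<^bsub>G\<^esub> x \<in> carrier G" using u(2) x by simp_all
    then show "w \<in> h ` carrier G" by blast
  qed
  have img: "h ` (?PN #>\<^bsub>G\<^esub> x) = h ` P #>\<^bsub>?H\<^esub> h x" if x: "x \<in> carrier G" for x
  proof (intro equalityI subsetI)
    fix w assume "w \<in> h ` (?PN #>\<^bsub>G\<^esub> x)"
    then show "w \<in> h ` P #>\<^bsub>?H\<^esub> h x" using coset[OF x] by blast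
  next
    fix w assume w: "w \<in> h ` P #>\<^bsub>?H\<^esub> h x"
    then obtain z where "z \<in> carrier G" "w = h z" using sub[OF x] by blast
    then show "w \<in> h ` (?PN #>\<^bsub>G\<^esub> x)" using coset[OF x, of z] w by blast
  qed
  have "bij_betw ((`) h) (rcosets\<^bsub>G\<^esub> ?PN) (rcosets\<^bsub>?H\<^esub> (h ` P))"
  proof (rule bij_betw_imageI)
    show "inj_on ((`) h) (rcosets\<^bsub>G\<^esub> ?PN)"
    proof (rule inj_onI)
      fix C D assume "C \<in> rcosets\<^bsub>G\<^esub> ?PN" "D \<in> rcosets\<^bsub>G\<^esub> ?PN" and eq: "h ` C = h ` D"
      then obtain x y where xy: "x \<in> carrier G" "C = ?PN #>\<^bsub>G\<^esub> x" "y \<in> carrier G" "D = ?PN #>\<^bsub>G\<^esub> y"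
        unfolding RCOSETS_def by blast
      have "h ` P #>\<^bsub>?H\<^esub> h x = h ` P #>\<^bsub>?H\<^esub> h y" using eq img xy by simp
      then show "C = D" using coset[OF xy(1)] coset[OF xy(3)] unfolding xy(2,4) by blast
    qed
    show "(`) h ` (rcosets\<^bsub>G\<^esub> ?PN) = rcosets\<^bsub>?H\<^esub> (h ` P)"
    proof (intro equalityI subsetI)
      fix C assume "C \<in> (`) h ` (rcosets\<^bsub>G\<^esub> ?PN)"
      then obtain x where "x \<in> carrier G" "C = h ` (?PN #>\<^bsub>G\<^esub> x)" unfolding RCOSETS_def by blast
      then show "C \<in> rcosets\<^bsub>?H\<^esub> (h ` P)" using img unfolding RCOSETS_def by auto
    next
      fix C assume "C \<in> rcosets\<^bsub>?H\<^esub> (h ` P)"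
      then obtain x where x: "x \<in> carrier G" "C = h ` P #>\<^bsub>?H\<^esub> h x" unfolding RCOSETS_def by auto
      then have "C = h ` (?PN #>\<^bsub>G\<^esub> x)" using img by simp
      then show "C \<in> (`) h ` (rcosets\<^bsub>G\<^esub> ?PN)" using x(1) unfolding RCOSETS_def by blast
    qed
  qed
  then have "card (rcosets\<^bsub>G\<^esub> ?PN) = card (rcosets\<^bsub>?H\<^esub> (h ` P))" by (rule bij_betw_same_card)
  then show ?thesis using I.H.lagrange[OF hP] by (simp add: Coset.order_def)
qed

definition aut_orbit :: "'q::field \<Rightarrow> 'q set" where "aut_orbit x = {\<sigma> x | \<sigma>. \<sigma> \<in> field_aut}"

text \<open>The finite stable sets take the place of the finite normal extensions of the rationals: the Galois group of the
extension generated by such a set is the group of permutations of the set that the automorphisms induce.\<close>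

definition aut_stable :: "'q::field set \<Rightarrow> bool" where
  "aut_stable S \<longleftrightarrow> (\<forall>\<sigma>\<in>field_aut. \<forall>s\<in>S. \<sigma> s \<in> S)"

definition aut_hull :: "'q::field set \<Rightarrow> 'q set" where "aut_hull S = (\<Union>s\<in>S. aut_orbit s)"

lemma id_field_aut: "id \<in> field_aut" by (auto simp: field_aut_def)

lemma aut_orbit_self: "x \<in> aut_orbit x"
  unfolding aut_orbit_def using id_field_aut by (auto intro!: exI[of _ id])

lemma aut_hull_props:
  shows "S \<subseteq> aut_hull S" "aut_stable (aut_hull S)" "S \<subseteq> T \<Longrightarrow> aut_hull S \<subseteq> aut_hull T"
    "aut_stable S \<Longrightarrow> aut_hull S = S"
proof -
  show "S \<subseteq> aut_hull S" unfolding aut_hull_def using aut_orbit_self by blast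
  show "aut_stable (aut_hull S)"
    unfolding aut_stable_def aut_hull_def aut_orbit_def
    by clarsimp (metis comp_apply field_aut_comp)
  show "S \<subseteq> T \<Longrightarrow> aut_hull S \<subseteq> aut_hull T" unfolding aut_hull_def by blast
  show "aut_hull S = S" if "aut_stable S"
  proof
    show "aut_hull S \<subseteq> S" using that by (auto simp: aut_hull_def aut_stable_def aut_orbit_def)
    show "S \<subseteq> aut_hull S" unfolding aut_hull_def using aut_orbit_self by blast
  qed
qed

lemma finite_aut_orbit:
  fixes x :: "'q::field_char_0"
  assumes "algebraic x" shows "finite (aut_orbit x)"
proof -
  obtain p where p: "p \<noteq> 0" "int_poly_val p x = 0" by (rule algebraicE'[OF assms])
  have "aut_orbit x \<subseteq> {y. int_poly_val p y = 0}"
    using field_aut_int_poly_val[of _ p x] p(2) by (auto simp: aut_orbit_def field_autD)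
  moreover have "finite {y :: 'q. int_poly_val p y = 0}" by (rule poly_roots_finite) (simp add: p(1))
  ultimately show ?thesis by (rule finite_subset)
qed

lemma finite_aut_hull:
  "(\<And>x::'q::field_char_0. algebraic x) \<Longrightarrow> finite (S :: 'q set) \<Longrightarrow> finite (aut_hull S)"
  unfolding aut_hull_def by (simp add: finite_aut_orbit)

lemma Gal_action:
  fixes K :: "'q::field_char_0 set"
  assumes "\<And>\<sigma> s. \<sigma> \<in> carrier (Gal K) \<Longrightarrow> s \<in> S \<Longrightarrow> \<sigma> s \<in> S"
  shows "group_action (Gal K) S (\<lambda>\<sigma>. restrict \<sigma> S)"
  using assms by (intro group_actionI[OF group_Gal]) simp_all

lemma Gal_restrict_hom:
  fixes K :: "'q::field_char_0 set"
  assumes "aut_stable S"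
  shows "group_hom (Gal K) (BijGroup S) (\<lambda>\<sigma>. restrict \<sigma> S)"
  by (rule group_action.group_hom[OF Gal_action]) (use assms in \<open>auto simp: carrier_Gal aut_stable_def\<close>)

text \<open>The automorphisms over \<open>K\<close> that fix \<open>S\<close> pointwise form an open normal subgroup, so that both clauses in the
definition of a Sylow subgroup apply to it. They say that the image of \<open>P\<close> in the permutation group of \<open>S\<close> is a
Sylow subgroup of the image of the Galois group.\<close>

lemma sylow_finite_level:
  fixes K :: "'q::field_char_0 set"
  assumes alg: "\<And>x::'q. algebraic x" and K: "subfield K type_ring"
    and P: "sylow_subgroup p (Gal K) (krull_topology K) P"
    and S: "finite S" "aut_stable S"
  shows "\<exists>a m. card ((\<lambda>\<sigma>. restrict \<sigma> S) ` P) = p ^ a \<and>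
    card ((\<lambda>\<sigma>. restrict \<sigma> S) ` carrier (Gal K)) = p ^ a * m \<and> \<not> p dvd m"
proof -
  let ?\<rho> = "\<lambda>\<sigma>. restrict \<sigma> S"
  let ?T = "krull_topology K"
  let ?GP = "Gal K\<lparr>carrier := P\<rparr>"
  interpret h: group_hom "Gal K" "BijGroup S" ?\<rho> by (rule Gal_restrict_hom[OF S(2)])
  let ?N = "kernel (Gal K) (BijGroup S) ?\<rho>"
  have sub: "subgroup P (Gal K)" and pro: "pro_p_group p ?GP (subtopology ?T P)"
    and idx: "\<And>U. open_normal_subgroup (Gal K) ?T U \<Longrightarrow> \<not> p dvd card (rcosets\<^bsub>Gal K\<^esub> (P <#>\<^bsub>Gal K\<^esub> U))"
    using P by (auto simp: sylow_subgroup_def)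
  have PG: "P \<subseteq> carrier (Gal K)" by (rule subgroup.subset[OF sub])
  have N: "?N = {\<sigma> \<in> carrier (Gal K). \<forall>s\<in>S. \<sigma> s = s}"
    by (auto simp: kernel_def BijGroup_def restrict_def fun_eq_iff)
  have openN: "openin ?T ?N" unfolding N by (rule openin_krull_fixing[OF alg K S(1)])
  interpret hP: group_hom ?GP "BijGroup S" ?\<rho>
  proof (rule group_hom.intro)
    show "group ?GP" by (rule subgroup.subgroup_is_group[OF sub group_Gal])
    show "group_hom_axioms ?GP (BijGroup S) ?\<rho>"
      using h.homh PG by (auto simp: group_hom_axioms_def hom_def)
  qed (rule group_BijGroup)
  let ?NP = "kernel ?GP (BijGroup S) ?\<rho>"
  have NP: "?NP = ?N \<inter> P" using PG by (auto simp: kernel_def)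
  have "open_normal_subgroup ?GP (subtopology ?T P) ?NP"
    unfolding open_normal_subgroup_def
  proof
    show "?NP \<lhd> ?GP" by (rule hP.normal_kernel)
    show "openin (subtopology ?T P) ?NP" unfolding NP openin_subtopology using openN by blast
  qed
  then obtain a where a: "Coset.order (?GP Mod ?NP) = p ^ a" using pro by (auto simp: pro_p_group_def)
  have "card (?\<rho> ` P) = p ^ a" using hP.order_FactGroup_kernel a by simp
  moreover have "\<not> p dvd card (rcosets\<^bsub>Gal K\<^esub> (P <#>\<^bsub>Gal K\<^esub> ?N))"
    by (rule idx) (simp add: open_normal_subgroup_def h.normal_kernel openN)
  ultimately show ?thesis
    using h.card_rcosets_mult_kernel[OF sub] by (metis mult.commute)
qed

lemma finite_Bij: "finite S \<Longrightarrow> finite (Bij S)"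
  by (rule finite_subset[of _ "S \<rightarrow>\<^sub>E S"]) (auto simp: Bij_def bij_betw_def PiE_def intro: finite_PiE[unfolded PiE_def])

text \<open>An orbit on \<open>T\<close> under the stabilizer of \<open>\<alpha>\<close> has size prime to \<open>p\<close>, since \<open>T\<close> has; this supplies the point \<open>y'\<close>
for the finite group of permutations of \<open>S\<close>.\<close>

lemma sylow_conjugate_finite_level:
  fixes \<alpha> \<beta> :: "'q::field_char_0"
  assumes alg: "\<And>x::'q. algebraic x" and p: "Factorial_Ring.prime p"
    and P: "sylow_subgroup p (Gal (rat_adjoin \<alpha>)) (krull_topology (rat_adjoin \<alpha>)) P"
    and Q: "sylow_subgroup p (Gal (rat_adjoin \<beta>)) (krull_topology (rat_adjoin \<beta>)) Q"
    and S: "finite S" "aut_stable S" "\<alpha> \<in> S" "\<beta> \<in> S"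
    and card: "card (aut_orbit \<alpha>) = card (aut_orbit \<beta>)"
    and T: "T \<subseteq> aut_orbit \<beta>" "\<And>\<sigma> t. \<sigma> \<in> field_aut \<Longrightarrow> \<sigma> \<alpha> = \<alpha> \<Longrightarrow> t \<in> T \<Longrightarrow> \<sigma> t \<in> T"
      "\<not> p dvd card T"
  shows "\<exists>h\<in>field_aut. (\<lambda>\<sigma>. restrict \<sigma> S) ` Q = (\<lambda>\<sigma>. restrict (h \<circ> \<sigma> \<circ> inv_into UNIV h) S) ` P"
proof -
  let ?K = "rat_adjoin \<alpha>" and ?L = "rat_adjoin \<beta>"
  let ?\<rho> = "\<lambda>\<sigma>. restrict \<sigma> S"
  have PK: "subgroup P (Gal ?K)" and QL: "subgroup Q (Gal ?L)" using P Q by (auto simp: sylow_subgroup_def)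
  have PQ: "P \<subseteq> carrier (Gal ?K)" "Q \<subseteq> carrier (Gal ?L)" using subgroup.subset[OF PK] subgroup.subset[OF QL] .
  interpret Q: group "Gal (\<rat> :: 'q set)" by (rule group_Gal)
  have PQs: "subgroup P (Gal \<rat>)" "subgroup Q (Gal \<rat>)"
    using Q.incl_subgroup[OF subgroup_Gal, of P ?K] Q.incl_subgroup[OF subgroup_Gal, of Q ?L] PK QL
    by (simp_all add: Gal_carrier_update[symmetric])
  interpret h: group_hom "Gal \<rat>" "BijGroup S" ?\<rho> by (rule Gal_restrict_hom[OF S(2)])
  define \<Gamma> where "\<Gamma> = BijGroup S\<lparr>carrier := ?\<rho> ` field_aut\<rparr>"
  have sub\<Gamma>: "subgroup (?\<rho> ` field_aut) (BijGroup S)" using h.img_is_subgroup by (simp add: carrier_Gal_Rats)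
  interpret \<Gamma>: group \<Gamma> unfolding \<Gamma>_def by (rule subgroup.subgroup_is_group[OF sub\<Gamma> group_BijGroup])
  interpret r: group_hom "Gal \<rat>" \<Gamma> ?\<rho> using h.restrict_range by (simp add: \<Gamma>_def carrier_Gal_Rats)
  have \<Gamma>c: "carrier \<Gamma> = ?\<rho> ` field_aut" by (simp add: \<Gamma>_def)
  have \<Gamma>m: "monoid.mult \<Gamma> = monoid.mult (BijGroup S)" by (simp add: \<Gamma>_def)
  interpret A: group_action \<Gamma> S "\<lambda>f. f"
  proof
    show "(\<lambda>f. f) \<in> hom \<Gamma> (BijGroup S)"
      using subgroup.subset[OF sub\<Gamma>] by (auto simp: hom_def \<Gamma>c \<Gamma>m)
  qed
  have fin: "finite (carrier \<Gamma>)"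
    using finite_subset[OF subgroup.subset[OF sub\<Gamma>]] finite_Bij[OF S(1)] by (simp add: \<Gamma>c BijGroup_def)
  have orb: "orbit \<Gamma> (\<lambda>f. f) x = aut_orbit x" if "x \<in> S" for x
  proof -
    have "orbit \<Gamma> (\<lambda>f. f) x = (\<lambda>\<sigma>. restrict \<sigma> S x) ` field_aut"
      unfolding orbit_def Setcompr_eq_image \<Gamma>c image_image ..
    also have "\<dots> = aut_orbit x" using that by (auto simp: aut_orbit_def)
    finally show ?thesis .
  qed
  have stab: "stabilizer \<Gamma> (\<lambda>f. f) x = ?\<rho> ` carrier (Gal (rat_adjoin x))" if "x \<in> S" for x
    using that by (auto simp: stabilizer_def carrier_Gal_rat_adjoin \<Gamma>c)
  have "group_action (Gal ?K) T (\<lambda>\<sigma>. restrict \<sigma> T)"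
    by (rule Gal_action) (use T(2) in \<open>auto simp: carrier_Gal_rat_adjoin\<close>)
  moreover have "finite T" using T(1) finite_aut_orbit[OF alg] finite_subset by blast
  ultimately obtain y' where y': "y' \<in> T" "\<not> p dvd card (orbit (Gal ?K) (\<lambda>\<sigma>. restrict \<sigma> T) y')"
    using group_action.prime_dvd_card_if_dvd_orbits T(3) by blast
  have y'S: "y' \<in> S"
  proof -
    have "aut_orbit \<beta> \<subseteq> S" using S(2,4) by (auto simp: aut_orbit_def aut_stable_def)
    then show ?thesis using y'(1) T(1) by blast
  qed
  have orb': "orbit (Gal ?K) (\<lambda>\<sigma>. restrict \<sigma> T) y' = (\<lambda>g. g y') ` stabilizer \<Gamma> (\<lambda>f. f) \<alpha>"
    unfolding orbit_def Setcompr_eq_image stab[OF S(3)] image_image using y'(1) y'S by simp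
  obtain a m where am: "card (?\<rho> ` P) = p ^ a" "card (?\<rho> ` carrier (Gal ?K)) = p ^ a * m" "\<not> p dvd m"
    using sylow_finite_level[OF alg subfield_rat_adjoin P S(1,2)] by blast
  obtain b k where bk: "card (?\<rho> ` Q) = p ^ b" "card (?\<rho> ` carrier (Gal ?L)) = p ^ b * k" "\<not> p dvd k"
    using sylow_finite_level[OF alg subfield_rat_adjoin Q S(1,2)] by blast
  have subPQ: "subgroup (?\<rho> ` P) \<Gamma>" "subgroup (?\<rho> ` Q) \<Gamma>" using r.subgroup_img_is_subgroup PQs by auto
  have "y' \<in> aut_orbit \<beta>" using T(1) y'(1) by blast
  then have "\<exists>g\<in>carrier \<Gamma>. ?\<rho> ` Q = (\<lambda>x. g \<otimes>\<^bsub>\<Gamma>\<^esub> x \<otimes>\<^bsub>\<Gamma>\<^esub> inv\<^bsub>\<Gamma>\<^esub> g) ` (?\<rho> ` P)"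
    using y'(2) card am bk subPQ image_mono[OF PQ(1), of ?\<rho>] image_mono[OF PQ(2), of ?\<rho>]
    by (intro A.stabilizer_sylow_conjugate[OF fin p S(3,4), where y' = y' and a = a and m = m and b = b and k = k]) (simp_all only: orb orb' stab S(3,4) not_False_eq_True)
  then obtain g where g: "g \<in> carrier \<Gamma>" "?\<rho> ` Q = (\<lambda>x. g \<otimes>\<^bsub>\<Gamma>\<^esub> x \<otimes>\<^bsub>\<Gamma>\<^esub> inv\<^bsub>\<Gamma>\<^esub> g) ` (?\<rho> ` P)"
    by blast
  from g(1) obtain h where h: "h \<in> field_aut" "g = ?\<rho> h" by (auto simp: \<Gamma>c)
  have hc: "h \<in> carrier (Gal \<rat>)" using h(1) by (simp add: carrier_Gal_Rats)
  have conj: "g \<otimes>\<^bsub>\<Gamma>\<^esub> ?\<rho> \<sigma> \<otimes>\<^bsub>\<Gamma>\<^esub> inv\<^bsub>\<Gamma>\<^esub> g = ?\<rho> (h \<circ> \<sigma> \<circ> inv_into UNIV h)" if "\<sigma> \<in> P" for \<sigma>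
  proof -
    have \<sigma>c: "\<sigma> \<in> carrier (Gal \<rat>)" using that subgroup.subset[OF PQs(1)] by blast
    have "g \<otimes>\<^bsub>\<Gamma>\<^esub> ?\<rho> \<sigma> \<otimes>\<^bsub>\<Gamma>\<^esub> inv\<^bsub>\<Gamma>\<^esub> g = ?\<rho> (h \<otimes>\<^bsub>Gal \<rat>\<^esub> \<sigma> \<otimes>\<^bsub>Gal \<rat>\<^esub> inv\<^bsub>Gal \<rat>\<^esub> h)"
      unfolding h(2) using hc \<sigma>c by (simp only: r.hom_mult r.hom_inv Q.m_closed Q.inv_closed)
    then show ?thesis by (simp add: Gal_inv[OF hc])
  qed
  have "?\<rho> ` Q = (\<lambda>\<sigma>. ?\<rho> (h \<circ> \<sigma> \<circ> inv_into UNIV h)) ` P"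
    unfolding g(2) image_image using conj by (rule image_cong[OF refl])
  then show ?thesis using h(1) by blast
qed

lemma field_aut_limit:
  fixes g :: "'q::field_char_0 \<Rightarrow> 'q"
  assumes alg: "\<And>x::'q. algebraic x"
    and approx: "\<And>S. finite S \<Longrightarrow> \<exists>h\<in>field_aut. \<forall>s\<in>S. h s = g s"
  shows "g \<in> field_aut"
proof (rule field_autI[OF alg])
  fix x y
  obtain h where h: "h \<in> field_aut" and "\<forall>s\<in>{x, y, x + y, x * y}. h s = g s"
    using approx[of "{x, y, x + y, x * y}"] by blast
  then have eq: "h x = g x" "h y = g y" "h (x + y) = g (x + y)" "h (x * y) = g (x * y)" by blast+
  show "g (x + y) = g x + g y" "g (x * y) = g x * g y"
    using field_autD(2,3)[OF h, of x y] unfolding eq .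
next
  obtain h where h: "h \<in> field_aut" "\<forall>s\<in>{1}. h s = g s" using approx[of "{1}"] by auto
  then show "g 1 = 1" using field_autD(5)[OF h(1)] by simp
qed

section \<open>Conjugacy in the absolute Galois group\<close>

text \<open>Compactness yields one automorphism \<open>g\<close> whose conjugation agrees with the ones found on every finite stable set.
Then \<open>Q\<close> and the conjugate of \<open>P\<close> under \<open>g\<close> have the same restrictions to all finite sets, and are equal because
both groups are closed.\<close>

theorem sylow_conjugateI:
  fixes \<alpha> \<beta> :: "'q::field_char_0"
  assumes alg: "\<And>x::'q. algebraic x"
    and card: "card (aut_orbit \<alpha>) = card (aut_orbit \<beta>)"
    and T: "\<And>p::nat. Factorial_Ring.prime p \<Longrightarrow> \<exists>T\<subseteq>aut_orbit \<beta>.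
      (\<forall>\<sigma>\<in>field_aut. \<sigma> \<alpha> = \<alpha> \<longrightarrow> (\<forall>t\<in>T. \<sigma> t \<in> T)) \<and> \<not> p dvd card T"
  shows "sylow_conjugate (rat_adjoin \<alpha>) (rat_adjoin \<beta>)"
  unfolding sylow_conjugate_def
proof (intro allI impI)
  fix p P Q
  let ?K = "rat_adjoin \<alpha>" and ?L = "rat_adjoin \<beta>"
  assume p: "Factorial_Ring.prime p"
    and P: "sylow_subgroup p (Gal ?K) (krull_topology ?K) P"
    and Q: "sylow_subgroup p (Gal ?L) (krull_topology ?L) Q"
  obtain T where T: "T \<subseteq> aut_orbit \<beta>" "\<forall>\<sigma>\<in>field_aut. \<sigma> \<alpha> = \<alpha> \<longrightarrow> (\<forall>t\<in>T. \<sigma> t \<in> T)" "\<not> p dvd card T"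
    using T[OF p] by blast
  have PQ: "P \<subseteq> carrier (Gal ?K)" "Q \<subseteq> carrier (Gal ?L)"
    and closed: "closedin (krull_topology ?K) P" "closedin (krull_topology ?L) Q"
    using P Q subgroup.subset by (auto simp: sylow_subgroup_def)
  have aut: "\<sigma> \<in> field_aut" if "\<sigma> \<in> P \<or> \<sigma> \<in> Q" for \<sigma> using that PQ by (auto simp: carrier_Gal)
  \<comment> \<open>the finite stable set on which the condition for \<open>S\<close> is imposed\<close>
  define H where "H = (\<lambda>S. aut_hull (insert \<alpha> (insert \<beta> S)))"
  have H: "S \<subseteq> H S" "aut_stable (H S)" "\<alpha> \<in> H S" "\<beta> \<in> H S" for S
    using aut_hull_props(1,2)[of "insert \<alpha> (insert \<beta> S)"] by (auto simp: H_def)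
  have Hmono: "S \<subseteq> U \<Longrightarrow> H S \<subseteq> H U" for S U unfolding H_def by (intro aut_hull_props(3)) blast
  have Hfin: "finite S \<Longrightarrow> finite (H S)" for S unfolding H_def by (intro finite_aut_hull[OF alg]) simp
  have HH: "H (H S) = H S" for S
  proof -
    have "insert \<alpha> (insert \<beta> (H S)) = H S" using H(3,4)[of S] by blast
    then show ?thesis unfolding H_def[of] using aut_hull_props(4)[OF H(2)[of S]] by (simp add: H_def)
  qed
  have perm: "\<sigma> s \<in> H S" if "\<sigma> \<in> field_aut" "s \<in> H S" for \<sigma> s S
    using H(2)[of S] that by (auto simp: aut_stable_def)
  let ?c = "\<lambda>h \<sigma>. h \<circ> \<sigma> \<circ> inv_into UNIV h"
  define W where "W S = {h \<in> field_aut. (\<lambda>\<sigma>. restrict \<sigma> (H S)) ` Q = (\<lambda>\<sigma>. restrict (?c h \<sigma>) (H S)) ` P}" for S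
  have anti: "W U \<subseteq> W S" if "S \<subseteq> U" for S U
  proof
    fix h assume "h \<in> W U"
    then have h: "h \<in> field_aut" and
      eq: "(\<lambda>\<sigma>. restrict \<sigma> (H U)) ` Q = (\<lambda>\<sigma>. restrict (?c h \<sigma>) (H U)) ` P" by (auto simp: W_def)
    have r: "restrict (restrict f (H U)) (H S) = restrict f (H S)" for f :: "'q \<Rightarrow> 'q"
      using Hmono[OF \<open>S \<subseteq> U\<close>] by (auto simp: fun_eq_iff restrict_def)
    have "(\<lambda>f. restrict f (H S)) ` (\<lambda>\<sigma>. restrict \<sigma> (H U)) ` Q = (\<lambda>f. restrict f (H S)) ` (\<lambda>\<sigma>. restrict (?c h \<sigma>) (H U)) ` P"
      using eq by simp
    then have "(\<lambda>\<sigma>. restrict \<sigma> (H S)) ` Q = (\<lambda>\<sigma>. restrict (?c h \<sigma>) (H S)) ` P"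
      by (simp only: image_image r)
    then show "h \<in> W S" using h by (simp add: W_def)
  qed
  have ne: "W S \<noteq> {}" if "finite S" for S
    using sylow_conjugate_finite_level[OF alg p P Q Hfin[OF that] H(2,3,4) card T(1) _ T(3)] T(2)
    unfolding W_def by blast
  have "\<exists>g. \<forall>S. finite S \<longrightarrow> (\<exists>h\<in>W S. \<forall>x\<in>S. h x = g x)"
  proof (rule finite_dependence_compactness[where A = aut_orbit])
    show "finite (aut_orbit x)" for x :: 'q by (rule finite_aut_orbit[OF alg])
    show "h x \<in> aut_orbit x" if "h \<in> W S" for h S and x :: 'q using that by (auto simp: W_def aut_orbit_def)
  qed (use anti ne in auto)
  then obtain g where g: "\<And>S. finite S \<Longrightarrow> \<exists>h\<in>W S. \<forall>x\<in>S. h x = g x" by blast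
  have gf: "g \<in> field_aut"
    by (rule field_aut_limit[OF alg]) (use g in \<open>force simp: W_def\<close>)
  have level: "(\<lambda>\<sigma>. restrict \<sigma> (H S)) ` Q = (\<lambda>\<sigma>. restrict (?c g \<sigma>) (H S)) ` P" if S: "finite S" for S
  proof -
    obtain h where h: "h \<in> W (H S)" "\<forall>x\<in>H S. h x = g x" using g[OF Hfin[OF S]] by blast
    have hf: "h \<in> field_aut" and eq: "(\<lambda>\<sigma>. restrict \<sigma> (H S)) ` Q = (\<lambda>\<sigma>. restrict (?c h \<sigma>) (H S)) ` P"
      using h(1) by (auto simp: W_def HH)
    have "restrict (?c h \<sigma>) (H S) = restrict (?c g \<sigma>) (H S)" if "\<sigma> \<in> P" for \<sigma>
    proof (rule restrict_ext)
      fix s assume s: "s \<in> H S"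
      have ig: "inv_into UNIV g s \<in> H S" by (rule perm[OF field_aut_inv[OF gf] s])
      then have "h (inv_into UNIV g s) = s" using h(2) field_aut_inv_apply(1)[OF gf] by simp
      then have "inv_into UNIV h s = inv_into UNIV g s"
        using field_aut_inv_apply(2)[OF hf, of "inv_into UNIV g s"] by simp
      moreover have "\<sigma> (inv_into UNIV g s) \<in> H S" using perm ig aut that by blast
      ultimately show "?c h \<sigma> s = ?c g \<sigma> s" using h(2) by simp
    qed
    then show ?thesis unfolding eq by (rule image_cong[OF refl])
  qed
  have KK: "finite_field_extension K K" if K: "subfield K type_ring" for K :: "'q set"
  proof -
    obtain E where E: "finite_field_extension K E" "\<forall>F. subfield F type_ring \<longrightarrow> K \<subseteq> F \<longrightarrow> {} \<subseteq> F \<longrightarrow> E \<subseteq> F"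
      using finite_extension_adjoin[OF alg K, of "{}"] by auto
    then have "E = K" using K by (auto simp: finite_field_extension_def)
    then show ?thesis using E(1) by simp
  qed
  have "Q = (?c g) ` P"
  proof (intro equalityI subsetI)
    fix \<tau> assume \<tau>: "\<tau> \<in> (?c g) ` P"
    then obtain \<sigma> where \<sigma>: "\<sigma> \<in> P" "\<tau> = ?c g \<sigma>" by blast
    show "\<tau> \<in> Q"
    proof (rule krull_closed_mem[OF subfield_rat_adjoin KK[OF subfield_rat_adjoin] closed(2) PQ(2)])
      show "\<tau> \<in> field_aut" unfolding \<sigma>(2) using gf aut \<sigma>(1) field_aut_inv by (intro field_aut_comp) auto
      fix S :: "'q set" assume S: "finite S"
      have "restrict \<tau> (H S) \<in> (\<lambda>\<sigma>. restrict \<sigma> (H S)) ` Q" unfolding level[OF S] using \<sigma> by blast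
      then obtain q where q: "q \<in> Q" "restrict \<tau> (H S) = restrict q (H S)" by blast
      have "q s = \<tau> s" if "s \<in> S" for s
        using fun_cong[OF q(2), of s] that H(1)[of S] by (auto simp: subset_iff)
      then show "\<exists>q\<in>Q. \<forall>s\<in>S. q s = \<tau> s" using q(1) by blast
    qed
  next
    fix \<tau> assume \<tau>: "\<tau> \<in> Q"
    let ?\<sigma> = "inv_into UNIV g \<circ> \<tau> \<circ> g"
    have "?\<sigma> \<in> P"
    proof (rule krull_closed_mem[OF subfield_rat_adjoin KK[OF subfield_rat_adjoin] closed(1) PQ(1)])
      show "?\<sigma> \<in> field_aut" using gf aut \<tau> field_aut_inv by (intro field_aut_comp) auto
      fix S :: "'q set" assume S: "finite S"
      have "restrict \<tau> (H S) \<in> (\<lambda>\<sigma>. restrict (?c g \<sigma>) (H S)) ` P" unfolding level[OF S, symmetric] using \<tau> by blast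
      then obtain q where q: "q \<in> P" "restrict \<tau> (H S) = restrict (?c g q) (H S)" by blast
      have "q s = ?\<sigma> s" if "s \<in> S" for s
      proof -
        have "g s \<in> H S" using perm[OF gf] that H(1)[of S] by blast
        then have "\<tau> (g s) = ?c g q (g s)" using fun_cong[OF q(2), of "g s"] by simp
        then show ?thesis by (simp add: field_aut_inv_apply[OF gf])
      qed
      then show "\<exists>q\<in>P. \<forall>s\<in>S. q s = ?\<sigma> s" using q(1) by blast
    qed
    moreover have "\<tau> = ?c g ?\<sigma>" by (simp add: fun_eq_iff field_aut_inv_apply[OF gf])
    ultimately show "\<tau> \<in> (?c g) ` P" by blast
  qed
  moreover have "g \<in> carrier (Gal \<rat>)" using gf by (simp add: carrier_Gal_Rats)
  ultimately show "conjugate_subgroups (Gal \<rat>) P Q"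
    unfolding conjugate_subgroups_def by (intro bexI[of _ g]) (simp_all add: Gal_inv)
qed

section \<open>Roots of irreducible integer polynomials\<close>

text \<open>Gauss's lemma in the form needed here, with irreducibility only among monic integer polynomials: let \<open>s\<close> have least
degree among the integer polynomials vanishing at \<open>x\<close>. Pseudo-division shows that \<open>s\<close> divides integer multiples of
\<open>p\<close> and of \<open>r\<close>; passing to primitive parts, \<open>p\<close> is up to sign the primitive part of \<open>s\<close>.\<close>

lemma dvd_of_common_root:
  fixes p r :: "int poly" and x :: "'q::field_char_0"
  assumes monic: "lead_coeff p = 1"
    and irr: "\<And>s t. p = s * t \<Longrightarrow> lead_coeff s = 1 \<Longrightarrow> lead_coeff t = 1 \<Longrightarrow> degree s = 0 \<or> degree t = 0"
    and root: "int_poly_val p x = 0" "int_poly_val r x = 0"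
  shows "p dvd r"
proof -
  have p0: "p \<noteq> 0" using monic by auto
  obtain s where s: "s \<noteq> 0" "int_poly_val s x = 0"
    and min: "\<And>u. u \<noteq> 0 \<Longrightarrow> int_poly_val u x = 0 \<Longrightarrow> degree s \<le> degree u"
    using ex_has_least_nat[of "\<lambda>u. u \<noteq> 0 \<and> int_poly_val u x = 0" p degree] p0 root(1) by blast
  have reduce: "\<exists>a q. a \<noteq> 0 \<and> smult a u = s * q" if u: "int_poly_val u x = 0" for u
  proof -
    obtain a q where aq: "a \<noteq> 0" "smult a u = s * q + pseudo_mod u s"
      using pseudo_mod(1)[OF s(1)] by blast
    have "int_poly_val (smult a u) x = int_poly_val (s * q + pseudo_mod u s) x" by (simp only: aq(2))
    then have "int_poly_val (pseudo_mod u s) x = 0" using u s(2) by (simp add: map_poly_of_int_hom)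
    then have "pseudo_mod u s = 0" using min pseudo_mod(2)[OF s(1), of u] by force
    then show ?thesis using aq by auto
  qed
  obtain a q where aq: "a \<noteq> 0" "smult a p = s * q" using reduce[OF root(1)] by blast
  have pp: "primitive_part p = p"
  proof -
    have "content p dvd 1" using content_dvd_coeff[of p "degree p"] monic by simp
    then have "content p = 1" by (metis content_primitive_part is_unit_content_iff normalize_content)
    then show ?thesis using content_times_primitive_part[of p] by simp
  qed
  define s1 where "s1 = primitive_part s"
  define u where "u = lead_coeff s1"
  have "smult (unit_factor a) p = s1 * primitive_part q"
    using arg_cong[OF aq(2), of primitive_part] by (simp add: primitive_part_smult primitive_part_mult pp s1_def)
  moreover have sq: "unit_factor a * unit_factor a = 1" using aq(1) by (simp add: sgn_if)
  ultimately have "smult (unit_factor a * unit_factor a) p = s1 * smult (unit_factor a) (primitive_part q)"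
    by (metis mult_smult_right smult_smult)
  then have eq: "p = s1 * smult (unit_factor a) (primitive_part q)" unfolding sq by simp
  then have "u * lead_coeff (smult (unit_factor a) (primitive_part q)) = 1"
    using monic lead_coeff_mult[of s1 "smult (unit_factor a) (primitive_part q)"] unfolding u_def by metis
  then have u: "u * u = 1" unfolding zmult_eq_1_iff by auto
  define s2 where "s2 = smult u s1"
  define t2 where "t2 = smult u (smult (unit_factor a) (primitive_part q))"
  have "s2 * t2 = smult (u * u) (s1 * smult (unit_factor a) (primitive_part q))"
    unfolding s2_def t2_def by (simp only: mult_smult_left mult_smult_right smult_smult mult_ac)
  then have st: "p = s2 * t2" using eq u by simp
  have ls: "lead_coeff s2 = 1" using u unfolding s2_def lead_coeff_smult by (simp only: u_def)
  have lt: "lead_coeff t2 = 1" using monic ls lead_coeff_mult[of s2 t2] st by simp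
  have s_eq: "s = smult (content s * u) s2"
    using u content_times_primitive_part[of s] by (simp add: s2_def s1_def mult.assoc)
  have s2x: "int_poly_val s2 x = 0"
  proof -
    have "of_int (content s * u) * int_poly_val s2 x = 0"
      using s(2) arg_cong[OF s_eq, of "\<lambda>v. int_poly_val v x"] by (simp only: map_poly_of_int_hom poly_smult)
    moreover have "content s * u \<noteq> 0" using s(1) u by auto
    ultimately show ?thesis by (simp only: mult_eq_0_iff of_int_eq_0_iff) simp
  qed
  have "degree s2 \<noteq> 0"
  proof
    assume "degree s2 = 0"
    then have "s2 = 1" using ls by (auto elim!: degree_eq_zeroE)
    then show False using s2x by simp
  qed
  then have "degree t2 = 0" using irr[OF st ls lt] by simp
  then have "t2 = 1" using lt by (auto elim!: degree_eq_zeroE)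
  then have ps: "p = s2" using st by simp
  obtain b v where bv: "b \<noteq> 0" "smult b r = s * v" using reduce[OF root(2)] by blast
  then have "smult b r = p * smult (content s * u) v" using s_eq ps by (metis mult_smult_left mult_smult_right)
  then have "primitive_part (smult b r) = p * primitive_part (smult (content s * u) v)"
    by (simp only: primitive_part_mult pp)
  then have "smult (unit_factor b) (primitive_part r) = p * primitive_part (smult (content s * u) v)"
    by (simp add: primitive_part_smult)
  then have "p dvd smult (unit_factor b) (primitive_part r)" by simp
  then have "p dvd smult (unit_factor b) (smult (unit_factor b) (primitive_part r))" by (rule dvd_smult)
  moreover have "unit_factor b * unit_factor b = 1" using bv(1) by (simp add: sgn_if)
  ultimately have "p dvd primitive_part r" by (simp only: smult_smult smult_1_left)
  then have "p dvd smult (content r) (primitive_part r)" by (rule dvd_smult)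
  then show ?thesis by simp
qed

definition monic_irreducible :: "int poly \<Rightarrow> bool" where
  "monic_irreducible p \<longleftrightarrow> lead_coeff p = 1 \<and> degree p > 0 \<and>
     (\<forall>s t. p = s * t \<longrightarrow> lead_coeff s = 1 \<longrightarrow> lead_coeff t = 1 \<longrightarrow> degree s = 0 \<or> degree t = 0)"

lemma monic_irreducible_dvd:
  fixes x :: "'q::field_char_0"
  assumes "monic_irreducible p" "int_poly_val p x = 0" "int_poly_val r x = 0"
  shows "p dvd r"
  using assms by (intro dvd_of_common_root[of p x r]) (auto simp: monic_irreducible_def)

lemma aut_orbit_root:
  fixes x :: "'q::{alg_closed_field,field_char_0}"
  assumes alg: "\<And>x::'q. algebraic x" and p: "monic_irreducible p" "int_poly_val p x = 0"
  shows "aut_orbit x = {y. int_poly_val p y = 0}"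
proof (intro equalityI subsetI)
  fix y assume "y \<in> aut_orbit x"
  then obtain \<sigma> where s: "\<sigma> \<in> field_aut" "y = \<sigma> x" by (auto simp: aut_orbit_def)
  have "int_poly_val p y = \<sigma> (int_poly_val p x)"
    unfolding s(2) by (rule field_aut_int_poly_val[OF s(1), symmetric])
  then show "y \<in> {y. int_poly_val p y = 0}" using p(2) field_autD(4)[OF s(1)] by simp
next
  fix y :: 'q assume y: "y \<in> {y. int_poly_val p y = 0}"
  have "\<exists>\<sigma>\<in>field_aut. \<sigma> x = y"
  proof (rule exists_field_aut[OF alg])
    fix r assume "int_poly_val r x = 0"
    then obtain k where "r = p * k" using monic_irreducible_dvd[OF p] by (auto elim: dvdE)
    then show "int_poly_val r y = 0" using y by (simp add: map_poly_of_int_hom)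
  qed
  then show "y \<in> aut_orbit x" by (auto simp: aut_orbit_def)
qed

lemma size_proots_alg_closed: "size (proots (p :: 'q::alg_closed_field poly)) = degree p"
proof (cases "p = 0")
  case False
  obtain A where A: "size A = degree p" "p = smult (lead_coeff p) (\<Prod>x\<in>#A. [:-x, 1:])"
    using alg_closed_imp_factorization[OF False] by blast
  have "proots p = proots (\<Prod>x\<in>#A. [:-x, 1:])"
    by (subst A(2)) (use False in simp)
  also have "\<dots> = A"
  proof (induction A)
    case (add x A)
    have "(\<Prod>x\<in>#A. [:-x, 1:]) \<noteq> (0 :: 'q poly)" by (auto simp: prod_mset_zero_iff)
    then show ?case using add proots_mult[of "[:-x, 1:]" "\<Prod>x\<in>#A. [:-x, 1:]"]
      by (simp del: mult_pCons_left)
  qed simp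
  finally show ?thesis using A(1) by simp
qed simp

lemma card_roots_monic_irreducible:
  assumes p: "monic_irreducible p"
  shows "card {x :: 'q::{alg_closed_field,field_char_0}. int_poly_val p x = 0} = degree p"
proof -
  define P where "P = (map_poly of_int p :: 'q poly)"
  have P0: "P \<noteq> 0" and deg: "degree P = degree p"
    using p by (auto simp: P_def monic_irreducible_def degree_map_poly)
  have "rsquarefree P"
    unfolding rsquarefree_roots
  proof (intro allI notI)
    fix a :: 'q assume a: "poly P a = 0 \<and> poly (pderiv P) a = 0"
    have "pderiv P = map_poly of_int (pderiv p)"
      by (rule poly_eqI) (simp add: P_def coeff_pderiv coeff_map_poly)
    then have "int_poly_val (pderiv p) a = 0" using a by simp
    moreover have "int_poly_val p a = 0" using a by (simp add: P_def)
    ultimately have "p dvd pderiv p" using monic_irreducible_dvd[OF p] by blast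
    moreover have "pderiv p \<noteq> 0" using p by (auto simp: pderiv_eq_0_iff monic_irreducible_def)
    ultimately have "degree p \<le> degree (pderiv p)" by (rule dvd_imp_degree_le)
    moreover have "degree p > 0" using p by (simp add: monic_irreducible_def)
    ultimately show False by (simp add: degree_pderiv)
  qed
  then have ord: "order x P = 1" if "poly P x = 0" for x
    using that P0 by (metis order_root rsquarefree_def)
  have "degree P = size (proots P)" by (simp add: size_proots_alg_closed)
  also have "\<dots> = (\<Sum>x\<in>set_mset (proots P). count (proots P) x)" by (rule size_multiset_overloaded_eq)
  also have "\<dots> = (\<Sum>x\<in>{x. poly P x = 0}. 1)"
    using P0 ord by (intro sum.cong) auto
  finally show ?thesis using deg by (simp add: P_def)
qed

text \<open>A polynomial with as many roots as its degree has this property for each of its factors, since no factor can have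
more roots than its degree.\<close>

lemma card_roots_of_factor:
  fixes f g :: "'q::field poly"
  assumes "card {x. poly (f * g) x = 0} = degree (f * g)" "f * g \<noteq> 0"
  shows "card {x. poly f x = 0} = degree f"
proof -
  have fg: "f \<noteq> 0" "g \<noteq> 0" using assms(2) by auto
  have "degree f + degree g = card {x. poly (f * g) x = 0}" using assms(1) fg by (simp add: degree_mult_eq)
  also have "{x. poly (f * g) x = 0} = {x. poly f x = 0} \<union> {x. poly g x = 0}" by auto
  also have "card \<dots> \<le> card {x. poly f x = 0} + card {x. poly g x = 0}" by (rule card_Un_le)
  finally show ?thesis using card_poly_roots_bound[OF fg(1)] card_poly_roots_bound[OF fg(2)] by linarith
qed

text \<open>The roots of a factor of \<open>q\<close> over the field generated by \<open>\<alpha>\<close> form a set that is stable under the stabilizer of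
\<open>\<alpha>\<close>, and its size is the degree of the factor. A prime cannot divide two coprime degrees, so two such factors
serve all primes at once.\<close>

theorem sylow_conjugate_roots:
  fixes \<alpha> \<beta> :: "'q::{alg_closed_field,field_char_0}"
  assumes alg: "\<And>x::'q. algebraic x"
    and p: "monic_irreducible p" "int_poly_val p \<alpha> = 0"
    and q: "monic_irreducible q" "int_poly_val q \<beta> = 0"
    and deg: "degree p = degree q"
    and f: "f dvd map_poly of_int q" "\<And>\<sigma>. \<sigma> \<in> field_aut \<Longrightarrow> \<sigma> \<alpha> = \<alpha> \<Longrightarrow> map_poly \<sigma> f = f"
    and g: "g dvd map_poly of_int q" "\<And>\<sigma>. \<sigma> \<in> field_aut \<Longrightarrow> \<sigma> \<alpha> = \<alpha> \<Longrightarrow> map_poly \<sigma> g = g"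
    and cop: "coprime (degree f) (degree g)"
  shows "sylow_conjugate (rat_adjoin \<alpha>) (rat_adjoin \<beta>)"
proof (rule sylow_conjugateI[OF alg])
  have orb: "aut_orbit \<alpha> = {y. int_poly_val p y = 0}" "aut_orbit \<beta> = {y. int_poly_val q y = 0}"
    using aut_orbit_root[OF alg] p q by blast+
  then show "card (aut_orbit \<alpha>) = card (aut_orbit \<beta>)"
    using card_roots_monic_irreducible[where ?'q = 'q] p(1) q(1) deg by simp
  have q0: "map_poly of_int q \<noteq> (0 :: 'q poly)" using q(1) by (auto simp: monic_irreducible_def)
  have dq: "degree (map_poly of_int q :: 'q poly) = degree q" using q(1) by (simp add: degree_map_poly)
  have factor: "\<exists>T\<subseteq>aut_orbit \<beta>. (\<forall>\<sigma>\<in>field_aut. \<sigma> \<alpha> = \<alpha> \<longrightarrow> (\<forall>t\<in>T. \<sigma> t \<in> T)) \<and> \<not> l dvd card T"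
    if e: "e dvd map_poly of_int q" "\<And>\<sigma>. \<sigma> \<in> field_aut \<Longrightarrow> \<sigma> \<alpha> = \<alpha> \<Longrightarrow> map_poly \<sigma> e = e"
      and l: "\<not> l dvd degree e" for e :: "'q poly" and l
  proof (intro exI[of _ "{x. poly e x = 0}"] conjI ballI impI)
    obtain k where k: "map_poly of_int q = e * k" using e(1) by (rule dvdE)
    show "{x. poly e x = 0} \<subseteq> aut_orbit \<beta>" unfolding orb k by auto
    have "card {x. poly e x = 0} = degree e"
    proof (rule card_roots_of_factor)
      show "card {x. poly (e * k) x = 0} = degree (e * k)"
        using card_roots_monic_irreducible[OF q(1), where ?'q = 'q] unfolding dq[symmetric] k .
      show "e * k \<noteq> 0" using q0 unfolding k .
    qed
    then show "\<not> l dvd card {x. poly e x = 0}" using l by simp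
    fix \<sigma> t assume "\<sigma> \<in> field_aut" "\<sigma> \<alpha> = \<alpha>" "t \<in> {x. poly e x = 0}"
    then show "\<sigma> t \<in> {x. poly e x = 0}"
      using field_aut_poly[of \<sigma> e t] e(2)[of \<sigma>] by (simp add: field_autD)
  qed
  fix l :: nat assume l: "Factorial_Ring.prime l"
  then have "\<not> l dvd degree f \<or> \<not> l dvd degree g"
    using cop by (metis coprime_common_divisor not_prime_unit)
  then show "\<exists>T\<subseteq>aut_orbit \<beta>. (\<forall>\<sigma>\<in>field_aut. \<sigma> \<alpha> = \<alpha> \<longrightarrow> (\<forall>t\<in>T. \<sigma> t \<in> T)) \<and> \<not> l dvd card T"
    using factor[OF f] factor[OF g] by blast
qed

section \<open>Roots in a field generated by one element\<close>

lemma poly_taylor2: "(y - x)\<^sup>2 dvd poly p y - poly p x - (y - x) * poly (pderiv p) x" for x y :: int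
proof (induction p)
  case (pCons a p)
  have "poly (pCons a p) y - poly (pCons a p) x - (y - x) * poly (pderiv (pCons a p)) x
    = y * (poly p y - poly p x - (y - x) * poly (pderiv p) x) + (y - x)\<^sup>2 * poly (pderiv p) x"
    by (simp add: pderiv_pCons algebra_simps power2_eq_square)
  then show ?case using pCons.IH by simp
qed simp

lemma poly_cong_int: "[x = y] (mod m) \<Longrightarrow> [poly p x = poly p y] (mod m)" for x y m :: int
  by (induction p) (auto intro: cong_add cong_mult)

text \<open>A simple root modulo a prime lifts to a root modulo any power of it, which amounts to a homomorphism from the
integers adjoined a root of \<open>p\<close> to the residues modulo that power.\<close>

lemma hensel_lift:
  fixes l a :: int
  assumes l: "Factorial_Ring.prime l" and a: "l dvd poly p a" "\<not> l dvd poly (pderiv p) a"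
  shows "\<exists>A. [A = a] (mod l) \<and> l ^ Suc k dvd poly p A"
proof (induction k)
  case 0 then show ?case using a(1) by (intro exI[of _ a]) simp
next
  case (Suc k)
  then obtain A where A': "[A = a] (mod l)" "l ^ Suc k dvd poly p A" by blast
  then obtain c where "poly p A = l ^ Suc k * c" by (auto simp only: dvd_def)
  with A'(1) have A: "[A = a] (mod l)" "poly p A = l ^ Suc k * c" .
  have "\<not> l dvd poly (pderiv p) A"
    using cong_dvd_iff[OF poly_cong_int[OF A(1)]] cong_dvd_iff a(2) poly_cong_int[OF A(1), of "pderiv p"]
    by (metis cong_0_iff cong_sym cong_trans)
  then have "coprime (poly (pderiv p) A) l" using prime_imp_coprime[OF l] by (subst coprime_commute)
  then obtain d where d: "[poly (pderiv p) A * d = 1] (mod l)" using cong_solve_coprime_int by blast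
  define B where "B = A - l ^ Suc k * (c * d)"
  have "[B = A] (mod l)" by (simp add: B_def cong_iff_dvd_diff)
  moreover have "l ^ Suc (Suc k) dvd poly p B"
  proof -
    have "l ^ Suc (Suc k) dvd (B - A)\<^sup>2"
    proof -
      have "(B - A)\<^sup>2 = l ^ Suc (Suc k) * (l ^ k * (c * d)\<^sup>2)"
        by (simp add: B_def power2_eq_square power_add algebra_simps)
      then show ?thesis by simp
    qed
    then have 1: "l ^ Suc (Suc k) dvd poly p B - poly p A - (B - A) * poly (pderiv p) A"
      using poly_taylor2 dvd_trans by blast
    have "poly p A + (B - A) * poly (pderiv p) A = l ^ Suc k * (c * (1 - poly (pderiv p) A * d))"
      by (simp add: A(2) B_def algebra_simps)
    moreover have "l dvd 1 - poly (pderiv p) A * d"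
      using d by (simp add: cong_iff_dvd_diff dvd_diff_commute)
    then have "l ^ Suc k * l dvd l ^ Suc k * (c * (1 - poly (pderiv p) A * d))"
      by (intro mult_dvd_mono dvd_refl dvd_mult)
    ultimately have 2: "l ^ Suc (Suc k) dvd poly p A + (B - A) * poly (pderiv p) A"
      by (simp add: mult.commute)
    have "poly p B = (poly p B - poly p A - (B - A) * poly (pderiv p) A) + (poly p A + (B - A) * poly (pderiv p) A)"
      by simp
    then show ?thesis using dvd_add[OF 1 2] by simp
  qed
  ultimately show ?case using A(1) cong_trans by blast
qed

text \<open>The sum is \<open>h (N / D)\<close> with cleared denominators. If \<open>l\<close> divides \<open>D\<close>, then it also divides \<open>N\<close> since \<open>h\<close> is monic,
and one may cancel; this uses up \<open>degree h\<close> factors \<open>l\<close> and makes \<open>D\<close> smaller, so that the exponent assumed here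
suffices to reach a denominator that is invertible modulo \<open>l\<close>.\<close>

lemma integral_root_mod_prime:
  fixes h :: "int poly" and l :: int
  assumes l: "Factorial_Ring.prime l" and h: "lead_coeff h = 1" and D: "D \<noteq> 0"
    and dvd: "l ^ (degree h * nat \<bar>D\<bar> + 1) dvd (\<Sum>i\<le>degree h. coeff h i * N ^ i * D ^ (degree h - i))"
  shows "\<exists>t. l dvd poly h t"
  using D dvd
proof (induction "nat \<bar>D\<bar>" arbitrary: D N rule: less_induct)
  case less
  let ?n = "degree h"
  let ?S = "\<lambda>N D. \<Sum>i\<le>?n. coeff h i * N ^ i * D ^ (?n - i)"
  have l2: "l > 1" using l prime_gt_1_int by blast
  have lS: "l dvd ?S N D" using less.prems(2) by (rule dvd_trans[rotated]) simp
  show ?case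
  proof (cases "l dvd D")
    case False
    then have "coprime D l" using prime_imp_coprime[OF l] by (subst coprime_commute)
    then obtain d where d: "[D * d = 1] (mod l)" using cong_solve_coprime_int by blast
    define t where "t = N * d"
    have "[poly h t * D ^ ?n = ?S N D] (mod l)"
    proof -
      have "[coeff h i * t ^ i * D ^ ?n = coeff h i * N ^ i * D ^ (?n - i)] (mod l)" if "i \<le> ?n" for i
      proof -
        have "D ^ ?n = D ^ i * D ^ (?n - i)" using that by (simp flip: power_add)
        then have "coeff h i * t ^ i * D ^ ?n = (coeff h i * N ^ i * D ^ (?n - i)) * (D * d) ^ i"
          by (simp add: t_def power_mult_distrib mult_ac)
        moreover have "[(coeff h i * N ^ i * D ^ (?n - i)) * (D * d) ^ i = (coeff h i * N ^ i * D ^ (?n - i)) * 1 ^ i] (mod l)"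
          by (intro cong_mult cong_pow d cong_refl)
        ultimately show ?thesis unfolding power_one mult_1_right by (simp only:)
      qed
      then show ?thesis unfolding poly_altdef sum_distrib_right by (intro cong_sum) simp
    qed
    then have "l dvd poly h t * D ^ ?n" using lS cong_dvd_iff by (metis cong_0_iff cong_trans)
    then have "l dvd poly h t" using l False by (meson prime_dvd_mult_iff prime_dvd_power)
    then show ?thesis by blast
  next
    case True
    then obtain D1 where D1: "D = l * D1" by (rule dvdE)
    have D10: "D1 \<noteq> 0" using less.prems(1) D1 by auto
    have "?S N D = N ^ ?n + (\<Sum>i<?n. coeff h i * N ^ i * D ^ (?n - i))"
      unfolding lessThan_Suc_atMost[symmetric] sum.lessThan_Suc using h by simp
    moreover have "l dvd (\<Sum>i<?n. coeff h i * N ^ i * D ^ (?n - i))"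
      by (intro dvd_sum dvd_mult dvd_trans[OF True] dvd_power) auto
    ultimately have "l dvd N ^ ?n" using lS by (simp only: dvd_add_left_iff)
    then have "l dvd N" by (rule prime_dvd_power[OF l])
    then obtain N1 where N1: "N = l * N1" by (rule dvdE)
    have "?S N D = l ^ ?n * ?S N1 D1"
    proof -
      have "coeff h i * N ^ i * D ^ (?n - i) = l ^ ?n * (coeff h i * N1 ^ i * D1 ^ (?n - i))" if "i \<le> ?n" for i
      proof -
        have "l ^ ?n = l ^ i * l ^ (?n - i)" using that by (simp flip: power_add)
        then show ?thesis by (simp add: N1 D1 power_mult_distrib mult_ac)
      qed
      then show ?thesis unfolding sum_distrib_left by (intro sum.cong) auto
    qed
    moreover have "?n + (?n * nat \<bar>D1\<bar> + 1) \<le> ?n * nat \<bar>D\<bar> + 1"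
    proof -
      have "2 * \<bar>D1\<bar> \<le> l * \<bar>D1\<bar>" using l2 by (intro mult_right_mono) auto
      moreover have "1 \<le> \<bar>D1\<bar>" using D10 by linarith
      ultimately have "\<bar>D1\<bar> + 1 \<le> \<bar>D\<bar>" using l2 by (simp add: D1 abs_mult)
      then have "nat \<bar>D1\<bar> + 1 \<le> nat \<bar>D\<bar>" by linarith
      then have "?n * (nat \<bar>D1\<bar> + 1) \<le> ?n * nat \<bar>D\<bar>" by (rule mult_le_mono2)
      then show ?thesis by simp
    qed
    ultimately have "l ^ (?n + (?n * nat \<bar>D1\<bar> + 1)) dvd l ^ ?n * ?S N1 D1"
      using less.prems(2) by (metis dvd_trans le_imp_power_dvd)
    then have "l ^ (?n * nat \<bar>D1\<bar> + 1) dvd ?S N1 D1"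
      using l2 by (simp add: power_add)
    moreover have "nat \<bar>D1\<bar> < nat \<bar>D\<bar>" using l2 D10 by (simp add: D1 abs_mult)
    ultimately show ?thesis using less.hyps D10 by blast
  qed
qed

lemma rat_adjoin_fraction:
  fixes a :: "'q::field_char_0"
  assumes alg: "\<And>x::'q. algebraic x" and g: "\<gamma> \<in> rat_adjoin a"
  shows "\<exists>r D. D \<noteq> 0 \<and> of_int D * \<gamma> = int_poly_val r a"
proof -
  define E where "E = {x. \<exists>r D. D \<noteq> 0 \<and> of_int D * x = int_poly_val r a}"
  have E: "x \<in> E" if "D \<noteq> 0" "of_int D * x = int_poly_val r a" for x D r
    using that by (auto simp: E_def)
  have add: "x + y \<in> E" and mult: "x * y \<in> E" if xy: "x \<in> E" "y \<in> E" for x y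
  proof -
    obtain r D s F where *: "D \<noteq> 0" "of_int D * x = int_poly_val r a" "F \<noteq> 0" "of_int F * y = int_poly_val s a"
      using xy unfolding E_def by blast
    have "of_int (D * F) * (x + y) = of_int F * (of_int D * x) + of_int D * (of_int F * y)" by (simp add: algebra_simps)
    then show "x + y \<in> E" unfolding * using *(1,3)
      by (intro E[of "D * F" _ "smult F r + smult D s"]) (simp_all add: map_poly_of_int_hom)
    have "of_int (D * F) * (x * y) = (of_int D * x) * (of_int F * y)" by (simp add: algebra_simps)
    then show "x * y \<in> E" unfolding * using *(1,3)
      by (intro E[of "D * F" _ "r * s"]) (simp_all add: map_poly_of_int_hom)
  qed
  have int: "of_int k \<in> E" for k by (rule E[of 1 _ "[:k:]"]) (simp_all add: map_poly_pCons)
  have neg: "- x \<in> E" if "x \<in> E" for x using mult[OF int[of "-1"] that] by simp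
  have inv_int: "inverse (of_int k) \<in> E" if "k \<noteq> 0" for k
    by (rule E[of k _ "1"]) (use that in simp_all)
  have "subfield E type_ring"
  proof (rule subfield_type_ringI)
    show "1 \<in> E" using int[of 1] by simp
    fix x assume x: "x \<in> E" "x \<noteq> 0"
    obtain p where p: "coeff p 0 \<noteq> 0" "int_poly_val p x = 0"
      by (rule algebraicE'_nonzero[OF alg[of x] x(2)])
    have Epoly: "int_poly_val s x \<in> E" for s
      using int[of 0] by (induction s) (auto simp: map_poly_pCons intro: add mult int x)
    obtain c s where cs: "p = pCons c s" by (cases p)
    have c0: "c \<noteq> 0" using p(1) cs by simp
    have "of_int c + x * int_poly_val s x = 0" using p(2) by (simp add: cs map_poly_pCons)
    then have "x * int_poly_val s x = - of_int c" by (simp add: add_eq_0_iff)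
    moreover have "x * ((- inverse (of_int c)) * int_poly_val s x) = - inverse (of_int c) * (x * int_poly_val s x)"
      by (rule mult.left_commute)
    ultimately have "x * ((- inverse (of_int c)) * int_poly_val s x) = 1" using c0 by simp
    then have "inverse x = (- inverse (of_int c)) * int_poly_val s x" by (rule inverse_unique)
    then show "inverse x \<in> E" using mult[OF neg[OF inv_int[OF c0]] Epoly[of s]] by simp
  qed (use add mult neg in auto)
  moreover have "a \<in> E" by (rule E[of 1 _ "[:0, 1:]"]) (simp_all add: map_poly_pCons)
  ultimately have "\<gamma> \<in> E" using rat_adjoin_least[of E a] g by blast
  then show ?thesis by (simp add: E_def)
qed

text \<open>Write \<open>\<gamma> = r(\<alpha>) / D\<close>. If \<open>\<gamma>\<close> were a root of \<open>G\<close>, then the homogenized polynomial \<open>F\<close> would vanish at \<open>\<alpha>\<close>, hence be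
divisible by \<open>p\<close>. Reducing at the place \<open>\<alpha> \<mapsto> a\<close> would give a root modulo \<open>l\<close>. The denominator \<open>D\<close> may be divisible
by \<open>l\<close>, and for this reason the place has to be considered modulo high powers of \<open>l\<close>. A monic polynomial in an
unknown over the polynomial ring in \<open>\<alpha>\<close> is represented by \<open>G\<close>.\<close>

theorem no_root_by_place:
  fixes \<alpha> :: "'q::field_char_0" and G :: "int poly poly" and l a :: int
  assumes alg: "\<And>x::'q. algebraic x"
    and p: "monic_irreducible p" "int_poly_val p \<alpha> = 0"
    and l: "Factorial_Ring.prime l" and a: "l dvd poly p a" "\<not> l dvd poly (pderiv p) a"
    and G: "lead_coeff G = 1"
    and none: "\<And>t. \<not> l dvd poly (map_poly (\<lambda>g. poly g a) G) t"
    and \<gamma>: "\<gamma> \<in> rat_adjoin \<alpha>"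
  shows "poly (map_poly (\<lambda>g. int_poly_val g \<alpha>) G) \<gamma> \<noteq> 0"
proof
  assume root: "poly (map_poly (\<lambda>g. int_poly_val g \<alpha>) G) \<gamma> = 0"
  let ?n = "degree G"
  obtain r D where rD: "D \<noteq> 0" "of_int D * \<gamma> = int_poly_val r \<alpha>"
    using rat_adjoin_fraction[OF alg \<gamma>] by blast
  define F where "F = (\<Sum>i\<le>?n. coeff G i * r ^ i * [:D:] ^ (?n - i))"
  have ev_pow: "int_poly_val (s ^ i) \<alpha> = int_poly_val s \<alpha> ^ i" for s i
    by (induction i) (simp_all add: map_poly_of_int_hom)
  have ev_sum: "int_poly_val (sum s A) \<alpha> = (\<Sum>i\<in>A. int_poly_val (s i) \<alpha>)" for s and A :: "nat set"
    by (induction A rule: infinite_finite_induct) (simp_all add: map_poly_of_int_hom)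
  have degG: "degree (map_poly (\<lambda>g. int_poly_val g \<alpha>) G) = ?n"
    using G by (intro map_poly_degree_eq) simp
  have "int_poly_val F \<alpha> = (\<Sum>i\<le>?n. of_int D ^ ?n * (int_poly_val (coeff G i) \<alpha> * \<gamma> ^ i))"
    unfolding F_def ev_sum
  proof (rule sum.cong[OF refl])
    fix i assume "i \<in> {..?n}"
    then have "(of_int D :: 'q) ^ ?n = of_int D ^ i * of_int D ^ (?n - i)" by (simp flip: power_add)
    then show "int_poly_val (coeff G i * r ^ i * [:D:] ^ (?n - i)) \<alpha> = of_int D ^ ?n * (int_poly_val (coeff G i) \<alpha> * \<gamma> ^ i)"
      by (simp add: map_poly_of_int_hom ev_pow map_poly_pCons rD(2)[symmetric] power_mult_distrib mult_ac)
  qed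
  also have "\<dots> = of_int D ^ ?n * poly (map_poly (\<lambda>g. int_poly_val g \<alpha>) G) \<gamma>"
    by (simp add: poly_altdef[of "map_poly _ G"] degG coeff_map_poly sum_distrib_left)
  finally have "int_poly_val F \<alpha> = 0" using root by simp
  then have pF: "p dvd F" using monic_irreducible_dvd[OF p] by blast
  define k where "k = ?n * nat \<bar>D\<bar>"
  obtain A where A: "[A = a] (mod l)" "l ^ Suc k dvd poly p A" using hensel_lift[OF l a] by blast
  have "l ^ (k + 1) dvd poly F A" using A(2) pF by (auto elim!: dvdE[of p F] simp: dvd_mult2)
  define h where "h = map_poly (\<lambda>g. poly g A) G"
  have degh: "degree h = ?n" unfolding h_def using G by (intro map_poly_degree_eq) simp
  have lch: "lead_coeff h = 1" using G unfolding degh by (simp add: h_def coeff_map_poly)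
  have "poly F A = (\<Sum>i\<le>degree h. coeff h i * poly r A ^ i * D ^ (degree h - i))"
    unfolding degh by (simp add: F_def poly_sum h_def coeff_map_poly poly_power)
  then obtain t where t: "l dvd poly h t"
    using integral_root_mod_prime[OF l lch rD(1)] \<open>l ^ (k + 1) dvd poly F A\<close> unfolding k_def degh by metis
  define h' where "h' = map_poly (\<lambda>g. poly g a) G"
  have degh': "degree h' = ?n" unfolding h'_def using G by (intro map_poly_degree_eq) simp
  have "[poly h t = poly h' t] (mod l)"
    unfolding poly_altdef[of h] poly_altdef[of h'] degh degh'
    by (intro cong_sum cong_mult cong_refl) (simp add: h_def h'_def coeff_map_poly poly_cong_int[OF A(1)])
  then show False using t none[of t] unfolding h'_def by (metis cong_0_iff cong_sym cong_trans)
qed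

lemma isomorphic_imp_root:
  fixes \<alpha> \<beta> :: "'q::field_char_0"
  assumes iso: "subfields_isomorphic (rat_adjoin \<alpha>) (rat_adjoin \<beta>)" and q: "int_poly_val q \<beta> = 0"
  shows "\<exists>\<gamma>\<in>rat_adjoin \<alpha>. int_poly_val q \<gamma> = 0"
proof -
  let ?K = "rat_adjoin \<alpha>" and ?L = "rat_adjoin \<beta>"
  obtain h where h: "h \<in> ring_iso (type_ring\<lparr>carrier := ?K\<rparr>) (type_ring\<lparr>carrier := ?L\<rparr>)"
    using iso by (auto simp: subfields_isomorphic_def is_ring_iso_def)
  have add: "\<And>x y. x \<in> ?K \<Longrightarrow> y \<in> ?K \<Longrightarrow> h (x + y) = h x + h y"
    and mult: "\<And>x y. x \<in> ?K \<Longrightarrow> y \<in> ?K \<Longrightarrow> h (x * y) = h x * h y"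
    and one: "h 1 = 1" and bij: "bij_betw h ?K ?L"
    using h by (auto simp: ring_iso_def ring_hom_def)
  note K = subfield_type_ringD[OF subfield_rat_adjoin[of \<alpha>]]
  obtain \<gamma> where \<gamma>: "\<gamma> \<in> ?K" "h \<gamma> = \<beta>"
    using rat_adjoin_mem[of \<beta>] bij_betw_imp_surj_on[OF bij] by (metis imageE)
  have zero: "h 0 = 0" using add[OF K(1) K(1)] by (metis add_cancel_right_right add_0)
  have neg1: "h (-1) = -1" using add[OF K(2) K(3)[OF K(2)]] one zero by (simp add: eq_neg_iff_add_eq_0 add.commute)
  have Kint: "of_int k \<in> ?K" for k using K(7) by (meson Rats_of_int subsetD)
  have int: "h (of_int k) = of_int k" for k
  proof (induction k rule: int_induct[where k = 0])
    case (step1 i) then show ?case using add[OF Kint[of i] K(2)] one by simp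
  next
    case (step2 i) then show ?case using add[OF Kint[of i] K(3)[OF K(2)]] neg1 by simp
  qed (simp add: zero)
  have poly: "int_poly_val s \<gamma> \<in> ?K \<and> h (int_poly_val s \<gamma>) = int_poly_val s \<beta>" for s
  proof (induction s)
    case (pCons c s)
    then show ?case
      using add[OF Kint[of c] K(4)[OF \<gamma>(1)]] mult[OF \<gamma>(1)] \<gamma> int K(4,5) Kint
      by (simp add: map_poly_pCons)
  qed (simp add: zero K(1))
  have "h (int_poly_val q \<gamma>) = h 0" using poly[of q] q zero by simp
  then have "int_poly_val q \<gamma> = 0" using bij poly[of q] K(1) by (meson bij_betw_def inj_onD)
  then show ?thesis using \<gamma>(1) by blast
qed

section \<open>An irreducibility test\<close>

text \<open>For \<open>s = x^d + c_(d-1) x^(d-1) + ... + c_0\<close>, given by the list of its lower coefficients, and the coefficients of a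
polynomial in ascending order, Horner's scheme computes the remainder modulo \<open>s\<close> with coefficients reduced
modulo \<open>l\<close>. One step sends the remainder \<open>r\<close> to that of \<open>x r + a\<close>.\<close>

fun monic_remainder_step :: "int \<Rightarrow> int list \<Rightarrow> int \<Rightarrow> int list \<Rightarrow> int list" where
  "monic_remainder_step l cs a r = map2 (\<lambda>u c. (u - last r * c) mod l) (a # butlast r) cs"

definition monic_remainder_mod :: "int \<Rightarrow> int list \<Rightarrow> int list \<Rightarrow> int list" where
  "monic_remainder_mod l cs ps = foldr (monic_remainder_step l cs) ps (replicate (length cs) 0)"

definition no_monic_factor_mod :: "int \<Rightarrow> nat \<Rightarrow> int list \<Rightarrow> bool" where
  "no_monic_factor_mod l d ps \<longleftrightarrow>
    list_all (\<lambda>cs. monic_remainder_mod l cs ps \<noteq> replicate d 0) (List.n_lists d [0..l - 1])"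

lemma length_monic_remainder_mod: "cs \<noteq> [] \<Longrightarrow> length (monic_remainder_mod l cs ps) = length cs"
  by (induction ps) (auto simp: monic_remainder_mod_def)

lemma monic_remainder_mod_range: "l > 0 \<Longrightarrow> cs \<noteq> [] \<Longrightarrow> x \<in> set (monic_remainder_mod l cs ps) \<Longrightarrow> 0 \<le> x \<and> x < l"
proof (cases ps)
  case (Cons a ps')
  assume "l > 0" "x \<in> set (monic_remainder_mod l cs ps)"
  then obtain y where "x = y mod l" by (auto simp: Cons monic_remainder_mod_def)
  then show ?thesis using \<open>l > 0\<close> by simp
qed (auto simp: monic_remainder_mod_def)

lemma monic_remainder_mod_correct:
  assumes "cs \<noteq> []"
  shows "\<exists>u v. Poly ps = (Poly cs + monom 1 (length cs)) * u + smult l v + Poly (monic_remainder_mod l cs ps)"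
proof (induction ps)
  case Nil
  have "Poly (replicate (length cs) (0::int)) = 0" by (rule poly_eqI) (simp add: nth_default_def)
  then show ?case by (intro exI[of _ 0]) (simp add: monic_remainder_mod_def)
next
  case (Cons a ps)
  let ?d = "length cs" and ?s = "Poly cs + monom 1 (length cs)"
  define r where "r = monic_remainder_mod l cs ps"
  have lr: "length r = ?d" using length_monic_remainder_mod[OF assms] by (simp add: r_def)
  obtain u v where uv: "Poly ps = ?s * u + smult l v + Poly r" using Cons.IH by (auto simp: r_def)
  define h where "h = last r"
  have rne: "r \<noteq> []" using lr assms by auto
  have r': "monic_remainder_mod l cs (a # ps) = map2 (\<lambda>u c. (u - h * c) mod l) (a # butlast r) cs"
    by (simp add: monic_remainder_mod_def r_def h_def)
  define w where "w = Poly (map2 (\<lambda>u c. (u - h * c) div l) (a # butlast r) cs)"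
  have shift: "pCons a (Poly r) = Poly (a # butlast r) + monom h ?d"
  proof -
    have "pCons a (Poly r) = Poly ((a # butlast r) @ [h])" using rne by (simp add: h_def)
    also have "\<dots> = Poly (a # butlast r) + monom h ?d" using lr assms by (subst Poly_snoc) simp
    finally show ?thesis .
  qed
  have red: "Poly (a # butlast r) - smult h (Poly cs) = Poly (monic_remainder_mod l cs (a # ps)) + smult l w"
  proof (rule poly_eqI)
    fix i
    have len: "length (butlast r) = ?d - 1" using lr by simp
    show "coeff (Poly (a # butlast r) - smult h (Poly cs)) i = coeff (Poly (monic_remainder_mod l cs (a # ps)) + smult l w) i"
      using assms lr by (cases "i < ?d") (auto simp: r' w_def nth_default_def len simp del: Poly.simps)
  qed
  have "Poly (a # ps) = [:0, 1:] * (?s * u + smult l v) + pCons a (Poly r)"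
    by (simp add: uv)
  also have "\<dots> = ?s * ([:0, 1:] * u + [:h:]) + smult l ([:0, 1:] * v) + (Poly (a # butlast r) - smult h (Poly cs))"
    unfolding shift by (simp add: algebra_simps smult_add_right smult_monom)
  also have "\<dots> = ?s * ([:0, 1:] * u + [:h:]) + smult l ([:0, 1:] * v + w) + Poly (monic_remainder_mod l cs (a # ps))"
    unfolding red by (simp add: algebra_simps smult_add_right)
  finally show ?case by blast
qed

text \<open>Uniqueness of the remainder on division by a monic polynomial, modulo \<open>l\<close>.\<close>

lemma dvd_remainder:
  fixes s z y R :: "int poly"
  assumes l: "l > 1" and s: "lead_coeff s = 1" and R: "R = s * z + smult l y" and deg: "\<And>i. i \<ge> degree s \<Longrightarrow> coeff R i = 0"
  shows "l dvd coeff R i"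
proof -
  define z1 where "z1 = map_poly (\<lambda>c. c mod l) z"
  define z2 where "z2 = map_poly (\<lambda>c. c div l) z"
  have z: "z = z1 + smult l z2" by (rule poly_eqI) (simp add: z1_def z2_def coeff_map_poly)
  have R': "R = s * z1 + smult l (s * z2 + y)" unfolding R by (subst z) (simp add: algebra_simps smult_add_right)
  have "z1 = 0"
  proof (rule ccontr)
    assume "z1 \<noteq> 0"
    then have "lead_coeff z1 \<noteq> 0" by simp
    moreover have "lead_coeff z1 = lead_coeff z1 mod l" by (simp add: z1_def coeff_map_poly)
    ultimately have nd: "\<not> l dvd lead_coeff z1" by (metis mod_eq_0_iff_dvd)
    have "coeff (s * z1) (degree s + degree z1) = lead_coeff z1" using s by (simp add: coeff_mult_degree_sum)
    then have "lead_coeff z1 + l * coeff (s * z2 + y) (degree s + degree z1) = 0"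
      using deg[of "degree s + degree z1"] R' by simp
    then have "l dvd lead_coeff z1" by (metis dvd_minus_iff dvd_triv_left eq_neg_iff_add_eq_0)
    then show False using nd by simp
  qed
  then show ?thesis using R' by simp
qed

text \<open>A monic factor of degree \<open>d\<close> would be one of finitely many polynomials modulo \<open>l\<close>. The modulus may depend on \<open>d\<close>,
which allows for smaller moduli.\<close>

theorem monic_irreducibleI:
  assumes ps: "length ps > 1" "last ps = 1"
    and check: "\<And>d. 0 < d \<Longrightarrow> d \<le> (length ps - 1) div 2 \<Longrightarrow> \<exists>l>1. no_monic_factor_mod l d ps"
  shows "monic_irreducible (Poly ps)"
proof -
  have lc: "coeff (Poly ps) (length ps - 1) = 1" using ps by (cases ps rule: rev_cases) (auto simp: nth_default_def nth_append)
  then have deg: "degree (Poly ps) = length ps - 1"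
    by (intro antisym le_degree degree_le) (auto simp: nth_default_def)
  have no: "False" if st: "Poly ps = s * t" "lead_coeff s = 1" "lead_coeff t = 1" "degree s > 0"
      and small: "degree s \<le> (length ps - 1) div 2" for s t
  proof -
    define d where "d = degree s"
    have d0: "d > 0" using st(4) by (simp add: d_def)
    obtain l where l: "l > 1" and check': "no_monic_factor_mod l d ps"
      using check[OF d0] small by (auto simp: d_def)
    define cs where "cs = map (\<lambda>i. coeff s i mod l) [0..<d]"
    define w where "w = Poly (map (\<lambda>i. coeff s i div l) [0..<d])"
    let ?s = "Poly cs + monom 1 (length cs)"
    have cs: "cs \<noteq> []" "length cs = d" using d0 by (auto simp: cs_def)
    have s: "s = ?s + smult l w"
      by (rule poly_eqI) (use st(2) in \<open>auto simp: cs_def w_def nth_default_def d_def coeff_eq_0 not_less le_less\<close>)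
    have degs: "degree ?s = d"
      by (intro antisym degree_le le_degree) (auto simp: cs nth_default_def)
    have lcs: "lead_coeff ?s = 1" unfolding degs by (simp add: cs nth_default_def)
    obtain u v where uv: "Poly ps = ?s * u + smult l v + Poly (monic_remainder_mod l cs ps)"
      using monic_remainder_mod_correct[OF cs(1)] by blast
    let ?r = "monic_remainder_mod l cs ps"
    have lr: "length ?r = d" using length_monic_remainder_mod[OF cs(1)] cs(2) by simp
    have "?s * t + smult l (w * t) = Poly ps" unfolding st(1) by (subst s) (simp add: algebra_simps)
    then have "Poly ?r = ?s * (t - u) + smult l (w * t - v)"
      using uv by (simp add: algebra_simps smult_diff_right)
    then have dvd: "l dvd coeff (Poly ?r) i" for i
      by (rule dvd_remainder[OF l lcs]) (simp add: degs nth_default_def lr)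
    have "?r = replicate d 0"
    proof (rule nth_equalityI)
      show "length ?r = length (replicate d 0)" using lr by simp
      fix i assume i: "i < length ?r"
      have "0 < l" using l by simp
      then have "0 \<le> ?r ! i \<and> ?r ! i < l" using monic_remainder_mod_range[OF _ cs(1) nth_mem[OF i]] by blast
      moreover have "l dvd ?r ! i" using dvd[of i] i by (simp add: nth_default_def)
      ultimately have "?r ! i = 0" using zdvd_not_zless[of "?r ! i" l] by (cases "0 < ?r ! i") auto
      then show "?r ! i = replicate d 0 ! i" using i lr by simp
    qed
    moreover have "set cs \<subseteq> set [0..l - 1]"
    proof
      fix x assume "x \<in> set cs"
      then obtain i where x: "x = coeff s i mod l" unfolding cs_def set_map by blast
      have "0 < l" using l by simp
      then show "x \<in> set [0..l - 1]"
        using pos_mod_sign[of l "coeff s i"] pos_mod_bound[of l "coeff s i"]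
        unfolding set_upto atLeastAtMost_iff x by linarith
    qed
    then have "cs \<in> set (List.n_lists d [0..l - 1])" unfolding set_n_lists using cs(2) by blast
    ultimately show False using check' unfolding no_monic_factor_mod_def list_all_iff by blast
  qed
  show ?thesis
    unfolding monic_irreducible_def
  proof (intro conjI allI impI)
    show "lead_coeff (Poly ps) = 1" using lc deg by simp
    show "degree (Poly ps) > 0" using deg ps(1) by simp
    fix s t assume st: "Poly ps = s * t" "lead_coeff s = 1" "lead_coeff t = 1"
    show "degree s = 0 \<or> degree t = 0"
    proof (rule ccontr)
      assume *: "\<not> (degree s = 0 \<or> degree t = 0)"
      have "degree s + degree t = length ps - 1"
      proof -
        have "s \<noteq> 0" "t \<noteq> 0" using st(2,3) by auto
        then show ?thesis using deg st(1) degree_mult_eq[of s t] by simp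
      qed
      then have "degree s \<le> (length ps - 1) div 2 \<or> degree t \<le> (length ps - 1) div 2" by linarith
      then show False using no[of s t] no[of t s] st * by (auto simp: mult.commute)
    qed
  qed
qed

lemma no_root_modI:
  fixes l t :: int
  assumes "l > 0" "list_all (\<lambda>t. poly h t mod l \<noteq> 0) [0..l - 1]"
  shows "\<not> l dvd poly h t"
proof
  assume "l dvd poly h t"
  then have 1: "poly h t mod l = 0" by (rule mod_eq_0_iff_dvd[THEN iffD2])
  have "[t mod l = t] (mod l)" unfolding cong_def by (rule mod_mod_trivial)
  then have 2: "poly h (t mod l) mod l = 0" using poly_cong_int[of "t mod l" t l h] 1 by (simp only: cong_def)
  have "t mod l \<in> set [0..l - 1]"
    using pos_mod_sign[OF assms(1), of t] pos_mod_bound[OF assms(1), of t] unfolding set_upto atLeastAtMost_iff by linarith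
  then have "poly h (t mod l) mod l \<noteq> 0" by (rule bspec[OF assms(2)[unfolded list_all_iff]])
  then show False using 2 by (rule notE)
qed

section \<open>The four polynomials\<close>

lemma field_aut_numeral: "\<sigma> \<in> field_aut \<Longrightarrow> \<sigma> (numeral n) = numeral n"
  using field_aut_of_int[of \<sigma> "numeral n"] by simp

lemma field_aut_power: "\<sigma> \<in> field_aut \<Longrightarrow> \<sigma> (x ^ n) = \<sigma> x ^ n"
  by (induction n) (simp_all add: field_autD)

lemma field_aut_divide: "\<sigma> \<in> field_aut \<Longrightarrow> \<sigma> (x / y) = \<sigma> x / \<sigma> y"
  by (simp add: divide_inverse field_autD)

lemmas field_aut_simps = field_autD(2-8) field_aut_numeral field_aut_power field_aut_divide

lemma mult_cubic_quartic:
  "[:a0, a1, a2, 1:] * [:b0, b1, b2, b3, 1:] =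
   [:a0 * b0, a0 * b1 + a1 * b0, a0 * b2 + a1 * b1 + a2 * b0, a0 * b3 + a1 * b2 + a2 * b1 + b0,
     a0 + a1 * b3 + a2 * b2 + b1, a1 + a2 * b3 + b2, a2 + b3, (1 :: 'a::comm_ring_1):]"
  by (simp add: algebra_simps)

lemma mult_quadratic_cubic_cubic:
  "[:a0, a1, 1:] * [:b0, b1, b2, 1:] * [:c0, c1, c2, 1:] =
   [:a0 * b0 * c0,
     a0 * b0 * c1 + (a0 * b1 + a1 * b0) * c0,
     a0 * b0 * c2 + (a0 * b1 + a1 * b0) * c1 + (a0 * b2 + a1 * b1 + b0) * c0,
     a0 * b0 + (a0 * b1 + a1 * b0) * c2 + (a0 * b2 + a1 * b1 + b0) * c1 + (a0 + a1 * b2 + b1) * c0,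
     (a0 * b1 + a1 * b0) + (a0 * b2 + a1 * b1 + b0) * c2 + (a0 + a1 * b2 + b1) * c1 + (a1 + b2) * c0,
     (a0 * b2 + a1 * b1 + b0) + (a0 + a1 * b2 + b1) * c2 + (a1 + b2) * c1 + c0,
     (a0 + a1 * b2 + b1) + (a1 + b2) * c2 + c1,
     a1 + b2 + c2, (1 :: 'a::comm_ring_1):]"
  by (simp add: algebra_simps)

definition p7 :: "int poly" where "p7 = Poly [3,-7,0,0,0,0,0,1]"
definition q7 :: "int poly" where "q7 = Poly [9,-21,-42,0,14,0,0,1]"
definition p8 :: "int poly" where "p8 = Poly [1,31,0,-52,2,26,-4,-4,1]"
definition q8 :: "int poly" where "q8 = Poly [-337,-687,1256,342,-402,-108,30,12,1]"

text \<open>Modulo \<open>2\<close>, both \<open>p7\<close> and \<open>q7\<close> are the irreducible polynomial \<open>x^7 + x + 1\<close>, whereas \<open>p8\<close> and \<open>q8\<close> are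
\<open>x^8 + x + 1\<close>, with irreducible factors of degrees \<open>2\<close> and \<open>6\<close>. Modulo \<open>3\<close> the latter two have no quadratic factor.\<close>

lemma monic_irreducible_polys:
  "monic_irreducible p7" "monic_irreducible q7" "monic_irreducible p8" "monic_irreducible q8"
proof -
  have range3: "d \<in> {1, 2, 3}" if "0 < d" "d \<le> 3" for d :: nat using that by auto
  have range4: "d \<in> {1, 3, 4} \<or> d = 2" if "0 < d" "d \<le> 4" for d :: nat using that by auto
  have *: "\<forall>d\<in>{1, 2, 3}. no_monic_factor_mod 2 d [3, -7, 0, 0, 0, 0, 0, 1]" by code_simp
  show "monic_irreducible p7"
    unfolding p7_def
  proof (rule monic_irreducibleI)
    fix d assume "0 < d" "d \<le> (length [3, -7, 0, 0, 0, 0, 0, 1 :: int] - 1) div 2"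
    then have "d \<in> {1, 2, 3}" by (intro range3) simp_all
    then show "\<exists>l>1. no_monic_factor_mod l d [3, -7, 0, 0, 0, 0, 0, 1]"
      using * by (intro exI[of _ 2]) auto
  qed simp_all
  have *: "\<forall>d\<in>{1, 2, 3}. no_monic_factor_mod 2 d [9, -21, -42, 0, 14, 0, 0, 1]" by code_simp
  show "monic_irreducible q7"
    unfolding q7_def
  proof (rule monic_irreducibleI)
    fix d assume "0 < d" "d \<le> (length [9, -21, -42, 0, 14, 0, 0, 1 :: int] - 1) div 2"
    then have "d \<in> {1, 2, 3}" by (intro range3) simp_all
    then show "\<exists>l>1. no_monic_factor_mod l d [9, -21, -42, 0, 14, 0, 0, 1]"
      using * by (intro exI[of _ 2]) auto
  qed simp_all
  have *: "\<forall>d\<in>{1, 3, 4}. no_monic_factor_mod 2 d [1, 31, 0, -52, 2, 26, -4, -4, 1]"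
    "no_monic_factor_mod 3 2 [1, 31, 0, -52, 2, 26, -4, -4, 1]" by code_simp+
  show "monic_irreducible p8"
    unfolding p8_def
  proof (rule monic_irreducibleI)
    fix d assume "0 < d" "d \<le> (length [1, 31, 0, -52, 2, 26, -4, -4, 1 :: int] - 1) div 2"
    then have "d \<in> {1, 3, 4} \<or> d = 2" by (intro range4) simp_all
    then show "\<exists>l>1. no_monic_factor_mod l d [1, 31, 0, -52, 2, 26, -4, -4, 1]"
      using * by (elim disjE) (auto intro: exI[of _ 2] exI[of _ 3])
  qed simp_all
  have *: "\<forall>d\<in>{1, 3, 4}. no_monic_factor_mod 2 d [-337, -687, 1256, 342, -402, -108, 30, 12, 1]"
    "no_monic_factor_mod 3 2 [-337, -687, 1256, 342, -402, -108, 30, 12, 1]" by code_simp+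
  show "monic_irreducible q8"
    unfolding q8_def
  proof (rule monic_irreducibleI)
    fix d assume "0 < d" "d \<le> (length [-337, -687, 1256, 342, -402, -108, 30, 12, 1 :: int] - 1) div 2"
    then have "d \<in> {1, 3, 4} \<or> d = 2" by (intro range4) simp_all
    then show "\<exists>l>1. no_monic_factor_mod l d [-337, -687, 1256, 342, -402, -108, 30, 12, 1]"
      using * by (elim disjE) (auto intro: exI[of _ 2] exI[of _ 3])
  qed simp_all
qed

lemma int_poly_val_polys:
  fixes x :: "'q::field_char_0"
  shows "int_poly_val p7 x = x ^ 7 - 7 * x + 3"
    "int_poly_val q7 x = x ^ 7 + 14 * x ^ 4 - 42 * x ^ 2 - 21 * x + 9"
    "int_poly_val p8 x = x ^ 8 - 4 * x ^ 7 - 4 * x ^ 6 + 26 * x ^ 5 + 2 * x ^ 4 - 52 * x ^ 3 + 31 * x + 1"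
    "int_poly_val q8 x = x ^ 8 + 12 * x ^ 7 + 30 * x ^ 6 - 108 * x ^ 5 - 402 * x ^ 4 + 342 * x ^ 3 + 1256 * x ^ 2
          - 687 * x - 337"
  by (simp_all add: p7_def q7_def p8_def q8_def map_poly_pCons algebra_simps eval_nat_numeral)

context
  fixes \<alpha> :: "'q::field_char_0"
begin

text \<open>The roots of \<open>q7\<close> are the sums of three roots of \<open>p7\<close> along the seven lines of a Fano plane. The cubic factor
belongs to the three lines through \<open>\<alpha>\<close>, the quartic factor to the other four.\<close>

definition q7_cubic :: "'q poly" where
  "q7_cubic = [:\<alpha> + \<alpha>^2 - \<alpha>^3 - \<alpha>^4,
          (-6 - \<alpha> + 7*\<alpha>^2 + 2*\<alpha>^3 + \<alpha>^4 + 2*\<alpha>^5 + \<alpha>^6) / 3, -2*\<alpha>, 1:]"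

definition q7_quartic :: "'q poly" where
  "q7_quartic = [:18 + \<alpha> - 2*\<alpha>^2 - \<alpha>^4 - \<alpha>^5 - 3*\<alpha>^6,
          (54 - 7*\<alpha> + \<alpha>^2 - \<alpha>^3 - 5*\<alpha>^4 - 4*\<alpha>^5 - 8*\<alpha>^6) / 3,
          (6 + \<alpha> + 5*\<alpha>^2 - 2*\<alpha>^3 - \<alpha>^4 - 2*\<alpha>^5 - \<alpha>^6) / 3, 2*\<alpha>, 1:]"

text \<open>The roots of \<open>q8\<close> come in pairs with sum \<open>-3\<close>. The quadratic factor belongs to a pair, and the substitution
of \<open>-3 - x\<close> for \<open>x\<close> interchanges the two cubic factors up to sign.\<close>

definition q8_quadratic :: "'q poly" where
  "q8_quadratic = [:-6 - 77*\<alpha> + 31*\<alpha>^2 + 86*\<alpha>^3 - 28*\<alpha>^4 - 18*\<alpha>^5 + 6*\<alpha>^6, 3, 1:]"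

definition q8_cubic :: "'q poly" where
  "q8_cubic = [:-23 + 111*\<alpha> - 113*\<alpha>^2 - 85*\<alpha>^3 + 136*\<alpha>^4 - 8*\<alpha>^5 - 29*\<alpha>^6 + 7*\<alpha>^7,
          25*\<alpha> - 11*\<alpha>^2 - 43*\<alpha>^3 + 14*\<alpha>^4 + 9*\<alpha>^5 - 3*\<alpha>^6, 6 - 3*\<alpha>, 1:]"

definition q8_cubic' :: "'q poly" where
  "q8_cubic' = [:-4 - 9*\<alpha> + 80*\<alpha>^2 - 44*\<alpha>^3 - 94*\<alpha>^4 + 35*\<alpha>^5 + 20*\<alpha>^6 - 7*\<alpha>^7,
          -9 + 43*\<alpha> - 11*\<alpha>^2 - 43*\<alpha>^3 + 14*\<alpha>^4 + 9*\<alpha>^5 - 3*\<alpha>^6, 3 + 3*\<alpha>, 1:]"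

lemma factorization_q7:
  assumes root: "int_poly_val p7 \<alpha> = 0"
  shows "map_poly of_int q7 = q7_cubic * q7_quartic"
proof -
  \<comment> \<open>polynomial identities without division, modulo \<open>3 k - 1\<close> and the equation of \<open>\<alpha>\<close>\<close>
  define k :: 'q where "k = 1 / 3"
  have k: "3 * k = 1" by (simp add: k_def)
  have r: "\<alpha> ^ 7 - 7 * \<alpha> + 3 = 0" using root by (simp add: int_poly_val_polys)
  have div3: "x / 3 = k * x" for x by (simp add: k_def)
  show ?thesis
    unfolding q7_cubic_def q7_quartic_def mult_cubic_quartic q7_def div3
    apply (simp add: map_poly_pCons del: pCons_eq_iff)
    apply (simp only: pCons_eq_iff)
    apply (intro conjI; (Groebner_Basis.algebra | (use k r in Groebner_Basis.algebra) | simp))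
    done
qed

lemma factorization_q8:
  assumes root: "int_poly_val p8 \<alpha> = 0"
  shows "map_poly of_int q8 = q8_quadratic * q8_cubic * q8_cubic'"
proof -
  have r: "\<alpha> ^ 8 - 4 * \<alpha> ^ 7 - 4 * \<alpha> ^ 6 + 26 * \<alpha> ^ 5 + 2 * \<alpha> ^ 4 - 52 * \<alpha> ^ 3 + 31 * \<alpha> + 1 = 0"
    using root by (simp add: int_poly_val_polys)
  show ?thesis
    unfolding q8_quadratic_def q8_cubic_def q8_cubic'_def mult_quadratic_cubic_cubic q8_def
    apply (simp add: map_poly_pCons del: pCons_eq_iff)
    apply (simp only: pCons_eq_iff)
    apply (intro conjI; (Groebner_Basis.algebra | (use r in Groebner_Basis.algebra) | simp))
    done
qed

lemma factors_fixed:
  assumes "\<sigma> \<in> field_aut" "\<sigma> \<alpha> = \<alpha>"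
  shows "map_poly \<sigma> q7_cubic = q7_cubic" "map_poly \<sigma> q7_quartic = q7_quartic" "map_poly \<sigma> q8_quadratic = q8_quadratic" "map_poly \<sigma> q8_cubic = q8_cubic"
  by (simp_all add: q7_cubic_def q7_quartic_def q8_quadratic_def q8_cubic_def map_poly_pCons field_aut_simps[OF assms(1)] assms(2))

section \<open>Absence of roots\<close>

text \<open>The place for each factor is a simple root \<open>a\<close> of \<open>p7\<close> or \<open>p8\<close> modulo a prime at which the reduced factor has
no root; the prime is the least one that has such an \<open>a\<close>. The factors of \<open>q7\<close> have denominator \<open>3\<close>, so the monic
integral polynomials are those of \<open>3 \<gamma>\<close>.\<close>

lemma no_root_q7_cubic:
  assumes alg: "\<And>x::'q. algebraic x" and root: "int_poly_val p7 \<alpha> = 0" and \<gamma>: "\<gamma> \<in> rat_adjoin \<alpha>"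
  shows "poly q7_cubic \<gamma> \<noteq> 0"
proof -
  let ?G = "[:[:0, 27, 27, -27, -27:], [:-18, -3, 21, 6, 3, 6, 3:], [:0, -6:], 1:] :: int poly poly"
  have eval: "map_poly (\<lambda>g. poly g 7) ?G = [:-72576, 464040, -42, 1:]" by (simp add: map_poly_pCons)
  have "list_all (\<lambda>t. poly [:-72576, 464040, -42, 1:] t mod 17 \<noteq> 0) [0..17 - 1 :: int]" by code_simp
  then have none: "\<not> 17 dvd poly (map_poly (\<lambda>g. poly g 7) ?G) t" for t
    unfolding eval by (intro no_root_modI) simp_all
  have mem: "3 * \<gamma> \<in> rat_adjoin \<alpha>"
    using subfield_type_ringD(4,7)[OF subfield_rat_adjoin[of \<alpha>]] \<gamma> by (meson Rats_number_of subsetD)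
  define k :: 'q where "k = 1 / 3"
  have k: "3 * k = 1" by (simp add: k_def)
  have div3: "x / 3 = k * x" for x by (simp add: k_def)
  have link: "poly (map_poly (\<lambda>g. int_poly_val g \<alpha>) ?G) (3 * \<gamma>) = 27 * poly q7_cubic \<gamma>"
    unfolding q7_cubic_def div3 by (simp add: map_poly_pCons) (use k in Groebner_Basis.algebra)
  have "poly (pderiv p7) 7 mod (17 :: int) \<noteq> 0" "poly p7 7 mod (17 :: int) = 0"
    by (simp_all add: p7_def pderiv_pCons)
  then have "poly (map_poly (\<lambda>g. int_poly_val g \<alpha>) ?G) (3 * \<gamma>) \<noteq> 0"
    by (intro no_root_by_place[OF alg monic_irreducible_polys(1) root, where l = 17 and a = 7] none mem) (simp_all add: dvd_eq_mod_eq_0)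
  then show ?thesis unfolding link by simp
qed

lemma no_root_q7_quartic:
  assumes alg: "\<And>x::'q. algebraic x" and root: "int_poly_val p7 \<alpha> = 0" and \<gamma>: "\<gamma> \<in> rat_adjoin \<alpha>"
  shows "poly q7_quartic \<gamma> \<noteq> 0"
proof -
  let ?G = "[:[:1458, 81, -162, 0, -81, -81, -243:], [:486, -63, 9, -9, -45, -36, -72:], [:18, 3, 15, -6, -3, -6, -3:], [:0, 6:], 1:] :: int poly poly"
  have eval: "map_poly (\<lambda>g. poly g 2) ?G = [:-18468, -6156, -396, 12, 1:]" by (simp add: map_poly_pCons)
  have "list_all (\<lambda>t. poly [:-18468, -6156, -396, 12, 1:] t mod 13 \<noteq> 0) [0..13 - 1 :: int]" by code_simp
  then have none: "\<not> 13 dvd poly (map_poly (\<lambda>g. poly g 2) ?G) t" for t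
    unfolding eval by (intro no_root_modI) simp_all
  have mem: "3 * \<gamma> \<in> rat_adjoin \<alpha>"
    using subfield_type_ringD(4,7)[OF subfield_rat_adjoin[of \<alpha>]] \<gamma> by (meson Rats_number_of subsetD)
  define k :: 'q where "k = 1 / 3"
  have k: "3 * k = 1" by (simp add: k_def)
  have div3: "x / 3 = k * x" for x by (simp add: k_def)
  have link: "poly (map_poly (\<lambda>g. int_poly_val g \<alpha>) ?G) (3 * \<gamma>) = 81 * poly q7_quartic \<gamma>"
    unfolding q7_quartic_def div3 by (simp add: map_poly_pCons) (use k in Groebner_Basis.algebra)
  have "poly (pderiv p7) 2 mod (13 :: int) \<noteq> 0" "poly p7 2 mod (13 :: int) = 0"
    by (simp_all add: p7_def pderiv_pCons)
  then have "poly (map_poly (\<lambda>g. int_poly_val g \<alpha>) ?G) (3 * \<gamma>) \<noteq> 0"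
    by (intro no_root_by_place[OF alg monic_irreducible_polys(1) root, where l = 13 and a = 2] none mem) (simp_all add: dvd_eq_mod_eq_0)
  then show ?thesis unfolding link by simp
qed

lemma no_root_q8_quadratic:
  assumes alg: "\<And>x::'q. algebraic x" and root: "int_poly_val p8 \<alpha> = 0" and \<gamma>: "\<gamma> \<in> rat_adjoin \<alpha>"
  shows "poly q8_quadratic \<gamma> \<noteq> 0"
proof -
  let ?G = "[:[:-6, -77, 31, 86, -28, -18, 6:], [:3:], 1:] :: int poly poly"
  have eval: "map_poly (\<lambda>g. poly g 11) ?G = [:7437864, 3, 1:]" by (simp add: map_poly_pCons)
  have "list_all (\<lambda>t. poly [:7437864, 3, 1:] t mod 23 \<noteq> 0) [0..23 - 1 :: int]" by code_simp
  then have none: "\<not> 23 dvd poly (map_poly (\<lambda>g. poly g 11) ?G) t" for t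
    unfolding eval by (intro no_root_modI) simp_all
  have link: "poly (map_poly (\<lambda>g. int_poly_val g \<alpha>) ?G) \<gamma> = poly q8_quadratic \<gamma>"
    unfolding q8_quadratic_def by (simp add: map_poly_pCons) Groebner_Basis.algebra
  have "poly (pderiv p8) 11 mod (23 :: int) \<noteq> 0" "poly p8 11 mod (23 :: int) = 0"
    by (simp_all add: p8_def pderiv_pCons)
  then have "poly (map_poly (\<lambda>g. int_poly_val g \<alpha>) ?G) \<gamma> \<noteq> 0"
    by (intro no_root_by_place[OF alg monic_irreducible_polys(3) root, where l = 23 and a = 11] none \<gamma>) (simp_all add: dvd_eq_mod_eq_0)
  then show ?thesis unfolding link .
qed

lemma no_root_q8_cubic:
  assumes alg: "\<And>x::'q. algebraic x" and root: "int_poly_val p8 \<alpha> = 0" and \<gamma>: "\<gamma> \<in> rat_adjoin \<alpha>"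
  shows "poly q8_cubic \<gamma> \<noteq> 0"
proof -
  let ?G = "[:[:-23, 111, -113, -85, 136, -8, -29, 7:], [:0, 25, -11, -43, 14, 9, -3:], [:6, -3:], 1:] :: int poly poly"
  have eval: "map_poly (\<lambda>g. poly g 12) ?G = [:164896717, -6503748, -30, 1:]" by (simp add: map_poly_pCons)
  have "list_all (\<lambda>t. poly [:164896717, -6503748, -30, 1:] t mod 31 \<noteq> 0) [0..31 - 1 :: int]" by code_simp
  then have none: "\<not> 31 dvd poly (map_poly (\<lambda>g. poly g 12) ?G) t" for t
    unfolding eval by (intro no_root_modI) simp_all
  have link: "poly (map_poly (\<lambda>g. int_poly_val g \<alpha>) ?G) \<gamma> = poly q8_cubic \<gamma>"
    unfolding q8_cubic_def by (simp add: map_poly_pCons) Groebner_Basis.algebra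
  have "poly (pderiv p8) 12 mod (31 :: int) \<noteq> 0" "poly p8 12 mod (31 :: int) = 0"
    by (simp_all add: p8_def pderiv_pCons)
  then have "poly (map_poly (\<lambda>g. int_poly_val g \<alpha>) ?G) \<gamma> \<noteq> 0"
    by (intro no_root_by_place[OF alg monic_irreducible_polys(3) root, where l = 31 and a = 12] none \<gamma>) (simp_all add: dvd_eq_mod_eq_0)
  then show ?thesis unfolding link .
qed

lemma no_root_q8_cubic':
  assumes alg: "\<And>x::'q. algebraic x" and root: "int_poly_val p8 \<alpha> = 0" and \<gamma>: "\<gamma> \<in> rat_adjoin \<alpha>"
  shows "poly q8_cubic' \<gamma> \<noteq> 0"
proof -
  let ?G = "[:[:-4, -9, 80, -44, -94, 35, 20, -7:], [:-9, 43, -11, -43, 14, 9, -3:], [:3, 3:], 1:] :: int poly poly"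
  have eval: "map_poly (\<lambda>g. poly g 12) ?G = [:-184407664, -6503541, 39, 1:]" by (simp add: map_poly_pCons)
  have "list_all (\<lambda>t. poly [:-184407664, -6503541, 39, 1:] t mod 31 \<noteq> 0) [0..31 - 1 :: int]" by code_simp
  then have none: "\<not> 31 dvd poly (map_poly (\<lambda>g. poly g 12) ?G) t" for t
    unfolding eval by (intro no_root_modI) simp_all
  have link: "poly (map_poly (\<lambda>g. int_poly_val g \<alpha>) ?G) \<gamma> = poly q8_cubic' \<gamma>"
    unfolding q8_cubic'_def by (simp add: map_poly_pCons) Groebner_Basis.algebra
  have "poly (pderiv p8) 12 mod (31 :: int) \<noteq> 0" "poly p8 12 mod (31 :: int) = 0"
    by (simp_all add: p8_def pderiv_pCons)
  then have "poly (map_poly (\<lambda>g. int_poly_val g \<alpha>) ?G) \<gamma> \<noteq> 0"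
    by (intro no_root_by_place[OF alg monic_irreducible_polys(3) root, where l = 31 and a = 12] none \<gamma>) (simp_all add: dvd_eq_mod_eq_0)
  then show ?thesis unfolding link .
qed

end

section \<open>The two pairs of fields\<close>

lemma not_isomorphicI:
  fixes \<alpha> \<beta> :: "'q::field_char_0"
  assumes "int_poly_val q \<beta> = 0" "\<And>\<gamma>. \<gamma> \<in> rat_adjoin \<alpha> \<Longrightarrow> int_poly_val q \<gamma> \<noteq> 0"
  shows "\<not> subfields_isomorphic (rat_adjoin \<alpha>) (rat_adjoin \<beta>)"
  using isomorphic_imp_root[of \<alpha> \<beta> q] assms by blast

lemma fields_a:
  fixes \<alpha> \<beta> :: "'q :: {alg_closed_field, field_char_0}"
  assumes alg: "\<And>x::'q. algebraic x" and roots: "int_poly_val p7 \<alpha> = 0" "int_poly_val q7 \<beta> = 0"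
  shows "sylow_conjugate (rat_adjoin \<alpha>) (rat_adjoin \<beta>)" "\<not> subfields_isomorphic (rat_adjoin \<alpha>) (rat_adjoin \<beta>)"
proof -
  note fac = factorization_q7[OF roots(1)]
  show "sylow_conjugate (rat_adjoin \<alpha>) (rat_adjoin \<beta>)"
  proof (rule sylow_conjugate_roots[OF alg monic_irreducible_polys(1) roots(1) monic_irreducible_polys(2) roots(2)])
    show "degree p7 = degree q7" by (simp add: p7_def q7_def)
    show "q7_cubic \<alpha> dvd map_poly of_int q7" "q7_quartic \<alpha> dvd map_poly of_int q7" unfolding fac by simp_all
    show "coprime (degree (q7_cubic \<alpha>)) (degree (q7_quartic \<alpha>))" by (simp add: q7_cubic_def q7_quartic_def)
  qed (rule factors_fixed; assumption)+
  show "\<not> subfields_isomorphic (rat_adjoin \<alpha>) (rat_adjoin \<beta>)"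
    by (rule not_isomorphicI[OF roots(2)]) (simp add: fac no_root_q7_cubic[OF alg roots(1)] no_root_q7_quartic[OF alg roots(1)])
qed

lemma fields_b:
  fixes \<alpha> \<beta> :: "'q :: {alg_closed_field, field_char_0}"
  assumes alg: "\<And>x::'q. algebraic x" and roots: "int_poly_val p8 \<alpha> = 0" "int_poly_val q8 \<beta> = 0"
  shows "sylow_conjugate (rat_adjoin \<alpha>) (rat_adjoin \<beta>)" "\<not> subfields_isomorphic (rat_adjoin \<alpha>) (rat_adjoin \<beta>)"
proof -
  note fac = factorization_q8[OF roots(1)]
  show "sylow_conjugate (rat_adjoin \<alpha>) (rat_adjoin \<beta>)"
  proof (rule sylow_conjugate_roots[OF alg monic_irreducible_polys(3) roots(1) monic_irreducible_polys(4) roots(2)])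
    show "degree p8 = degree q8" by (simp add: p8_def q8_def)
    show "q8_quadratic \<alpha> dvd map_poly of_int q8" "q8_cubic \<alpha> dvd map_poly of_int q8" unfolding fac by simp_all
    show "coprime (degree (q8_quadratic \<alpha>)) (degree (q8_cubic \<alpha>))" by (simp add: q8_quadratic_def q8_cubic_def)
  qed (rule factors_fixed; assumption)+
  show "\<not> subfields_isomorphic (rat_adjoin \<alpha>) (rat_adjoin \<beta>)"
    by (rule not_isomorphicI[OF roots(2)])
       (simp add: fac no_root_q8_quadratic[OF alg roots(1)] no_root_q8_cubic[OF alg roots(1)] no_root_q8_cubic'[OF alg roots(1)])
qed

theorem claim1p2:
  assumes algebraic_closure: "\<And>x :: 'q :: {alg_closed_field, field_char_0}. algebraic x"
  shows
    "(\<forall>\<alpha> \<beta> :: 'q.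
        \<alpha> ^ 7 - 7 * \<alpha> + 3 = 0 \<longrightarrow>
        \<beta> ^ 7 + 14 * \<beta> ^ 4 - 42 * \<beta> ^ 2 - 21 * \<beta> + 9 = 0 \<longrightarrow>
        number_field (rat_adjoin \<alpha>) \<and> number_field (rat_adjoin \<beta>) \<and>
        sylow_conjugate (rat_adjoin \<alpha>) (rat_adjoin \<beta>) \<and>
        \<not> subfields_isomorphic (rat_adjoin \<alpha>) (rat_adjoin \<beta>)) \<and>
     (\<forall>\<alpha> \<beta> :: 'q.
        \<alpha> ^ 8 - 4 * \<alpha> ^ 7 - 4 * \<alpha> ^ 6 + 26 * \<alpha> ^ 5 + 2 * \<alpha> ^ 4 - 52 * \<alpha> ^ 3 + 31 * \<alpha> + 1 = 0 \<longrightarrow>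
        \<beta> ^ 8 + 12 * \<beta> ^ 7 + 30 * \<beta> ^ 6 - 108 * \<beta> ^ 5 - 402 * \<beta> ^ 4 + 342 * \<beta> ^ 3 + 1256 * \<beta> ^ 2
          - 687 * \<beta> - 337 = 0 \<longrightarrow>
        number_field (rat_adjoin \<alpha>) \<and> number_field (rat_adjoin \<beta>) \<and>
        sylow_conjugate (rat_adjoin \<alpha>) (rat_adjoin \<beta>) \<and>
        \<not> subfields_isomorphic (rat_adjoin \<alpha>) (rat_adjoin \<beta>))"
proof -
  note vals = int_poly_val_polys[where ?'q = 'q, symmetric]
  show ?thesis
    unfolding vals
    using number_field_rat_adjoin[OF algebraic_closure] fields_a[OF algebraic_closure] fields_b[OF algebraic_closure]
    by blast
qed

end
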